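(* Let $f\in\mathbb{R}[x_1,\ldots,x_n]$ be of degree $2r_f$, with global minimum $f^*:=\inf_{x\in\mathbb{R}^n}f(x)>-\infty$, and let $M>0$ be a fixed integer. Let $\mathcal{P}_M$, $\mathbb{Q}_r$ and $\mathbb{Q}_r^*$ be the optimization problems defined in the context. Then: (i) For every integer $r\ge r_f$, $\mathbb{Q}_r$ is solvable, and $\min\mathbb{Q}_r\uparrow\inf\mathcal{P}_M$ as $r\to\infty$. (ii) For each $r\ge r_f$ let $\mathbf{y}^{(r)}=\{y^{(r)}_\alpha\}$ be an optimal solution of $\mathbb{Q}_r$, completed with zeros to make it a bounded infinite sequence indexed by $\alpha\in\mathbb{N}^n$. Every pointwise accumulation point $\mathbf{y}^*$ of the sequence $\{\mathbf{y}^{(r)}\}_{r}$ is a determinate moment sequence, that is, $$y^*_\alpha=\int_{\mathbb{R}^n}x^\alpha\,d\mu^*,\qquad\alpha\in\mathbb{N}^n,$$ for a unique probability measure $\mu^*$, and $\mu^*$ is an optimal solution of $\mathcal{P}_M$. (iii) For every integer $r\ge r_f$, $\mathbb{Q}_r^*$ is solvable and $\max\mathbb{Q}^*_r=\min\mathbb{Q}_r$.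
   Context: Notation: $\mathbb{N}=\{0,1,2,\ldots\}$; $|\alpha|=\alpha_1+\cdots+\alpha_n$ for $\alpha\in\mathbb{N}^n$; $f=\sum_\alpha f_\alpha x^\alpha$. For a real family $\mathbf{y}=\{y_\alpha\}$ indexed by exponents $\alpha$ (with at least all $|\alpha|\le 2r$ present), $L_{\mathbf{y}}(p):=\sum_\alpha p_\alpha y_\alpha$ for a polynomial $p=\sum_\alpha p_\alpha x^\alpha$; the moment matrix $M_r(\mathbf{y})$ is the symmetric matrix with rows and columns indexed by $\{\alpha\in\mathbb{N}^n:|\alpha|\le r\}$ and $(\alpha,\beta)$ entry $y_{\alpha+\beta}$; and $y^{(i)}_{2k}:=L_{\mathbf{y}}(x_i^{2k})$ is the entry of $\mathbf{y}$ corresponding to the monomial $x_i^{2k}$ (so $y^{(i)}_0=y_0$). $A\succeq 0$ means $A$ is positive semidefinite. "s.o.s." means a finite sum of squares of real polynomials. Problem $\mathcal{P}_M$: with $\mathcal{P}(\mathbb{R}^n)$ the set of Borel probability measures on $\mathbb{R}^n$, $$\mathcal{P}_M:\quad\inf_{\mu\in\mathcal{P}(\mathbb{R}^n)}\left\{\int f\,d\mu \;\Big|\; \int\sum_{i=1}^n e^{x_i^2}\,d\mu\le n e^{M^2}\right\}.$$ Problem $\mathbb{Q}_r$ (for $r\ge r_f$), over $\mathbf{y}=\{y_\alpha\}_{|\alpha|\le 2r}$: $$\mathbb{Q}_r:\quad\min_{\mathbf{y}}\ L_{\mathbf{y}}(f)\quad\text{s.t.}\quad M_r(\mathbf{y})\succeq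 0,\quad \sum_{k=0}^r\sum_{i=1}^n\frac{y^{(i)}_{2k}}{k!}\le n e^{M^2},\quad y_0=1.$$ Dual problem $\mathbb{Q}_r^*$, over $\lambda\ge 0$, $\gamma\in\mathbb{R}$ and polynomials $q$: $$\mathbb{Q}_r^*:\quad\max_{\lambda\ge0,\gamma,q}\ \gamma-n e^{M^2}\lambda\quad\text{s.t.}\quad f-\gamma=q-\lambda\sum_{k=0}^r\sum_{j=1}^n\frac{x_j^{2k}}{k!},\quad q\ \text{s.o.s. of degree}\le 2r.$$ The optimal values are written $\inf\mathcal{P}_M$, $\inf\mathbb{Q}_r$, $\sup\mathbb{Q}_r^*$; one writes $\min$ or $\max$ instead when the optimum is attained, in which case the problem is called solvable. The symbol $\uparrow$ denotes monotone nondecreasing convergence. A pointwise accumulation point of $\{\mathbf{y}^{(r)}\}_r$ is a sequence $\mathbf{y}^*$ such that along some subsequence $r_k\to\infty$ one has $y^{(r_k)}_\alpha\to y^*_\alpha$ for every $\alpha\in\mathbb{N}^n$. A sequence $\mathbf{y}$ indexed by $\mathbb{N}^n$ is a moment sequence if it has a representing measure, i.e. a (nonnegative Borel) measure $\mu$ on $\mathbb{R}^n$ with $y_\alpha=\int x^\alpha d\mu$ for all $\alpha$; it is determinate if this measure is unique. *)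

theory Defs
  imports "HOL-Probability.Probability" "HOL-Library.Poly_Mapping"
begin

text \<open>An exponent is a finitely supported function from variables to naturals, and a polynomial is a
  finitely supported family of real coefficients. The ring structure of \<open>'n mpoly\<close> is the
  convolution product on \<open>poly_mapping\<close>.\<close>

type_synonym 'n expo = "'n \<Rightarrow>\<^sub>0 nat"
type_synonym 'n mpoly = "'n expo \<Rightarrow>\<^sub>0 real"

abbreviation coeff :: "'n mpoly \<Rightarrow> 'n expo \<Rightarrow> real" where
  "coeff \<equiv> Poly_Mapping.lookup"

definition expo_deg :: "'n::finite expo \<Rightarrow> nat" where
  "expo_deg \<alpha> = (\<Sum>i\<in>UNIV. Poly_Mapping.lookup \<alpha> i)"

definition expos :: "nat \<Rightarrow> 'n::finite expo set" where
  "expos d = {\<alpha>. expo_deg \<alpha> \<le> d}"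

text \<open>The zero polynomial is given degree 0.\<close>

definition total_degree :: "'n::finite mpoly \<Rightarrow> nat" where
  "total_degree p = Max (insert 0 (expo_deg ` Poly_Mapping.keys p))"

definition monomial_fun :: "'n::finite expo \<Rightarrow> real^'n \<Rightarrow> real" where
  "monomial_fun \<alpha> x = (\<Prod>i\<in>UNIV. (x $ i) ^ Poly_Mapping.lookup \<alpha> i)"

definition poly_fun :: "'n::finite mpoly \<Rightarrow> real^'n \<Rightarrow> real" where
  "poly_fun p x = (\<Sum>\<alpha>\<in>Poly_Mapping.keys p. coeff p \<alpha> * monomial_fun \<alpha> x)"

definition const_poly :: "real \<Rightarrow> 'n mpoly" where
  "const_poly c = Poly_Mapping.single 0 c"

definition var_pow :: "'n \<Rightarrow> nat \<Rightarrow> 'n expo" where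
  "var_pow i k = Poly_Mapping.single i k"

definition sos :: "'n mpoly \<Rightarrow> bool" where
  "sos q \<longleftrightarrow> (\<exists>(m::nat) g. q = (\<Sum>i<m. (g i)\<^sup>2))"

definition riesz :: "('n expo \<Rightarrow> real) \<Rightarrow> 'n mpoly \<Rightarrow> real" where
  "riesz y p = (\<Sum>\<alpha>\<in>Poly_Mapping.keys p. coeff p \<alpha> * y \<alpha>)"

definition moment_matrix :: "('n expo \<Rightarrow> real) \<Rightarrow> 'n expo \<Rightarrow> 'n expo \<Rightarrow> real" where
  "moment_matrix y \<alpha> \<beta> = y (\<alpha> + \<beta>)"

definition psd_on :: "'a set \<Rightarrow> ('a \<Rightarrow> 'a \<Rightarrow> real) \<Rightarrow> bool" where
  "psd_on I A \<longleftrightarrow> (\<forall>a\<in>I. \<forall>b\<in>I. A a b = A b a) \<and>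
     (\<forall>v. (\<Sum>a\<in>I. \<Sum>b\<in>I. v a * A a b * v b) \<ge> 0)"

definition represents :: "(real^'n::finite) measure \<Rightarrow> ('n expo \<Rightarrow> real) \<Rightarrow> bool" where
  "represents \<mu> y \<longleftrightarrow> sets \<mu> = sets borel \<and>
     (\<forall>\<alpha>. integrable \<mu> (monomial_fun \<alpha>) \<and> y \<alpha> = (\<integral>x. monomial_fun \<alpha> x \<partial>\<mu>))"

definition moment_seq :: "('n::finite expo \<Rightarrow> real) \<Rightarrow> bool" where
  "moment_seq y \<longleftrightarrow> (\<exists>\<mu>. represents \<mu> y)"

definition determinate :: "('n::finite expo \<Rightarrow> real) \<Rightarrow> bool" where
  "determinate y \<longleftrightarrow> (\<exists>!\<mu>. represents \<mu> y)"

definition accumulation_point :: "(nat \<Rightarrow> 'a \<Rightarrow> real) \<Rightarrow> ('a \<Rightarrow> real) \<Rightarrow> bool" where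
  "accumulation_point Y y \<longleftrightarrow>
     (\<exists>s. strict_mono s \<and> (\<forall>\<alpha>. (\<lambda>k. Y (s k) \<alpha>) \<longlonglongrightarrow> y \<alpha>))"

text \<open>Optimal values are extended reals, so that they are meaningful before feasibility or
  boundedness is known.\<close>

definition bound :: "'n::finite itself \<Rightarrow> int \<Rightarrow> real" where
  "bound _ M = real CARD('n) * exp ((real_of_int M)\<^sup>2)"

text \<open>The constraint of the problem \<open>P\<close> is a Lebesgue integral of a nonnegative function with values
  in \<open>[0, \<infinity>]\<close>. On its feasible measures every monomial is integrable, so the Bochner
  integral in the objective is the true integral.\<close>

definition P_feasible :: "int \<Rightarrow> (real^'n::finite) measure set" where
  "P_feasible M = {\<mu>. prob_space \<mu> \<and> sets \<mu> = sets borel \<and>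
     (\<integral>\<^sup>+x. ennreal (\<Sum>i\<in>UNIV. exp ((x $ i)\<^sup>2)) \<partial>\<mu>) \<le> ennreal (bound TYPE('n) M)}"

definition P_obj :: "'n::finite mpoly \<Rightarrow> (real^'n) measure \<Rightarrow> real" where
  "P_obj f \<mu> = (\<integral>x. poly_fun f x \<partial>\<mu>)"

definition P_value :: "'n::finite mpoly \<Rightarrow> int \<Rightarrow> ereal" where
  "P_value f M = (INF \<mu>\<in>P_feasible M. ereal (P_obj f \<mu>))"

definition P_optimal :: "'n::finite mpoly \<Rightarrow> int \<Rightarrow> (real^'n) measure \<Rightarrow> bool" where
  "P_optimal f M \<mu> \<longleftrightarrow> \<mu> \<in> P_feasible M \<and> ereal (P_obj f \<mu>) = P_value f M"

text \<open>A family indexed by the exponents of degree at most \<open>2r\<close> is encoded as its completion by zeros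
  to a function on all exponents.\<close>

definition Q_feasible :: "int \<Rightarrow> nat \<Rightarrow> ('n::finite expo \<Rightarrow> real) set" where
  "Q_feasible M r = {y. (\<forall>\<alpha>. \<alpha> \<notin> expos (2 * r) \<longrightarrow> y \<alpha> = 0) \<and>
     psd_on (expos r) (moment_matrix y) \<and>
     (\<Sum>k\<le>r. \<Sum>i\<in>UNIV. y (var_pow i (2 * k)) / fact k) \<le> bound TYPE('n) M \<and>
     y 0 = 1}"

definition Q_value :: "'n::finite mpoly \<Rightarrow> int \<Rightarrow> nat \<Rightarrow> ereal" where
  "Q_value f M r = (INF y\<in>Q_feasible M r. ereal (riesz y f))"

definition Q_optimal :: "'n::finite mpoly \<Rightarrow> int \<Rightarrow> nat \<Rightarrow> ('n expo \<Rightarrow> real) \<Rightarrow> bool" where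
  "Q_optimal f M r y \<longleftrightarrow> y \<in> Q_feasible M r \<and> ereal (riesz y f) = Q_value f M r"

definition theta :: "nat \<Rightarrow> 'n::finite mpoly" where
  "theta r = (\<Sum>k\<le>r. \<Sum>j\<in>UNIV. Poly_Mapping.single (var_pow j (2 * k)) (1 / fact k))"

definition D_feasible :: "'n::finite mpoly \<Rightarrow> nat \<Rightarrow> (real \<times> real \<times> 'n mpoly) set" where
  "D_feasible f r = {(l, g, q). 0 \<le> l \<and> f - const_poly g = q - const_poly l * theta r \<and>
     sos q \<and> total_degree q \<le> 2 * r}"

definition D_obj :: "int \<Rightarrow> real \<times> real \<times> 'n::finite mpoly \<Rightarrow> real" where
  "D_obj M = (\<lambda>(l, g, q). g - bound TYPE('n) M * l)"

definition D_value :: "'n::finite mpoly \<Rightarrow> int \<Rightarrow> nat \<Rightarrow> ereal" where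
  "D_value f M r = (SUP d\<in>D_feasible f r. ereal (D_obj M d))"

definition D_optimal ::
    "'n::finite mpoly \<Rightarrow> int \<Rightarrow> nat \<Rightarrow> real \<times> real \<times> 'n mpoly \<Rightarrow> bool" where
  "D_optimal f M r d \<longleftrightarrow> d \<in> D_feasible f r \<and> ereal (D_obj M d) = D_value f M r"

end

theory Submission
  imports Defs
begin

text \<open>Feasible points of the relaxations satisfy \<open>y (2\<alpha>) \<le> b |\<alpha>|!\<close> with \<open>b = n exp (M\<^sup>2)\<close>, so each
  feasible set is compact and optimal solutions accumulate pointwise. For duality, \<open>f\<close> minus the
  optimal value is projected onto the cone generated by the Gram matrices and the slack polynomial
  \<open>b - \<theta>\<^sub>r\<close>. That cone is closed since it has a compact base avoiding 0, and the residual of the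
  projection, if nonzero, is a functional contradicting optimality.

  A limit point \<open>y\<close> is positive on squares and extends to products of power series of exponential
  type, in particular to \<open>sin (\<epsilon> x\<^sub>i)\<close>. There \<open>1 \<plusminus> sin (\<epsilon> x) = (cos (\<epsilon> x / 2) \<plusminus> sin (\<epsilon> x / 2))\<^sup>2\<close> makes
  Bernstein weights squares, so that evaluating the functional on them gives finitely supported probability
  measures whose moments tend to \<open>y\<close> as \<open>\<epsilon> \<rightarrow> 0\<close>. Transporting them to the line along a
  space-filling curve, Helly's theorem yields a weak limit representing \<open>y\<close>. The same discrete
  measures depend on \<open>y\<close> only and converge weakly to every representing measure, hence determinacy.\<close>

subsection \<open>Positive semidefinite matrices on finite index sets\<close>

text \<open>Positivity of a limit sequence is available on squares only, and in several variables a
  nonnegative polynomial need not be a sum of squares, so Haviland's criterion does not apply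
  directly. The factorial bound is what helps: it makes \<open>y \<alpha>\<close> at most of order
  \<open>sqrt (fact |\<alpha>|)\<close>, so power series with coefficients of order
  \<open>R ^ k / fact k\<close> may replace polynomials, and among those there are enough squares
  for a partition of unity. The factorials stem from the weights \<open>1 / fact k\<close> in
  \<open>theta\<close>, that is, from the Taylor series of \<open>exp (x\<^sup>2)\<close>. Helly's
  theorem concerns distribution functions on the line. The curve enters only as a continuous
  surjection with a right inverse of linear growth; the inverse needs no regularity, because it is
  applied to discrete measures alone. In the duality, \<open>M > 0\<close> enters as
  \<open>b > n\<close>: the slack polynomial then has the positive constant coefficient
  \<open>b - n\<close>, and this keeps the base of the cone away from 0.\<close>

lemma sum_two_point:
  fixes A :: "'a \<Rightarrow> 'a \<Rightarrow> real"
  assumes "finite I" "a \<in> I" "b \<in> I"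
  shows "(\<Sum>x\<in>I. \<Sum>z\<in>I. ((if x = a then s else 0) + (if x = b then t else 0)) * A x z *
      ((if z = a then s else 0) + (if z = b then t else 0)))
    = s\<^sup>2 * A a a + s * t * A a b + t * s * A b a + t\<^sup>2 * A b b"
proof -
  have delta: "(\<Sum>x\<in>I. f x * (if x = c then u else 0)) = f c * u" if "c \<in> I"
    for f :: "'a \<Rightarrow> real" and c u
  proof -
    have "(\<Sum>x\<in>I. f x * (if x = c then u else 0)) = (\<Sum>x\<in>I. if x = c then f c * u else 0)"
      by (rule sum.cong) auto
    then show ?thesis using assms(1) that by simp
  qed
  have inner: "(\<Sum>z\<in>I. c * A x z * ((if z = a then s else 0) + (if z = b then t else 0)))
      = c * (A x a * s + A x b * t)" for c x
    using delta[OF assms(2), of "\<lambda>z. c * A x z"] delta[OF assms(3), of "\<lambda>z. c * A x z"]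
    by (simp add: distrib_left sum.distrib)
  have "(\<Sum>x\<in>I. ((if x = a then s else 0) + (if x = b then t else 0)) * (A x a * s + A x b * t))
      = (\<Sum>x\<in>I. (A x a * s + A x b * t) * (if x = a then s else 0))
        + (\<Sum>x\<in>I. (A x a * s + A x b * t) * (if x = b then t else 0))"
    unfolding sum.distrib[symmetric] by (rule sum.cong) (auto simp: algebra_simps)
  then show ?thesis
    unfolding inner delta[OF assms(2)] delta[OF assms(3)]
    by (simp add: power2_eq_square algebra_simps)
qed

lemma psd_on_form2:
  assumes "psd_on I A" "finite I" "a \<in> I" "b \<in> I"
  shows "0 \<le> s\<^sup>2 * A a a + 2 * s * t * A a b + t\<^sup>2 * A b b"
proof -
  have "0 \<le> (\<Sum>x\<in>I. \<Sum>z\<in>I. ((if x = a then s else 0) + (if x = b then t else 0)) * A x z *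
      ((if z = a then s else 0) + (if z = b then t else 0)))"
    using assms(1) unfolding psd_on_def by (elim conjE allE) assumption
  moreover have "A b a = A a b"
    using assms unfolding psd_on_def by blast
  ultimately show ?thesis
    unfolding sum_two_point[OF assms(2-4)] by (simp add: algebra_simps)
qed

lemma psd_on_diag_nonneg:
  assumes "psd_on I A" "finite I" "a \<in> I"
  shows "0 \<le> A a a"
  using psd_on_form2[OF assms(1,2,3,3), of 1 0] by simp

lemma psd_on_cauchy:
  assumes "psd_on I A" "finite I" "a \<in> I" "b \<in> I"
  shows "(A a b)\<^sup>2 \<le> A a a * A b b"
proof (cases "A b b = 0")
  case True
  have aa: "0 \<le> A a a" using psd_on_diag_nonneg[OF assms(1-3)] .
  \<comment> \<open>With \<open>A b b = 0\<close> the form is affine in the second weight; the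
    weight \<open>- (A a a + 1)\<close> makes it equal to
    \<open>- ((A a b)\<^sup>2 * (A a a + 2))\<close>, so nonnegativity forces
    \<open>A a b = 0\<close>.\<close>
  have "0 \<le> (A a b)\<^sup>2 * A a a + 2 * A a b * (- (A a a + 1)) * A a b"
    using psd_on_form2[OF assms, of "A a b" "- (A a a + 1)"] True by simp
  also have "\<dots> = - ((A a b)\<^sup>2 * (A a a + 2))"
    by (simp add: power2_eq_square algebra_simps)
  finally have "(A a b)\<^sup>2 * (A a a + 2) \<le> 0" by simp
  hence "A a b = 0"
    using aa by (simp add: mult_le_0_iff)
  then show ?thesis using True by simp
next
  case False
  hence pos: "A b b > 0" using psd_on_diag_nonneg[OF assms(1,2,4)] by simp
  \<comment> \<open>For a fixed first weight the second one minimises the form; the value is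
    \<open>A b b\<close> times the determinant of the 2 by 2 minor.\<close>
  have "0 \<le> (A b b)\<^sup>2 * A a a + 2 * A b b * (- A a b) * A a b + (- A a b)\<^sup>2 * A b b"
    by (rule psd_on_form2[OF assms])
  also have "\<dots> = A b b * (A a a * A b b - (A a b)\<^sup>2)"
    by (simp add: power2_eq_square algebra_simps)
  finally show ?thesis using pos by (simp add: zero_le_mult_iff)
qed

lemma psd_on_subset:
  fixes A :: "'a \<Rightarrow> 'a \<Rightarrow> real"
  assumes "psd_on I A" "J \<subseteq> I" "finite I"
  shows "psd_on J A"
  unfolding psd_on_def
proof (intro conjI allI)
  show "\<forall>a\<in>J. \<forall>b\<in>J. A a b = A b a" using assms unfolding psd_on_def by blast
next
  fix v :: "'a \<Rightarrow> real"
  have "0 \<le> (\<Sum>a\<in>I. \<Sum>b\<in>I. (if a \<in> J then v a else 0) * A a b * (if b \<in> J then v b else 0))"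
    using assms(1) unfolding psd_on_def by (elim conjE allE) assumption
  also have "\<dots> = (\<Sum>a\<in>J. \<Sum>b\<in>J. v a * A a b * v b)"
    using assms(2,3)
    by (intro sum.mono_neutral_cong_right) (auto intro!: sum.mono_neutral_cong_right)
  finally show "0 \<le> (\<Sum>a\<in>J. \<Sum>b\<in>J. v a * A a b * v b)" .
qed

lemma psd_on_cong:
  assumes "\<And>a b. a \<in> I \<Longrightarrow> b \<in> I \<Longrightarrow> A a b = B a b"
  shows "psd_on I A \<longleftrightarrow> psd_on I B"
  using assms unfolding psd_on_def by (metis (mono_tags, lifting) sum.cong)

subsection \<open>Exponents\<close>

abbreviation expt :: "'n expo \<Rightarrow> 'n \<Rightarrow> nat" where
  "expt \<equiv> Poly_Mapping.lookup"

lemma finite_expos [simp]: "finite (expos d :: 'n::finite expo set)"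
proof (rule finite_imageD)
  have "expt ` (expos d :: 'n expo set) \<subseteq> PiE UNIV (\<lambda>_. {..d})"
  proof -
    have "expt \<alpha> i \<le> d" if "\<alpha> \<in> expos d" for \<alpha> :: "'n expo" and i
      using member_le_sum[of i UNIV "expt \<alpha>"] that
      by (auto simp: expos_def expo_deg_def)
    then show ?thesis by (auto simp: PiE_def)
  qed
  then show "finite (expt ` (expos d :: 'n expo set))"
    by (rule finite_subset) (simp add: finite_PiE)
  show "inj_on expt (expos d :: 'n expo set)"
    by (simp add: inj_on_def)
qed

lemma expo_deg_add [simp]: "expo_deg (\<alpha> + \<beta>) = expo_deg \<alpha> + expo_deg \<beta>"
  by (simp add: expo_deg_def lookup_add sum.distrib)

lemma expo_deg_zero [simp]: "expo_deg 0 = 0"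
  by (simp add: expo_deg_def)

lemma lookup_var_pow: "expt (var_pow i k) j = (if i = j then k else 0)"
  by (simp add: var_pow_def lookup_single when_def)

lemma expo_deg_var_pow [simp]: "expo_deg (var_pow (i::'n::finite) k) = k"
  by (simp add: expo_deg_def lookup_var_pow)

lemma var_pow_add: "var_pow i j + var_pow i k = var_pow i (j + k)"
  by (simp add: var_pow_def single_add)

lemma var_pow_0 [simp]: "var_pow i 0 = 0"
  by (simp add: var_pow_def)

lemma mem_expos [simp]: "\<alpha> \<in> expos d \<longleftrightarrow> expo_deg \<alpha> \<le> d"
  by (simp add: expos_def)

text \<open>Variables are moved to the first part one at a time. With \<open>m = k = r\<close>,
  every exponent of degree at most \<open>2 * r\<close> becomes a sum of two indices of the moment
  matrix, so Cauchy-Schwarz reaches it.\<close>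

lemma expo_split:
  assumes "expo_deg (\<beta> :: 'n::finite expo) \<le> m + k"
  shows "\<exists>\<alpha> \<gamma>. \<beta> = \<alpha> + \<gamma> \<and> expo_deg \<alpha> \<le> m \<and> expo_deg \<gamma> \<le> k"
  using assms
proof (induction m arbitrary: \<beta>)
  case 0
  then show ?case by (intro exI[of _ 0] exI[of _ \<beta>]) simp
next
  case (Suc m)
  show ?case
  proof (cases "\<beta> = 0")
    case True
    then show ?thesis by (intro exI[of _ 0]) simp
  next
    case False
    then obtain i where i: "expt \<beta> i \<noteq> 0"
      by (metis lookup_zero poly_mapping_eqI)
    define \<beta>' where "\<beta>' = \<beta> - var_pow i 1"
    have eq: "\<beta> = \<beta>' + var_pow i 1"
      using i by (intro poly_mapping_eqI) (auto simp: \<beta>'_def lookup_add lookup_minus lookup_var_pow)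
    have "expo_deg \<beta>' \<le> m + k" using Suc.prems unfolding eq by simp
    from Suc.IH[OF this] obtain \<alpha> \<gamma> where
      "\<beta>' = \<alpha> + \<gamma>" "expo_deg \<alpha> \<le> m" "expo_deg \<gamma> \<le> k" by blast
    then show ?thesis using eq
      by (intro exI[of _ "\<alpha> + var_pow i 1"] exI[of _ \<gamma>]) (simp add: ac_simps)
  qed
qed

lemma var_pow_eq_0_iff [simp]: "var_pow i k = 0 \<longleftrightarrow> k = 0"
  unfolding var_pow_def by (metis lookup_single_eq lookup_zero single_zero)

lemma expo_add_eq_0_iff: "\<alpha> + \<beta> = 0 \<longleftrightarrow> \<alpha> = 0 \<and> \<beta> = 0" for \<alpha> \<beta> :: "'n expo"
  by (auto simp: poly_mapping_eq_iff lookup_add fun_eq_iff)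

lemma expo_double_eq_iff: "b + b = c + c \<longleftrightarrow> b = c" for b c :: "'n expo"
proof
  assume eq: "b + b = c + c"
  show "b = c"
  proof (rule poly_mapping_eqI)
    fix k show "expt b k = expt c k"
      using arg_cong[OF eq, of "\<lambda>p. expt p k"] by (simp add: lookup_add)
  qed
qed simp

text \<open>A strictly convex function on exponents, integer-valued so that differences of exponents
  can be squared. A maximiser over a finite set is never the midpoint of two distinct members of the
  set; it stands in for a vertex of a Newton polytope.\<close>

definition expo_sq :: "'n::finite expo \<Rightarrow> int" where
  "expo_sq \<alpha> = (\<Sum>i\<in>UNIV. (int (expt \<alpha> i))\<^sup>2)"

text \<open>The parallelogram law: \<open>2 * (expo_sq \<beta> + expo_sq \<gamma>)\<close> exceeds
  \<open>4 * expo_sq \<alpha>\<close> by the squared distance of \<beta> and \<gamma>, so the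
  midpoint lies strictly below the average.\<close>

lemma expo_sq_parallelogram:
  fixes \<alpha> \<beta> \<gamma> :: "'n::finite expo"
  assumes "\<beta> + \<gamma> = \<alpha> + \<alpha>" "\<beta> \<noteq> \<gamma>"
  shows "expo_sq \<alpha> < expo_sq \<beta> \<or> expo_sq \<alpha> < expo_sq \<gamma>"
proof -
  have sum: "int (expt \<beta> i) + int (expt \<gamma> i)
      = 2 * int (expt \<alpha> i)" for i
    using arg_cong[OF assms(1), of "\<lambda>p. expt p i"] by (simp add: lookup_add)
  obtain i where i: "expt \<beta> i \<noteq> expt \<gamma> i"
    using assms(2) by (metis poly_mapping_eqI)
  have pt: "2 * ((int (expt \<beta> j))\<^sup>2 + (int (expt \<gamma> j))\<^sup>2)
      = 4 * (int (expt \<alpha> j))\<^sup>2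
        + (int (expt \<beta> j) - int (expt \<gamma> j))\<^sup>2" for j
  proof -
    have "4 * (int (expt \<alpha> j))\<^sup>2
        = (int (expt \<beta> j) + int (expt \<gamma> j))\<^sup>2"
      unfolding sum by (simp add: power2_eq_square)
    then show ?thesis by (simp add: power2_eq_square algebra_simps)
  qed
  have "2 * (expo_sq \<beta> + expo_sq \<gamma>) = 4 * expo_sq \<alpha>
      + (\<Sum>j\<in>UNIV. (int (expt \<beta> j) - int (expt \<gamma> j))\<^sup>2)"
    unfolding expo_sq_def by (simp only: sum.distrib[symmetric] sum_distrib_left pt)
  moreover have "(\<Sum>j\<in>UNIV. (int (expt \<beta> j) - int (expt \<gamma> j))\<^sup>2) > 0"
    using i by (intro sum_pos2[of _ i]) auto
  ultimately have "4 * expo_sq \<alpha> < 2 * (expo_sq \<beta> + expo_sq \<gamma>)" by simp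
  then show ?thesis by arith
qed

subsection \<open>Bounds on truncated moment sequences\<close>

lemma moment_cauchy:
  assumes "psd_on (expos r) (moment_matrix y)" "expo_deg \<alpha> \<le> r" "expo_deg \<beta> \<le> r"
  shows "(y (\<alpha> + \<beta>))\<^sup>2 \<le> y (\<alpha> + \<alpha>) * y (\<beta> + \<beta>)"
  using psd_on_cauchy[OF assms(1), of \<alpha> \<beta>] assms(2,3) by (simp add: moment_matrix_def)

lemma moment_diag_nonneg:
  assumes "psd_on (expos r) (moment_matrix y)" "expo_deg \<alpha> \<le> r"
  shows "0 \<le> y (\<alpha> + \<alpha>)"
  using psd_on_diag_nonneg[OF assms(1), of \<alpha>] assms(2) by (simp add: moment_matrix_def)

text \<open>If \<open>\<alpha>\<close> maximises \<open>y (2\<alpha>)\<close> among the exponents of its degree and involves two variables, shifting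
  weight between them in either direction gives two maximisers, one of which has a larger sum of
  squares. So a maximiser with maximal sum of squares is a pure power.\<close>

lemma moment_diag_le_pure_powers:
  fixes y :: "'n::finite expo \<Rightarrow> real"
  assumes psd: "psd_on (expos r) (moment_matrix y)" and deg: "expo_deg \<alpha> \<le> r"
    and B: "\<And>i. y (var_pow i (2 * expo_deg \<alpha>)) \<le> B"
  shows "y (\<alpha> + \<alpha>) \<le> B"
proof -
  define d where "d = expo_deg \<alpha>"
  define D where "D = {\<beta> :: 'n expo. expo_deg \<beta> = d}"
  have "D \<subseteq> expos d" by (auto simp: D_def)
  then have finD: "finite D" by (rule finite_subset) simp
  have neD: "D \<noteq> {}" by (auto simp: D_def d_def)
  define Y where "Y \<beta> = y (\<beta> + \<beta>)" for \<beta>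
  define m where "m = Max (Y ` D)"
  have le_m: "Y \<beta> \<le> m" if "\<beta> \<in> D" for \<beta>
    unfolding m_def using finD that by simp
  have "m \<in> Y ` D" unfolding m_def using finD neD by (intro Max_in) auto
  then have neE: "{\<beta> \<in> D. Y \<beta> = m} \<noteq> {}" by auto
  have finE: "finite {\<beta> \<in> D. Y \<beta> = m}" using finD by simp
  have "Max (expo_sq ` {\<beta> \<in> D. Y \<beta> = m}) \<in> expo_sq ` {\<beta> \<in> D. Y \<beta> = m}"
    using finE neE by (intro Max_in) auto
  then obtain \<beta> where \<beta>: "\<beta> \<in> D" "Y \<beta> = m"
    and sq: "expo_sq \<beta> = Max (expo_sq ` {\<beta> \<in> D. Y \<beta> = m})"
    by auto
  have max: "expo_sq \<gamma> \<le> expo_sq \<beta>" if "\<gamma> \<in> D" "Y \<gamma> = m" for \<gamma>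
    unfolding sq using finE that by (intro Max_ge) auto
  have nonneg: "0 \<le> Y \<gamma>" if "\<gamma> \<in> D" for \<gamma>
    using moment_diag_nonneg[OF psd, of \<gamma>] that deg by (simp add: D_def d_def Y_def)
  have B0: "0 \<le> B"
    using B[of undefined] nonneg[of "var_pow undefined d"]
    by (simp add: Y_def D_def d_def var_pow_add mult_2)
  have "m \<le> B"
  proof (cases "m \<le> 0")
    case True
    then show ?thesis using B0 by simp
  next
    case False
    have "\<exists>i. \<beta> = var_pow i d"
    proof (rule ccontr)
      assume np: "\<not> (\<exists>i. \<beta> = var_pow i d)"
      have "\<exists>i j. i \<noteq> j \<and> expt \<beta> i \<noteq> 0 \<and> expt \<beta> j \<noteq> 0"
      proof (rule ccontr)
        assume a: "\<not> ?thesis"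
        show False
        proof (cases "\<beta> = 0")
          case True
          then have "\<beta> = var_pow undefined d" using \<beta>(1) by (simp add: D_def)
          then show False using np by blast
        next
          case False
          then obtain i where i: "expt \<beta> i \<noteq> 0"
            by (metis lookup_zero poly_mapping_eqI)
          then have o: "expt \<beta> j = 0" if "j \<noteq> i" for j using a that by blast
          have "expo_deg \<beta> = expt \<beta> i"
            unfolding expo_deg_def by (subst sum.remove[of _ i]) (auto simp: o)
          then have "\<beta> = var_pow i d"
            using \<beta>(1) o by (intro poly_mapping_eqI) (auto simp: D_def lookup_var_pow)
          then show False using np by blast
        qed
      qed
      then obtain i j where ij: "i \<noteq> j" "expt \<beta> i \<noteq> 0" "expt \<beta> j \<noteq> 0"
        by blast
      \<comment> \<open>One unit of \<open>i\<close> and one unit of \<open>j\<close> are taken out;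
        returning both units to \<open>i\<close>, or both to \<open>j\<close>, keeps the degree and
        gives two exponents with midpoint \<beta>.\<close>
      define \<rho> where "\<rho> = \<beta> - var_pow i 1 - var_pow j 1"
      have \<rho>: "\<beta> = \<rho> + var_pow i 1 + var_pow j 1"
        using ij by (intro poly_mapping_eqI)
          (auto simp: \<rho>_def lookup_add lookup_minus lookup_var_pow)
      define \<gamma> where "\<gamma> = \<rho> + var_pow i 1 + var_pow i 1"
      define \<gamma>' where "\<gamma>' = \<rho> + var_pow j 1 + var_pow j 1"
      have sum: "\<gamma> + \<gamma>' = \<beta> + \<beta>"
        unfolding \<gamma>_def \<gamma>'_def \<rho> by (simp add: ac_simps)
      have ne: "\<gamma> \<noteq> \<gamma>'"
      proof
        assume "\<gamma> = \<gamma>'"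
        then have "expt \<gamma> i = expt \<gamma>' i" by simp
        then show False using ij(1) by (simp add: \<gamma>_def \<gamma>'_def lookup_add lookup_var_pow)
      qed
      have D: "\<gamma> \<in> D" "\<gamma>' \<in> D" using \<beta>(1) unfolding D_def \<gamma>_def \<gamma>'_def \<rho> by auto
      have "m\<^sup>2 \<le> Y \<gamma> * Y \<gamma>'"
        using moment_cauchy[OF psd, of \<gamma> \<gamma>'] D deg \<beta>(2) unfolding sum Y_def
        by (simp add: D_def d_def)
      moreover have "Y \<gamma> * Y \<gamma>' \<le> Y \<gamma> * m" "Y \<gamma> * Y \<gamma>' \<le> m * Y \<gamma>'"
        using le_m nonneg D by (auto intro: mult_left_mono mult_right_mono)
      \<comment> \<open>Since \<open>m > 0\<close>, cancelling it forces both neighbours to be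
        maximisers too, against the choice of \<beta> by its sum of squares.\<close>
      ultimately have "m * m \<le> m * Y \<gamma>" "m * m \<le> m * Y \<gamma>'"
        unfolding power2_eq_square by (simp_all add: mult.commute)
      then have "m \<le> Y \<gamma>" "m \<le> Y \<gamma>'"
        using False by auto
      then have "Y \<gamma> = m" "Y \<gamma>' = m" using le_m D by (auto intro: antisym)
      then show False
        using expo_sq_parallelogram[OF sum ne] max[of \<gamma>] max[of \<gamma>'] D by auto
    qed
    then obtain i where "\<beta> = var_pow i d" by blast
    then show ?thesis using B[of i] \<beta>(2) by (simp add: Y_def d_def var_pow_add mult_2)
  qed
  then show ?thesis using le_m[of \<alpha>] by (simp add: D_def d_def Y_def)
qed

text \<open>Every summand is a diagonal entry of the moment matrix over a factorial, hence
  nonnegative, so none exceeds the bound on the whole sum.\<close>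

lemma pure_power_le_of_weighted_sum:
  fixes y :: "'n::finite expo \<Rightarrow> real"
  assumes psd: "psd_on (expos r) (moment_matrix y)"
    and c: "(\<Sum>k\<le>r. \<Sum>i\<in>UNIV. y (var_pow i (2 * k)) / fact k) \<le> c" and "k \<le> r"
  shows "y (var_pow i (2 * k)) \<le> c * fact k"
proof -
  have nn: "0 \<le> y (var_pow i (2 * l)) / fact l" if "l \<le> r" for l i
    using moment_diag_nonneg[OF psd, of "var_pow i l"] that by (simp add: var_pow_add mult_2)
  have "y (var_pow i (2 * k)) / fact k \<le> (\<Sum>i\<in>UNIV. y (var_pow i (2 * k)) / fact k)"
    using nn[OF \<open>k \<le> r\<close>] by (intro member_le_sum) auto
  also have "\<dots> \<le> (\<Sum>k\<le>r. \<Sum>i\<in>UNIV. y (var_pow i (2 * k)) / fact k)"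
    using nn \<open>k \<le> r\<close>
    by (intro member_le_sum[of k _ "\<lambda>k. \<Sum>i\<in>UNIV. y (var_pow i (2 * k)) / fact k"])
      (auto intro: sum_nonneg)
  also note c
  finally show ?thesis by (simp add: field_simps)
qed

lemma moment_diag_le:
  fixes y :: "'n::finite expo \<Rightarrow> real"
  assumes psd: "psd_on (expos r) (moment_matrix y)"
    and c: "(\<Sum>k\<le>r. \<Sum>i\<in>UNIV. y (var_pow i (2 * k)) / fact k) \<le> c" and "expo_deg \<alpha> \<le> r"
  shows "y (\<alpha> + \<alpha>) \<le> c * fact (expo_deg \<alpha>)"
  using assms by (intro moment_diag_le_pure_powers[OF psd] pure_power_le_of_weighted_sum[OF psd c])

text \<open>The bound is crude but proportional to \<open>c\<close>. Besides compactness of the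
  feasible sets it shows that a functional with \<open>c = 0\<close> vanishes in degrees up to
  \<open>2 * r\<close>, which settles the degenerate case of the separation argument.\<close>

lemma moment_abs_le:
  fixes y :: "'n::finite expo \<Rightarrow> real"
  assumes psd: "psd_on (expos r) (moment_matrix y)"
    and c: "(\<Sum>k\<le>r. \<Sum>i\<in>UNIV. y (var_pow i (2 * k)) / fact k) \<le> c" and \<beta>: "expo_deg \<beta> \<le> 2 * r"
  shows "\<bar>y \<beta>\<bar> \<le> c * fact r"
proof -
  obtain \<alpha> \<gamma> where s: "\<beta> = \<alpha> + \<gamma>" "expo_deg \<alpha> \<le> r" "expo_deg \<gamma> \<le> r"
    using expo_split[of \<beta> r r] \<beta> by (auto simp: mult_2)
  have *: "0 \<le> y (\<delta> + \<delta>) \<and> y (\<delta> + \<delta>) \<le> c * fact r" if "expo_deg \<delta> \<le> r" for \<delta>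
  proof
    show nn: "0 \<le> y (\<delta> + \<delta>)" by (rule moment_diag_nonneg[OF psd that])
    have le: "y (\<delta> + \<delta>) \<le> c * fact (expo_deg \<delta>)" by (rule moment_diag_le[OF psd c that])
    then have "0 \<le> c * fact (expo_deg \<delta>)" using nn by simp
    moreover have "(0::real) < fact (expo_deg \<delta>)" by simp
    ultimately have "0 \<le> c" by (simp add: zero_le_mult_iff)
    then have "c * fact (expo_deg \<delta>) \<le> c * fact r"
      using that by (intro mult_left_mono fact_mono) auto
    with le show "y (\<delta> + \<delta>) \<le> c * fact r" by simp
  qed
  have "(y \<beta>)\<^sup>2 \<le> y (\<alpha> + \<alpha>) * y (\<gamma> + \<gamma>)"
    unfolding s(1) by (rule moment_cauchy[OF psd s(2,3)])
  also have "\<dots> \<le> (c * fact r) * (c * fact r)"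
    using *[OF s(2)] *[OF s(3)] by (intro mult_mono) auto
  finally have "(y \<beta>)\<^sup>2 \<le> (c * fact r)\<^sup>2" by (simp add: power2_eq_square)
  moreover have "0 \<le> c * fact r" using *[OF s(2)] by linarith
  ultimately show ?thesis by (simp add: abs_le_square_iff[symmetric])
qed

text \<open>Cholesky factorisation by induction over the index set. A zero pivot has a zero row by
  Cauchy-Schwarz and is dropped; otherwise the Schur complement of the pivot is positive
  semidefinite, and the pivot row divided by the root of the pivot supplies one further
  vector.\<close>

lemma psd_on_gram:
  fixes A :: "'a \<Rightarrow> 'a \<Rightarrow> real"
  assumes "finite I" "psd_on I A"
  shows "\<exists>(m::nat) w. \<forall>a\<in>I. \<forall>b\<in>I. A a b = (\<Sum>l<m. w l a * w l b)"
  using assms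
proof (induction I arbitrary: A rule: finite_induct)
  case empty
  then show ?case by simp
next
  case (insert a I)
  have fin: "finite (insert a I)" using insert.hyps by simp
  have sym: "A b c = A c b" if "b \<in> insert a I" "c \<in> insert a I" for b c
    using insert.prems that unfolding psd_on_def by blast
  have form: "0 \<le> (\<Sum>b\<in>insert a I. \<Sum>c\<in>insert a I. v b * A b c * v c)" for v
    using insert.prems unfolding psd_on_def by blast
  show ?case
  proof (cases "A a a = 0")
    case True
    have z: "A a b = 0" if "b \<in> insert a I" for b
      using psd_on_cauchy[OF insert.prems fin, of a b] that True by simp
    have "psd_on I A" using psd_on_subset[OF insert.prems _ fin] by blast
    from insert.IH[OF this] obtain m :: nat and w where
      w: "\<And>b c. b \<in> I \<Longrightarrow> c \<in> I \<Longrightarrow> A b c = (\<Sum>l<m. w l b * w l c)" by blast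
    have "A b c = (\<Sum>l<m. (if b = a then 0 else w l b) * (if c = a then 0 else w l c))"
      if "b \<in> insert a I" "c \<in> insert a I" for b c
    proof (cases "b = a \<or> c = a")
      case True
      then have "A b c = 0" using z that sym[OF that] by metis
      then show ?thesis using True by auto
    next
      case False
      then show ?thesis using that w[of b c] by simp
    qed
    then show ?thesis
      by (intro exI[of _ m] exI[of _ "\<lambda>l b. if b = a then 0 else w l b"]) auto
  next
    case False
    then have pos: "A a a > 0" using psd_on_diag_nonneg[OF insert.prems fin, of a] by simp
    define G where "G b c = A b c - A a b * A a c / A a a" for b c
    have "psd_on I G"
      unfolding psd_on_def
    proof (intro conjI allI)
      show "\<forall>b\<in>I. \<forall>c\<in>I. G b c = G c b" using sym by (simp add: G_def)
      fix v :: "'a \<Rightarrow> real"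
      define S where "S = (\<Sum>b\<in>I. A a b * v b)"
      \<comment> \<open>The value at \<open>a\<close> minimises the form among all extensions of
        \<open>v\<close>; the minimum is the form of the Schur complement.\<close>
      define v' where "v' b = (if b = a then - S / A a a else v b)" for b
      have v'I: "v' b = v b" if "b \<in> I" for b using that insert.hyps by (auto simp: v'_def)
      have v'a: "v' a = - S / A a a" by (simp add: v'_def)
      have row: "(\<Sum>c\<in>insert a I. v' b * A b c * v' c)
          = v' b * A b a * v' a + (\<Sum>c\<in>I. v' b * A b c * v c)" for b
        using insert.hyps v'I by simp
      have S1: "(\<Sum>c\<in>I. v' a * A a c * v c) = v' a * S"
        unfolding S_def by (simp add: sum_distrib_left mult.assoc)
      have S2: "(\<Sum>b\<in>I. v b * A b a * v' a) = v' a * S"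
        unfolding S_def sum_distrib_left using sym by (intro sum.cong) auto
      have "(\<Sum>b\<in>insert a I. \<Sum>c\<in>insert a I. v' b * A b c * v' c)
          = (v' a * A a a * v' a + v' a * S) + (v' a * S + (\<Sum>b\<in>I. \<Sum>c\<in>I. v b * A b c * v c))"
        unfolding row using insert.hyps S1 S2 v'I by (simp add: sum.distrib)
      also have "\<dots> = (\<Sum>b\<in>I. \<Sum>c\<in>I. v b * A b c * v c) - S * S / A a a"
        unfolding v'a using pos by (simp add: field_simps)
      also have "S * S / A a a = (\<Sum>b\<in>I. \<Sum>c\<in>I. v b * (A a b * A a c / A a a) * v c)"
        unfolding S_def sum_product sum_divide_distrib
        by (intro sum.cong) (auto simp: ac_simps)
      also have "(\<Sum>b\<in>I. \<Sum>c\<in>I. v b * A b c * v c) - \<dots> = (\<Sum>b\<in>I. \<Sum>c\<in>I. v b * G b c * v c)"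
        unfolding G_def sum_subtractf[symmetric] by (simp add: algebra_simps)
      finally show "0 \<le> (\<Sum>b\<in>I. \<Sum>c\<in>I. v b * G b c * v c)" using form[of v'] by simp
    qed
    from insert.IH[OF this] obtain m :: nat and w where
      w: "\<And>b c. b \<in> I \<Longrightarrow> c \<in> I \<Longrightarrow> G b c = (\<Sum>l<m. w l b * w l c)" by blast
    define w' where "w' l b = (if l = m then A a b / sqrt (A a a) else if b = a then 0 else w l b)"
      for l b
    have "A b c = (\<Sum>l<Suc m. w' l b * w' l c)"
      if bc: "b \<in> insert a I" "c \<in> insert a I" for b c
    proof -
      have "(\<Sum>l<Suc m. w' l b * w' l c) = A a b * A a c / A a a
          + (\<Sum>l<m. (if b = a then 0 else w l b) * (if c = a then 0 else w l c))"
        using pos by (simp add: w'_def)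
      moreover have "(\<Sum>l<m. (if b = a then 0 else w l b) * (if c = a then 0 else w l c))
          = A b c - A a b * A a c / A a a"
      proof (cases "b = a \<or> c = a")
        case True
        then show ?thesis using pos sym[of a b] bc by auto
      next
        case False
        then show ?thesis using w[of b c] bc by (simp add: G_def)
      qed
      ultimately show ?thesis by simp
    qed
    then show ?thesis by (intro exI[of _ "Suc m"] exI[of _ w']) blast
  qed
qed

subsection \<open>Compactness and separation of cones in function spaces\<close>

lemma compact_box: "compact {y :: 'a \<Rightarrow> real. \<forall>a. \<bar>y a\<bar> \<le> R a}"
proof -
  have eq: "{y :: 'a \<Rightarrow> real. \<forall>a. \<bar>y a\<bar> \<le> R a} = PiE UNIV (\<lambda>a. {- R a..R a})"
    by (auto simp: PiE_def Pi_def abs_le_iff) (metis minus_le_iff)+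
  have "compactin (product_topology (\<lambda>_::'a. euclidean) UNIV) (PiE UNIV (\<lambda>a. {- R a..R a}))"
    by (subst compactin_PiE) (simp add: compactin_euclidean_iff)
  then show ?thesis
    unfolding eq by (simp add: euclidean_product_topology compactin_euclidean_iff)
qed

text \<open>The cone over \<open>B\<close> is closed because \<open>B\<close> is compact and no
  element of it vanishes on \<open>E\<close>. So \<open>t\<close> has a nearest point
  \<open>s * c\<close> in the cone for the Euclidean norm of the coordinates in \<open>E\<close>.
  The residual \<open>w\<close> is orthogonal to this point and has nonpositive inner product with
  the cone, hence \<open>- w\<close> separates.\<close>

lemma cone_separation:
  fixes B :: "('a \<Rightarrow> real) set" and t :: "'a \<Rightarrow> real"
  assumes E: "finite E" and B: "compact B" "B \<noteq> {}"
    and conv: "\<And>b c p q. b \<in> B \<Longrightarrow> c \<in> B \<Longrightarrow> 0 \<le> p \<Longrightarrow> 0 \<le> q \<Longrightarrow> p + q = 1 \<Longrightarrow>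
      (\<lambda>x. p * b x + q * c x) \<in> B"
    and nz: "\<And>b. b \<in> B \<Longrightarrow> \<exists>x\<in>E. b x \<noteq> 0"
    and out: "\<And>b s. b \<in> B \<Longrightarrow> 0 \<le> s \<Longrightarrow> \<exists>x\<in>E. t x \<noteq> s * b x"
  shows "\<exists>u. (\<forall>b\<in>B. 0 \<le> (\<Sum>x\<in>E. u x * b x)) \<and> (\<Sum>x\<in>E. u x * t x) < 0"
proof -
  define N where "N w = (\<Sum>x\<in>E. (w x)\<^sup>2)" for w :: "'a \<Rightarrow> real"
  have N_nonneg: "0 \<le> N w" for w unfolding N_def by (simp add: sum_nonneg)
  have N_pos: "0 < N w" if "\<exists>x\<in>E. w x \<noteq> 0" for w
    unfolding N_def using that E by (auto intro!: sum_pos2)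
  have N_lin: "N (\<lambda>x. w x + s * b x) = N w + 2 * s * (\<Sum>x\<in>E. w x * b x) + s\<^sup>2 * N b" for w s b
    unfolding N_def sum_distrib_left sum.distrib[symmetric]
    by (rule sum.cong) (auto simp: power2_eq_square algebra_simps)
  have "continuous_on B N"
    unfolding N_def
    by (intro continuous_intros continuous_on_subset[OF continuous_on_product_coordinates]) auto
  from continuous_attains_inf[OF B this] obtain b0 where
    b0: "b0 \<in> B" "\<And>b. b \<in> B \<Longrightarrow> N b0 \<le> N b" by blast
  define \<kappa> where "\<kappa> = N b0"
  have \<kappa>: "0 < \<kappa>" unfolding \<kappa>_def by (rule N_pos) (rule nz[OF b0(1)])
  \<comment> \<open>For \<open>s \<ge> T\<close> the point \<open>s * b\<close> is no closer to
    \<open>t\<close> than 0 is: its squared norm is at least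
    \<open>s\<^sup>2 * \<kappa> \<ge> 4 * N t\<close>, yet at most twice the squared distance to
    \<open>t\<close> plus \<open>2 * N t\<close>. The nearest point may thus be sought over the
    compact set \<open>{0..T} \<times> B\<close>.\<close>
  define T where "T = 4 * N t / \<kappa> + 1"
  have T: "1 \<le> T" unfolding T_def using \<kappa> N_nonneg[of t] by simp
  have far: "N t \<le> N (\<lambda>x. t x - s * b x)" if "T \<le> s" "b \<in> B" for s b
  proof -
    have "4 * N t \<le> T * \<kappa>" unfolding T_def using \<kappa> by (simp add: field_simps)
    also have "\<dots> \<le> s * \<kappa>" using that \<kappa> by simp
    also have "\<dots> \<le> s * s * \<kappa>" using that T \<kappa> by simp
    also have "\<dots> \<le> s * s * N b"
      unfolding \<kappa>_def using b0(2)[OF that(2)] that T by (intro mult_left_mono) auto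
    also have "s * s * N b = N (\<lambda>x. s * b x)"
      unfolding N_def sum_distrib_left
      by (rule sum.cong) (auto simp: power2_eq_square algebra_simps)
    also have "\<dots> \<le> 2 * N (\<lambda>x. t x - s * b x) + 2 * N t"
      unfolding N_def sum_distrib_left sum.distrib[symmetric]
    proof (rule sum_mono)
      fix x
      have "0 \<le> (2 * t x - s * b x)\<^sup>2" by simp
      then show "(s * b x)\<^sup>2 \<le> 2 * (t x - s * b x)\<^sup>2 + 2 * (t x)\<^sup>2"
        by (simp add: power2_eq_square algebra_simps)
    qed
    finally show ?thesis by simp
  qed
  have cont: "continuous_on ({0..T} \<times> B) (\<lambda>z. N (\<lambda>x. t x - fst z * snd z x))"
    unfolding N_def
    by (intro continuous_intros continuous_on_compose2[OF continuous_on_product_coordinates]) auto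
  have comp: "compact ({0..T} \<times> B)" using B by (intro compact_Times) auto
  have ne: "{0..T} \<times> B \<noteq> {}" using B T by auto
  from continuous_attains_inf[OF comp ne cont] obtain z where z: "z \<in> {0..T} \<times> B"
    "\<And>z'. z' \<in> {0..T} \<times> B \<Longrightarrow> N (\<lambda>x. t x - fst z * snd z x) \<le> N (\<lambda>x. t x - fst z' * snd z' x)"
    by blast
  obtain s c where sc: "z = (s, c)" "0 \<le> s" "c \<in> B" using z(1) by (cases z) auto
  define w where "w x = t x - s * c x" for x
  have w: "w = (\<lambda>x. t x - s * c x)" by (simp add: w_def fun_eq_iff)
  have near: "N w \<le> N (\<lambda>x. t x - s' * b x)" if "0 \<le> s'" "b \<in> B" for s' b
  proof (cases "s' \<le> T")
    case True
    then show ?thesis using z(2)[of "(s', b)"] that sc(1) by (simp add: w)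
  next
    case False
    have "N w \<le> N (\<lambda>x. t x)" using z(2)[of "(0, b)"] that sc(1) T by (simp add: w)
    also have "\<dots> \<le> N (\<lambda>x. t x - s' * b x)" using far[of s' b] False that by simp
    finally show ?thesis .
  qed
  \<comment> \<open>First-order optimality: a linear term dominated by a quadratic one for all small
    positive steps cannot be positive.\<close>
  have small: "x \<le> 0" if "\<delta>0 > 0" "\<And>\<delta>. 0 < \<delta> \<Longrightarrow> \<delta> < \<delta>0 \<Longrightarrow> 2 * \<delta> * x \<le> \<delta>\<^sup>2 * k" "0 \<le> k"
    for x k \<delta>0 :: real
  proof (rule ccontr)
    assume x: "\<not> x \<le> 0"
    define \<delta> where "\<delta> = min (\<delta>0 / 2) (x / (k + 1))"
    have \<delta>: "0 < \<delta>" "\<delta> < \<delta>0" using that x by (auto simp: \<delta>_def)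
    have "\<delta> * k \<le> x / (k + 1) * k" using that by (intro mult_right_mono) (auto simp: \<delta>_def)
    also have "\<dots> \<le> x" using x that by (simp add: field_simps)
    finally have "\<delta> * k < 2 * x" using x by simp
    then have "\<delta> * (\<delta> * k) < \<delta> * (2 * x)" using \<delta> by (intro mult_strict_left_mono)
    then show False using that(2)[OF \<delta>] by (simp add: power2_eq_square algebra_simps)
  qed
  have le: "(\<Sum>x\<in>E. w x * b x) \<le> 0" if b: "b \<in> B" for b
  proof (rule small[of 1 _ "N b"])
    fix \<delta> :: real assume \<delta>: "0 < \<delta>" "\<delta> < 1"
    \<comment> \<open>Chosen so that \<open>(s + \<delta>) * b' = s * c + \<delta> * b\<close>
      pointwise: a step from the nearest point in direction \<open>b\<close> stays in the
      cone.\<close>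
    define b' where "b' x = s / (s + \<delta>) * c x + \<delta> / (s + \<delta>) * b x" for x
    have "b' \<in> B" unfolding b'_def using sc \<delta> b
      by (intro conv) (auto simp: add_divide_distrib[symmetric])
    then have "N w \<le> N (\<lambda>x. t x - (s + \<delta>) * b' x)" using near[of "s + \<delta>" b'] sc \<delta> by simp
    also have "(\<lambda>x. t x - (s + \<delta>) * b' x) = (\<lambda>x. w x + (- \<delta>) * b x)"
      using sc \<delta> by (auto simp: b'_def w_def fun_eq_iff distrib_left)
    also have "N \<dots> = N w + 2 * (- \<delta>) * (\<Sum>x\<in>E. w x * b x) + (- \<delta>)\<^sup>2 * N b"
      by (rule N_lin)
    finally show "2 * \<delta> * (\<Sum>x\<in>E. w x * b x) \<le> \<delta>\<^sup>2 * N b" by simp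
  qed (auto simp: N_nonneg)
  \<comment> \<open>For \<open>s > 0\<close> the nearest point can also be shrunk, so in direction
    \<open>c\<close> the inequality holds both ways.\<close>
  have "s * (\<Sum>x\<in>E. w x * c x) = 0"
  proof (cases "s = 0")
    case False
    have "- (\<Sum>x\<in>E. w x * c x) \<le> 0"
    proof (rule small[of s _ "N c"])
      fix \<delta> :: real assume \<delta>: "0 < \<delta>" "\<delta> < s"
      have "N w \<le> N (\<lambda>x. t x - (s - \<delta>) * c x)" using near[of "s - \<delta>" c] sc \<delta> by simp
      also have "(\<lambda>x. t x - (s - \<delta>) * c x) = (\<lambda>x. w x + \<delta> * c x)"
        by (auto simp: w_def fun_eq_iff algebra_simps)
      also have "N \<dots> = N w + 2 * \<delta> * (\<Sum>x\<in>E. w x * c x) + \<delta>\<^sup>2 * N c"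
        by (rule N_lin)
      finally show "2 * \<delta> * - (\<Sum>x\<in>E. w x * c x) \<le> \<delta>\<^sup>2 * N c" by simp
    qed (use False sc in \<open>auto simp: N_nonneg\<close>)
    then show ?thesis using le[OF sc(3)] by simp
  qed simp
  then have "(\<Sum>x\<in>E. w x * t x) = N w"
  proof -
    assume a: "s * (\<Sum>x\<in>E. w x * c x) = 0"
    have "(\<Sum>x\<in>E. w x * t x) = (\<Sum>x\<in>E. (w x)\<^sup>2 + s * (w x * c x))"
      by (rule sum.cong) (auto simp: w_def power2_eq_square algebra_simps)
    then show ?thesis using a by (simp add: sum.distrib N_def sum_distrib_left)
  qed
  moreover have "0 < N w" using out[OF sc(3,2)] by (intro N_pos) (auto simp: w_def)
  ultimately show ?thesis using le
    by (intro exI[of _ "\<lambda>x. - w x"]) (auto simp: sum_negf)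
qed

subsection \<open>The Riesz functional\<close>

lemma riesz_superset:
  assumes "finite E" "Poly_Mapping.keys p \<subseteq> E"
  shows "riesz y p = (\<Sum>\<alpha>\<in>E. coeff p \<alpha> * y \<alpha>)"
  unfolding riesz_def using assms
  by (intro sum.mono_neutral_left) (auto simp: in_keys_iff)

lemma riesz_add: "riesz y (p + q) = riesz y p + riesz y q"
proof -
  let ?E = "Poly_Mapping.keys p \<union> Poly_Mapping.keys q"
  have "riesz y (p + q) = (\<Sum>\<alpha>\<in>?E. coeff (p + q) \<alpha> * y \<alpha>)"
    by (rule riesz_superset) (use keys_add[of p q] in auto)
  moreover have "riesz y p = (\<Sum>\<alpha>\<in>?E. coeff p \<alpha> * y \<alpha>)" by (rule riesz_superset) auto
  moreover have "riesz y q = (\<Sum>\<alpha>\<in>?E. coeff q \<alpha> * y \<alpha>)" by (rule riesz_superset) auto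
  ultimately show ?thesis by (simp add: lookup_add distrib_right sum.distrib)
qed

lemma riesz_zero [simp]: "riesz y 0 = 0"
  by (simp add: riesz_def)

lemma riesz_uminus: "riesz y (- p) = - riesz y p"
  using riesz_add[of y p "- p"] by simp

lemma riesz_diff: "riesz y (p - q) = riesz y p - riesz y q"
  using riesz_add[of y p "- q"] by (simp add: riesz_uminus)

lemma riesz_sum: "riesz y (sum p A) = (\<Sum>a\<in>A. riesz y (p a))"
  by (induction A rule: infinite_finite_induct) (auto simp: riesz_add)

lemma riesz_single [simp]: "riesz y (Poly_Mapping.single \<alpha> c) = c * y \<alpha>"
  by (simp add: riesz_def)

lemma coeff_const_mult: "coeff (const_poly c * p) \<alpha> = c * coeff p \<alpha>"
  unfolding const_poly_def mult_map_scale_conv_mult[symmetric]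
  by (simp add: Poly_Mapping.map.rep_eq when_def)

lemma riesz_const_mult: "riesz y (const_poly c * p) = c * riesz y p"
proof -
  have "riesz y (const_poly c * p) = (\<Sum>\<alpha>\<in>Poly_Mapping.keys p. coeff (const_poly c * p) \<alpha> * y \<alpha>)"
    by (rule riesz_superset) (auto simp: in_keys_iff coeff_const_mult)
  then show ?thesis by (simp add: coeff_const_mult riesz_def sum_distrib_left mult.assoc)
qed

lemma riesz_const [simp]: "riesz y (const_poly c) = c * y 0"
  by (simp add: const_poly_def)

lemma riesz_theta:
  "riesz y (theta r) = (\<Sum>k\<le>r. \<Sum>i\<in>UNIV. y (var_pow i (2 * k)) / fact k)"
  by (simp add: theta_def riesz_sum)

lemma riesz_scale: "riesz (\<lambda>\<alpha>. c * y \<alpha>) p = c * riesz y p"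
  by (simp add: riesz_def sum_distrib_left ac_simps)

lemma riesz_cong:
  assumes "\<And>\<alpha>. \<alpha> \<in> Poly_Mapping.keys p \<Longrightarrow> y \<alpha> = z \<alpha>"
  shows "riesz y p = riesz z p"
  using assms by (simp add: riesz_def)

lemma total_degree_le_iff: "total_degree p \<le> d \<longleftrightarrow> Poly_Mapping.keys p \<subseteq> expos d"
  by (auto simp: total_degree_def)

lemma keys_theta: "Poly_Mapping.keys (theta r :: 'n::finite mpoly) \<subseteq> expos (2 * r)"
proof -
  have s: "Poly_Mapping.keys (Poly_Mapping.single (var_pow (i::'n) (2 * k)) (1 / fact k :: real))
      \<subseteq> expos (2 * r)" if "k \<le> r" for i k
    using that by auto
  have "Poly_Mapping.keys (\<Sum>j\<in>UNIV. Poly_Mapping.single (var_pow (j::'n) (2 * k)) (1 / fact k :: real))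
      \<subseteq> expos (2 * r)" if "k \<le> r" for k
    using s[OF that] by (intro order_trans[OF keys_sum]) blast
  then show ?thesis unfolding theta_def by (intro order_trans[OF keys_sum]) blast
qed

lemma poly_mapping_sum_single:
  assumes "finite E" "Poly_Mapping.keys p \<subseteq> E"
  shows "p = (\<Sum>a\<in>E. Poly_Mapping.single a (coeff p a))"
proof (rule poly_mapping_eqI)
  fix k
  have "coeff (\<Sum>a\<in>E. Poly_Mapping.single a (coeff p a)) k = (\<Sum>a\<in>E. if a = k then coeff p k else 0)"
    unfolding lookup_sum by (rule sum.cong) (auto simp: lookup_single when_def)
  also have "\<dots> = coeff p k" using assms by (auto simp: in_keys_iff)
  finally show "coeff p k = coeff (\<Sum>a\<in>E. Poly_Mapping.single a (coeff p a)) k" by simp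
qed

subsection \<open>Gram matrices\<close>

text \<open>The polynomial \<open>z^T G z\<close> for the vector \<open>z\<close> of monomials with
  exponents in \<open>I\<close>. The matrix is a function on pairs, so sets of matrices carry the
  product topology of a function space.\<close>

definition gram_poly :: "'n expo set \<Rightarrow> ('n expo \<times> 'n expo \<Rightarrow> real) \<Rightarrow> 'n mpoly" where
  "gram_poly I G = (\<Sum>a\<in>I. \<Sum>b\<in>I. Poly_Mapping.single (a + b) (G (a, b)))"

lemma coeff_gram_poly:
  "coeff (gram_poly I G) \<gamma> = (\<Sum>a\<in>I. \<Sum>b\<in>I. if a + b = \<gamma> then G (a, b) else 0)"
  by (simp add: gram_poly_def lookup_sum lookup_single when_def)

lemma riesz_gram_poly:
  "riesz y (gram_poly I G) = (\<Sum>a\<in>I. \<Sum>b\<in>I. G (a, b) * y (a + b))"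
  by (simp add: gram_poly_def riesz_sum)

lemma square_eq_gram_poly:
  "(\<Sum>a\<in>I. Poly_Mapping.single a (w a))\<^sup>2 = gram_poly I (\<lambda>(a, b). w a * w b)"
  by (simp add: gram_poly_def power2_eq_square sum_product mult_single)

lemma riesz_square_nonneg:
  fixes p :: "'n::finite mpoly"
  assumes "psd_on (expos r) (moment_matrix y)" "Poly_Mapping.keys p \<subseteq> expos r"
  shows "0 \<le> riesz y (p\<^sup>2)"
proof -
  have "p = (\<Sum>a\<in>expos r. Poly_Mapping.single a (coeff p a))"
    by (rule poly_mapping_sum_single[OF finite_expos assms(2)])
  then have "p\<^sup>2 = gram_poly (expos r) (\<lambda>(a, b). coeff p a * coeff p b)"
    by (metis square_eq_gram_poly)
  then have "riesz y (p\<^sup>2) = (\<Sum>a\<in>expos r. \<Sum>b\<in>expos r. coeff p a * y (a + b) * coeff p b)"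
    by (simp add: riesz_gram_poly ac_simps)
  then show ?thesis using assms(1) by (simp add: psd_on_def moment_matrix_def)
qed

lemma gram_poly_sum: "gram_poly I (\<lambda>z. \<Sum>l\<in>L. G l z) = (\<Sum>l\<in>L. gram_poly I (G l))"
proof (rule poly_mapping_eqI)
  fix \<gamma>
  have "(\<Sum>a\<in>I. \<Sum>b\<in>I. if a + b = \<gamma> then (\<Sum>l\<in>L. G l (a, b)) else 0)
      = (\<Sum>a\<in>I. \<Sum>b\<in>I. \<Sum>l\<in>L. if a + b = \<gamma> then G l (a, b) else 0)"
    by (intro sum.cong) auto
  also have "\<dots> = (\<Sum>l\<in>L. \<Sum>a\<in>I. \<Sum>b\<in>I. if a + b = \<gamma> then G l (a, b) else 0)"
    by (simp only: sum.swap[of _ _ L])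
  finally show "coeff (gram_poly I (\<lambda>z. \<Sum>l\<in>L. G l z)) \<gamma> = coeff (\<Sum>l\<in>L. gram_poly I (G l)) \<gamma>"
    by (simp add: coeff_gram_poly lookup_sum)
qed

lemma sos_gram_poly:
  assumes "finite I" "psd_on I (\<lambda>a b. G (a, b))"
  shows "sos (gram_poly I G)"
proof -
  from psd_on_gram[OF assms] obtain m :: nat and w where
    w: "\<And>a b. a \<in> I \<Longrightarrow> b \<in> I \<Longrightarrow> G (a, b) = (\<Sum>l<m. w l a * w l b)" by blast
  have "gram_poly I G = gram_poly I (\<lambda>z. \<Sum>l<m. (\<lambda>(a, b). w l a * w l b) z)"
    unfolding gram_poly_def using w by (intro sum.cong) auto
  also have "\<dots> = (\<Sum>l<m. (\<Sum>a\<in>I. Poly_Mapping.single a (w l a))\<^sup>2)"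
    unfolding gram_poly_sum square_eq_gram_poly by simp
  finally show ?thesis
    unfolding sos_def
    by (intro exI[of _ m] exI[of _ "\<lambda>l. \<Sum>a\<in>I. Poly_Mapping.single a (w l a)"])
qed

lemma keys_gram_poly:
  fixes G :: "'n::finite expo \<times> 'n expo \<Rightarrow> real"
  shows "Poly_Mapping.keys (gram_poly (expos r) G) \<subseteq> expos (2 * r)"
proof
  fix \<gamma> assume "\<gamma> \<in> Poly_Mapping.keys (gram_poly (expos r) G)"
  then have "(\<Sum>a\<in>expos r. \<Sum>b\<in>expos r. if a + b = \<gamma> then G (a, b) else 0) \<noteq> 0"
    by (simp add: in_keys_iff coeff_gram_poly)
  then obtain a where a: "a \<in> expos r" "(\<Sum>b\<in>expos r. if a + b = \<gamma> then G (a, b) else 0) \<noteq> 0"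
    by (rule sum.not_neutral_contains_not_neutral)
  from a(2) obtain b where "b \<in> expos r" "(if a + b = \<gamma> then G (a, b) else 0) \<noteq> 0"
    by (rule sum.not_neutral_contains_not_neutral)
  then show "\<gamma> \<in> expos (2 * r)" using a(1) by (auto split: if_splits)
qed

text \<open>The largest exponents (for the sum of squares) on the diagonal of a Gram matrix contribute to
  the polynomial without cancellation.\<close>

lemma gram_poly_eq_zero:
  fixes G :: "'n::finite expo \<times> 'n expo \<Rightarrow> real"
  assumes fin: "finite I" and psd: "psd_on I (\<lambda>a b. G (a, b))" and z: "gram_poly I G = 0"
    and a: "a \<in> I"
  shows "G (a, a) = 0"
proof (rule ccontr)
  assume "G (a, a) \<noteq> 0"
  define S where "S = {a \<in> I. G (a, a) \<noteq> 0}"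
  have S: "finite S" "S \<noteq> {}" using fin a \<open>G (a, a) \<noteq> 0\<close> by (auto simp: S_def)
  have "Max (expo_sq ` S) \<in> expo_sq ` S" using S by (intro Max_in) auto
  then obtain c where c: "c \<in> S" "expo_sq c = Max (expo_sq ` S)" by auto
  have max: "expo_sq d \<le> expo_sq c" if "d \<in> S" for d
    unfolding c(2) using S that by (intro Max_ge) auto
  \<comment> \<open>Of two distinct exponents with midpoint \<open>c\<close>, one has a larger sum
    of squares than \<open>c\<close>, hence a zero diagonal entry; Cauchy-Schwarz then kills the
    entry joining them.\<close>
  have off: "G (b, d) = 0" if "b \<in> I" "d \<in> I" "b + d = c + c" "b \<noteq> d" for b d
  proof -
    have "(G (b, d))\<^sup>2 \<le> G (b, b) * G (d, d)"
      using psd_on_cauchy[OF psd fin, of b d] that by simp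
    moreover have "b \<notin> S \<or> d \<notin> S"
      using expo_sq_parallelogram[OF that(3,4)] max[of b] max[of d] by auto
    then have "G (b, b) = 0 \<or> G (d, d) = 0" using that by (auto simp: S_def)
    ultimately show ?thesis by auto
  qed
  have "(\<Sum>b\<in>I. \<Sum>d\<in>I. if b + d = c + c then G (b, d) else 0)
      = (\<Sum>b\<in>I. \<Sum>d\<in>I. if b = c then (if d = c then G (c, c) else 0) else 0)"
  proof (intro sum.cong refl)
    fix b d assume bd: "b \<in> I" "d \<in> I"
    show "(if b + d = c + c then G (b, d) else 0)
        = (if b = c then (if d = c then G (c, c) else 0) else 0)"
    proof (cases "b = d")
      case True
      then show ?thesis by (auto simp: expo_double_eq_iff)
    next
      case False
      then show ?thesis using off[OF bd] by auto
    qed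
  qed
  also have "\<dots> = G (c, c)"
  proof -
    have "c \<in> I" using c(1) by (simp add: S_def)
    have "(\<Sum>b\<in>I. \<Sum>d\<in>I. if b = c then (if d = c then G (c, c) else 0) else 0)
      = (\<Sum>b\<in>I. if b = c then G (c, c) else 0)"
      using fin \<open>c \<in> I\<close> by (intro sum.cong) auto
    then show ?thesis using fin \<open>c \<in> I\<close> by simp
  qed
  finally have "G (c, c) = coeff (gram_poly I G) (c + c)" by (simp add: coeff_gram_poly)
  then show False using z c(1) by (simp add: S_def)
qed

text \<open>The analogous extremal argument bounds the degrees of the summands in a sum of squares.\<close>

lemma sos_summand_degree:
  fixes g :: "nat \<Rightarrow> 'n::finite mpoly"
  assumes deg: "total_degree (\<Sum>i<m. (g i)\<^sup>2) \<le> 2 * r" and j: "j < m"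
  shows "Poly_Mapping.keys (g j) \<subseteq> expos r"
proof (rule ccontr)
  assume "\<not> Poly_Mapping.keys (g j) \<subseteq> expos r"
  define I where "I = (\<Union>i<m. Poly_Mapping.keys (g i))"
  have fin: "finite I" by (simp add: I_def)
  define J where "J = {a \<in> I. r < expo_deg a}"
  have J: "finite J" "J \<noteq> {}"
    using fin j \<open>\<not> Poly_Mapping.keys (g j) \<subseteq> expos r\<close> by (auto simp: J_def I_def not_le)
  \<comment> \<open>The exponents beyond \<open>r\<close> are narrowed twice: to the largest degree,
    then to the largest sum of squares. In a product equal to the monomial of \<open>c + c\<close>,
    the first choice forces both factors to have degree \<open>D\<close>, the second forces both to
    be \<open>c\<close>.\<close>
  define D where "D = Max (expo_deg ` J)"
  have "D \<in> expo_deg ` J" unfolding D_def using J by (intro Max_in) auto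
  define S where "S = {a \<in> J. expo_deg a = D}"
  have S: "finite S" "S \<noteq> {}" using J \<open>D \<in> expo_deg ` J\<close> by (auto simp: S_def)
  have "Max (expo_sq ` S) \<in> expo_sq ` S" using S by (intro Max_in) auto
  then obtain c where c: "c \<in> S" "expo_sq c = Max (expo_sq ` S)" by auto
  have max: "expo_sq d \<le> expo_sq c" if "d \<in> S" for d
    unfolding c(2) using S that by (intro Max_ge) auto
  have rD: "r < D" using c(1) by (auto simp: S_def J_def)
  have le: "expo_deg b \<le> D" if "b \<in> I" for b
  proof (cases "b \<in> J")
    case True
    then show ?thesis unfolding D_def using J by (intro Max_ge) auto
  next
    case False
    then show ?thesis using that rD by (auto simp: J_def)
  qed
  have diag: "b = c \<and> d = c" if "b \<in> I" "d \<in> I" "b + d = c + c" for b d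
  proof -
    have "expo_deg b + expo_deg d = D + D"
      using arg_cong[OF that(3), of expo_deg] c(1) by (simp add: S_def)
    then have "expo_deg b = D" "expo_deg d = D" using le[of b] le[of d] that by linarith+
    then have "b \<in> S" "d \<in> S" using that rD by (auto simp: S_def J_def)
    then have "b = d" using expo_sq_parallelogram[OF that(3)] max[of b] max[of d] by fastforce
    then show ?thesis using that(3) by (auto simp: expo_double_eq_iff)
  qed
  have cI: "c \<in> I" using c(1) by (simp add: S_def J_def)
  have sq: "coeff ((g i)\<^sup>2) (c + c) = (coeff (g i) c)\<^sup>2" if "i < m" for i
  proof -
    have "g i = (\<Sum>a\<in>I. Poly_Mapping.single a (coeff (g i) a))"
      using that by (intro poly_mapping_sum_single[OF fin]) (auto simp: I_def)
    then have "(g i)\<^sup>2 = gram_poly I (\<lambda>(a, b). coeff (g i) a * coeff (g i) b)"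
      by (metis square_eq_gram_poly)
    then have "coeff ((g i)\<^sup>2) (c + c)
        = (\<Sum>b\<in>I. \<Sum>d\<in>I. if b + d = c + c then coeff (g i) b * coeff (g i) d else 0)"
      by (simp add: coeff_gram_poly cong: if_cong)
    also have "\<dots> = (\<Sum>b\<in>I. \<Sum>d\<in>I. if b = c then (if d = c then (coeff (g i) c)\<^sup>2 else 0) else 0)"
    proof (intro sum.cong refl)
      fix b d assume "b \<in> I" "d \<in> I"
      from diag[OF this] show "(if b + d = c + c then coeff (g i) b * coeff (g i) d else 0)
          = (if b = c then (if d = c then (coeff (g i) c)\<^sup>2 else 0) else 0)"
        by (cases "b + d = c + c") (auto simp: power2_eq_square)
    qed
    also have "\<dots> = (\<Sum>b\<in>I. if b = c then (coeff (g i) c)\<^sup>2 else 0)"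
      using fin cI by (intro sum.cong) auto
    also have "\<dots> = (coeff (g i) c)\<^sup>2" using fin cI by simp
    finally show ?thesis .
  qed
  obtain i where i: "i < m" "coeff (g i) c \<noteq> 0"
    using cI by (auto simp: I_def in_keys_iff)
  have "coeff (\<Sum>i<m. (g i)\<^sup>2) (c + c) = (\<Sum>i<m. (coeff (g i) c)\<^sup>2)"
    by (simp add: lookup_sum sq)
  also have "\<dots> > 0" using i by (intro sum_pos2[of _ i]) auto
  finally have "c + c \<in> Poly_Mapping.keys (\<Sum>i<m. (g i)\<^sup>2)" by (simp add: in_keys_iff)
  then have "c + c \<in> expos (2 * r)" using deg total_degree_le_iff by blast
  then show False using c(1) rD by (simp add: S_def)
qed

lemma riesz_sos_nonneg:
  fixes q :: "'n::finite mpoly"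
  assumes "psd_on (expos r) (moment_matrix y)" "sos q" "total_degree q \<le> 2 * r"
  shows "0 \<le> riesz y q"
proof -
  from assms(2) obtain m :: nat and g where q: "q = (\<Sum>i<m. (g i)\<^sup>2)" unfolding sos_def by blast
  have "0 \<le> riesz y ((g i)\<^sup>2)" if "i < m" for i
    using that assms(3) unfolding q by (intro riesz_square_nonneg[OF assms(1)] sos_summand_degree)
  then show ?thesis unfolding q riesz_sum by (auto intro: sum_nonneg)
qed

text \<open>The functional is applied to the dual identity: the sum of squares contributes a
  nonnegative amount, and \<open>l \<ge> 0\<close> preserves the primal inequality on
  \<open>theta\<close>.\<close>

lemma weak_duality:
  fixes f :: "'n::finite mpoly"
  assumes "y \<in> Q_feasible M r" "d \<in> D_feasible f r"
  shows "D_obj M d \<le> riesz y f"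
proof -
  obtain l g q where d: "d = (l, g, q)" by (cases d)
  have l: "0 \<le> l" and eq: "f - const_poly g = q - const_poly l * theta r"
    and q: "sos q" "total_degree q \<le> 2 * r"
    using assms(2) by (auto simp: d D_feasible_def)
  have y: "psd_on (expos r) (moment_matrix y)" "riesz y (theta r) \<le> bound TYPE('n) M" "y 0 = 1"
    using assms(1) by (auto simp: Q_feasible_def riesz_theta)
  have "riesz y f - g = riesz y q - l * riesz y (theta r)"
    using arg_cong[OF eq, of "riesz y"] y(3) by (simp add: riesz_diff riesz_const_mult)
  moreover have "0 \<le> riesz y q" by (rule riesz_sos_nonneg[OF y(1) q])
  moreover have "l * riesz y (theta r) \<le> l * bound TYPE('n) M" using y(2) l by (rule mult_left_mono)
  ultimately show ?thesis by (simp add: d D_obj_def mult.commute)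
qed

subsection \<open>Duality\<close>

text \<open>A base of the cone of pairs formed by a positive semidefinite matrix and a nonnegative
  multiplier of the slack polynomial, normalised by trace plus multiplier. Entries outside
  \<open>I\<close> are fixed to zero because the matrices are functions on all pairs and the set has
  to be bounded.\<close>

definition gram_base :: "'a set \<Rightarrow> (('a \<times> 'a \<Rightarrow> real) \<times> real) set" where
  "gram_base I = {z. (\<forall>a b. a \<notin> I \<or> b \<notin> I \<longrightarrow> fst z (a, b) = 0) \<and>
     (\<forall>a\<in>I. \<forall>b\<in>I. fst z (a, b) = fst z (b, a)) \<and>
     (\<forall>v. 0 \<le> (\<Sum>a\<in>I. \<Sum>b\<in>I. v a * fst z (a, b) * v b)) \<and>
     0 \<le> snd z \<and> (\<Sum>a\<in>I. fst z (a, a)) + snd z = 1}"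

lemma gram_base_psd: "z \<in> gram_base I \<Longrightarrow> psd_on I (\<lambda>a b. fst z (a, b))"
  by (simp add: gram_base_def psd_on_def)

lemma continuous_on_fst_apply [continuous_intros]:
  "continuous_on S (\<lambda>z :: ('a \<Rightarrow> real) \<times> real. fst z i)"
  by (rule continuous_on_compose2[OF continuous_on_product_coordinates]) (auto intro: continuous_intros)

text \<open>The normalisation bounds the diagonal by 1, and Cauchy-Schwarz the other entries, so the
  base is a closed subset of a box.\<close>

lemma compact_gram_base:
  assumes fin: "finite I"
  shows "compact (gram_base I)"
proof -
  let ?K = "{G :: 'a \<times> 'a \<Rightarrow> real. \<forall>z. \<bar>G z\<bar> \<le> 1} \<times> {0..1::real}"
  have sub: "gram_base I \<subseteq> ?K"
  proof
    fix z assume z: "z \<in> gram_base I"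
    note psd = gram_base_psd[OF z]
    have d: "0 \<le> fst z (a, a)" if "a \<in> I" for a using psd_on_diag_nonneg[OF psd fin that] .
    have tr: "(\<Sum>a\<in>I. fst z (a, a)) + snd z = 1" "0 \<le> snd z" using z by (auto simp: gram_base_def)
    have d1: "fst z (a, a) \<le> 1" if "a \<in> I" for a
      using member_le_sum[of a I "\<lambda>a. fst z (a, a)"] that d fin tr by auto
    have "\<bar>fst z (a, b)\<bar> \<le> 1" for a b
    proof (cases "a \<in> I \<and> b \<in> I")
      case True
      have "(fst z (a, b))\<^sup>2 \<le> fst z (a, a) * fst z (b, b)"
        using psd_on_cauchy[OF psd fin] True by simp
      also have "\<dots> \<le> 1 * 1" using True d d1 by (intro mult_mono) auto
      finally show ?thesis by (simp add: abs_square_le_1)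
    next
      case False
      then show ?thesis using z by (auto simp: gram_base_def)
    qed
    moreover have "0 \<le> (\<Sum>a\<in>I. fst z (a, a))" by (rule sum_nonneg) (rule d)
    ultimately show "z \<in> ?K" using tr by (auto simp: mem_Times_iff)
  qed
  have "closed (gram_base I)"
    unfolding gram_base_def
  proof (intro closed_Collect_conj closed_Collect_all)
    fix a b
    show "closed {z :: ('a \<times> 'a \<Rightarrow> real) \<times> real. a \<notin> I \<or> b \<notin> I \<longrightarrow> fst z (a, b) = 0}"
      by (cases "a \<notin> I \<or> b \<notin> I") (auto intro!: closed_Collect_eq continuous_intros)
  next
    have "{z :: ('a \<times> 'a \<Rightarrow> real) \<times> real. \<forall>a\<in>I. \<forall>b\<in>I. fst z (a, b) = fst z (b, a)}
        = (\<Inter>a\<in>I. \<Inter>b\<in>I. {z. fst z (a, b) = fst z (b, a)})" by auto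
    also have "closed \<dots>" by (intro closed_INT ballI closed_Collect_eq continuous_intros)
    finally show "closed {z :: ('a \<times> 'a \<Rightarrow> real) \<times> real.
        \<forall>a\<in>I. \<forall>b\<in>I. fst z (a, b) = fst z (b, a)}" .
  qed (intro closed_Collect_le closed_Collect_eq continuous_intros)+
  moreover have "compact ?K" by (intro compact_Times compact_box) auto
  ultimately have "compact (?K \<inter> gram_base I)" by (intro compact_Int_closed)
  then show ?thesis using sub by (simp add: Int_absorb1)
qed

lemma gram_base_convex:
  assumes "z \<in> gram_base I" "z' \<in> gram_base I" "0 \<le> p" "0 \<le> q" "p + q = 1"
  shows "(\<lambda>x. p * fst z x + q * fst z' x, p * snd z + q * snd z') \<in> gram_base I"
proof -
  have form: "(\<Sum>a\<in>I. \<Sum>b\<in>I. v a * (p * fst z (a, b) + q * fst z' (a, b)) * v b)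
     = p * (\<Sum>a\<in>I. \<Sum>b\<in>I. v a * fst z (a, b) * v b)
       + q * (\<Sum>a\<in>I. \<Sum>b\<in>I. v a * fst z' (a, b) * v b)" for v
    by (simp add: sum_distrib_left sum.distrib[symmetric] algebra_simps)
  have tr: "(\<Sum>a\<in>I. p * fst z (a, a) + q * fst z' (a, a)) + (p * snd z + q * snd z')
      = p * ((\<Sum>a\<in>I. fst z (a, a)) + snd z) + q * ((\<Sum>a\<in>I. fst z' (a, a)) + snd z')"
    by (simp add: sum.distrib sum_distrib_left algebra_simps)
  show ?thesis
    using assms unfolding gram_base_def by (simp add: form tr)
qed

text \<open>Rank-one matrices and the pure slack element that follows are the test elements for a
  separating functional: nonnegativity on the former means a positive semidefinite moment matrix, on
  the latter the \<open>theta\<close> constraint.\<close>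

lemma gram_base_rank_one:
  assumes "finite I" "(\<Sum>a\<in>I. (v a)\<^sup>2) = 1"
  shows "(\<lambda>(a, b). if a \<in> I \<and> b \<in> I then v a * v b else 0, 0) \<in> gram_base I"
proof -
  have "(\<Sum>a\<in>I. \<Sum>b\<in>I. u a * (if a \<in> I \<and> b \<in> I then v a * v b else 0) * u b)
      = (\<Sum>a\<in>I. u a * v a)\<^sup>2" for u
    unfolding power2_eq_square sum_product by (intro sum.cong) auto
  then show ?thesis
    using assms unfolding gram_base_def by (simp add: power2_eq_square[symmetric] mult.commute)
qed

lemma gram_base_slack: "(\<lambda>_. 0, 1) \<in> gram_base I"
  by (simp add: gram_base_def)

text \<open>If \<open>f - v\<close> were outside the cone, the residual of its projection onto the cone would define a
  functional that, after normalisation, is primal feasible with value below \<open>v\<close>.\<close>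

lemma cone_membership:
  fixes f :: "'n::finite mpoly"
  assumes deg: "total_degree f \<le> 2 * r" and b: "real CARD('n) < b"
    and v: "\<And>y. psd_on (expos r) (moment_matrix y) \<Longrightarrow> riesz y (theta r) \<le> b \<Longrightarrow> y 0 = 1 \<Longrightarrow>
      v \<le> riesz y f"
  shows "\<exists>s z. 0 \<le> s \<and> z \<in> gram_base (expos r) \<and>
    f - const_poly v = const_poly s *
      (gram_poly (expos r) (fst z) + const_poly (snd z) * (const_poly b - theta r))"
proof (rule ccontr)
  assume none: "\<not> ?thesis"
  define \<Phi> where "\<Phi> z = gram_poly (expos r) (fst z) + const_poly (snd z) * (const_poly b - theta r)"
    for z :: "('n expo \<times> 'n expo \<Rightarrow> real) \<times> real"
  define E where "E = (expos (2 * r) :: 'n expo set)"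
  have finE: "finite E" by (simp add: E_def)
  define t where "t = f - const_poly v"
  have coeff_\<Phi>: "coeff (\<Phi> z) \<gamma> = (\<Sum>a\<in>expos r. \<Sum>b\<in>expos r. if a + b = \<gamma> then fst z (a, b) else 0)
      + snd z * coeff (const_poly b - theta r) \<gamma>" for z \<gamma>
    by (simp add: \<Phi>_def lookup_add coeff_gram_poly coeff_const_mult)
  have keys_const: "Poly_Mapping.keys (const_poly c :: 'n mpoly) \<subseteq> E" for c
    by (auto simp: const_poly_def E_def)
  have keys_t: "Poly_Mapping.keys t \<subseteq> E"
    using deg keys_diff[of f "const_poly v"] keys_const
    unfolding t_def total_degree_le_iff E_def by blast
  have keys_slack: "Poly_Mapping.keys (const_poly b - theta r :: 'n mpoly) \<subseteq> E"
    using keys_diff[of "const_poly b" "theta r :: 'n mpoly"] keys_const keys_theta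
    unfolding E_def by blast
  have keys_\<Phi>: "Poly_Mapping.keys (\<Phi> z) \<subseteq> E" for z
  proof
    fix \<gamma> assume "\<gamma> \<in> Poly_Mapping.keys (\<Phi> z)"
    then have "\<gamma> \<in> Poly_Mapping.keys (gram_poly (expos r) (fst z))
        \<or> \<gamma> \<in> Poly_Mapping.keys (const_poly b - theta r :: 'n mpoly)"
      by (auto simp: in_keys_iff \<Phi>_def lookup_add coeff_const_mult)
    then show "\<gamma> \<in> E" using keys_slack keys_gram_poly unfolding E_def by blast
  qed
  define B where "B = (\<lambda>z. coeff (\<Phi> z)) ` gram_base (expos r)"
  have "continuous_on (gram_base (expos r)) (\<lambda>z. coeff (\<Phi> z))"
    unfolding coeff_\<Phi>
  proof (rule continuous_on_coordinatewise_then_product)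
    fix \<gamma>
    have "continuous_on (gram_base (expos r))
      (\<lambda>z. if a + b = \<gamma> then fst z (a, b) else (0::real))" for a b :: "'n expo"
      by (cases "a + b = \<gamma>") (auto intro: continuous_intros)
    then show "continuous_on (gram_base (expos r))
      (\<lambda>z. (\<Sum>a\<in>expos r. \<Sum>b\<in>expos r. if a + b = \<gamma> then fst z (a, b) else 0)
        + snd z * coeff (const_poly b - theta r) \<gamma>)"
      by (intro continuous_intros)
  qed
  then have comp: "compact B"
    unfolding B_def by (intro compact_continuous_image compact_gram_base finite_expos)
  have ne: "B \<noteq> {}" unfolding B_def using gram_base_slack by blast
  have conv: "(\<lambda>x. p * c x + q * d x) \<in> B"
    if cd: "c \<in> B" "d \<in> B" "0 \<le> p" "0 \<le> q" "p + q = 1" for c d p q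
  proof -
    obtain z z' where z: "z \<in> gram_base (expos r)" "c = coeff (\<Phi> z)"
      "z' \<in> gram_base (expos r)" "d = coeff (\<Phi> z')" using cd unfolding B_def by blast
    have "(\<lambda>x. p * c x + q * d x)
        = coeff (\<Phi> (\<lambda>x. p * fst z x + q * fst z' x, p * snd z + q * snd z'))"
    proof
      fix \<gamma>
      have sp: "(if a + b = \<gamma> then p * fst z (a, b) + q * fst z' (a, b) else 0)
          = p * (if a + b = \<gamma> then fst z (a, b) else 0) + q * (if a + b = \<gamma> then fst z' (a, b) else 0)"
        for a b by simp
      then show "p * c \<gamma> + q * d \<gamma>
          = coeff (\<Phi> (\<lambda>x. p * fst z x + q * fst z' x, p * snd z + q * snd z')) \<gamma>"
        unfolding z coeff_\<Phi> fst_conv snd_conv sp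
        by (simp add: sum.distrib sum_distrib_left algebra_simps)
    qed
    then show ?thesis unfolding B_def using gram_base_convex[OF z(1,3) cd(3-5)] by blast
  qed
  \<comment> \<open>The constant coefficient is the matrix entry at \<open>(0, 0)\<close> plus the
    multiplier times \<open>b - n\<close>, both nonnegative. As \<open>b > n\<close>, its vanishing
    makes the multiplier zero; then the Gram polynomial vanishes, so does the diagonal, and the
    normalisation fails.\<close>
  have nz: "\<exists>x\<in>E. c x \<noteq> 0" if "c \<in> B" for c
  proof (rule ccontr)
    assume "\<not> ?thesis"
    then have c0: "\<And>x. x \<in> E \<Longrightarrow> c x = 0" by blast
    obtain z where z: "z \<in> gram_base (expos r)" "c = coeff (\<Phi> z)" using \<open>c \<in> B\<close> by (auto simp: B_def)
    have "coeff (\<Phi> z) \<gamma> = 0" for \<gamma>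
      using c0[of \<gamma>] keys_\<Phi>[of z] z(2) by (cases "\<gamma> \<in> E") (auto simp: in_keys_iff)
    then have \<Phi>0: "\<Phi> z = 0" by (intro poly_mapping_eqI) simp
    have psd: "psd_on (expos r) (\<lambda>a b. fst z (a, b))" by (rule gram_base_psd[OF z(1)])
    have l: "0 \<le> snd z" using z(1) by (simp add: gram_base_def)
    have theta0: "coeff (theta r :: 'n mpoly) 0 = real CARD('n)"
    proof -
      have "coeff (theta r :: 'n mpoly) 0 = (\<Sum>k\<le>r. if k = 0 then real CARD('n) else 0)"
        unfolding theta_def by (simp add: lookup_sum lookup_single when_def if_distrib cong: if_cong)
      then show ?thesis by simp
    qed
    have "(\<Sum>a\<in>expos r. \<Sum>b\<in>expos r. if a + b = (0 :: 'n expo) then fst z (a, b) else 0)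
        = (\<Sum>a\<in>expos r. \<Sum>b\<in>expos r. if a = (0 :: 'n expo) then (if b = (0 :: 'n expo) then fst z (0, 0) else 0) else 0)"
      by (intro sum.cong) (auto simp: expo_add_eq_0_iff)
    also have "\<dots> = (\<Sum>a\<in>expos r. if a = (0 :: 'n expo) then fst z (0, 0) else 0)"
      by (intro sum.cong) auto
    also have "\<dots> = fst z (0, 0)" by simp
    finally have "fst z (0, 0) + snd z * (b - real CARD('n)) = 0"
      using coeff_\<Phi>[of z 0] \<Phi>0 theta0 by (simp add: lookup_minus const_poly_def)
    moreover have "0 \<le> fst z (0, 0)" using psd_on_diag_nonneg[OF psd, of 0] by simp
    moreover have "0 \<le> snd z * (b - real CARD('n))" using l b by simp
    ultimately have "snd z * (b - real CARD('n)) = 0" by linarith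
    then have sz: "snd z = 0" using b by simp
    have "coeff (const_poly 0 * (const_poly b - theta r) :: 'n mpoly) \<gamma> = 0" for \<gamma>
      by (simp add: coeff_const_mult)
    then have "gram_poly (expos r) (fst z) = 0"
      using \<Phi>0 sz by (intro poly_mapping_eqI) (metis \<Phi>_def add.right_neutral lookup_add lookup_zero)
    then have "fst z (a, a) = 0" if "a \<in> expos r" for a
      using gram_poly_eq_zero[OF finite_expos psd _ that] by blast
    then show False using z(1) sz by (simp add: gram_base_def)
  qed
  have out: "\<exists>x\<in>E. coeff t x \<noteq> s * c x" if "c \<in> B" "0 \<le> s" for c s
  proof (rule ccontr)
    assume "\<not> ?thesis"
    then have eq: "\<And>x. x \<in> E \<Longrightarrow> coeff t x = s * c x" by blast
    obtain z where z: "z \<in> gram_base (expos r)" "c = coeff (\<Phi> z)" using \<open>c \<in> B\<close> by (auto simp: B_def)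
    have "t = const_poly s * \<Phi> z"
    proof (rule poly_mapping_eqI)
      fix \<gamma>
      have "coeff t \<gamma> = 0 \<and> coeff (\<Phi> z) \<gamma> = 0" if "\<gamma> \<notin> E"
        using that keys_t keys_\<Phi>[of z] by (meson in_keys_iff subsetD)
      then show "coeff t \<gamma> = coeff (const_poly s * \<Phi> z) \<gamma>"
        using eq[of \<gamma>] by (cases "\<gamma> \<in> E") (auto simp: z(2) coeff_const_mult)
    qed
    then show False using none z(1) that(2) unfolding t_def \<Phi>_def by blast
  qed
  from cone_separation[OF finE comp ne conv nz out] obtain u where
    u: "\<And>c. c \<in> B \<Longrightarrow> 0 \<le> (\<Sum>x\<in>E. u x * c x)" "(\<Sum>x\<in>E. u x * coeff t x) < 0" by blast
  have riesz_u: "riesz u p = (\<Sum>x\<in>E. u x * coeff p x)" if "Poly_Mapping.keys p \<subseteq> E" for p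
    using riesz_superset[OF finE that, of u] by (simp add: mult.commute)
  have u\<Phi>: "0 \<le> riesz u (\<Phi> z)" if "z \<in> gram_base (expos r)" for z
    using u(1)[of "coeff (\<Phi> z)"] that riesz_u[OF keys_\<Phi>[of z]] by (simp add: B_def)
  have riesz_\<Phi>: "riesz u (\<Phi> z) = (\<Sum>a\<in>expos r. \<Sum>b\<in>expos r. fst z (a, b) * u (a + b))
      + snd z * (b * u 0 - riesz u (theta r))" for z
    by (simp add: \<Phi>_def riesz_add riesz_gram_poly riesz_const_mult riesz_diff)
  have psd: "psd_on (expos r) (moment_matrix u)"
    unfolding psd_on_def
  proof (intro conjI allI)
    show "\<forall>a\<in>expos r. \<forall>b\<in>expos r. moment_matrix u a b = moment_matrix u b a"
      by (simp add: moment_matrix_def add.commute)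
    fix w :: "'n expo \<Rightarrow> real"
    define N where "N = (\<Sum>a\<in>expos r. (w a)\<^sup>2)"
    show "0 \<le> (\<Sum>a\<in>expos r. \<Sum>b\<in>expos r. w a * moment_matrix u a b * w b)"
    proof (cases "N = 0")
      case True
      then have "w a = 0" if "a \<in> expos r" for a
        using that unfolding N_def by (subst (asm) sum_nonneg_eq_0_iff) auto
      then show ?thesis by simp
    next
      case False
      then have N: "0 < N" unfolding N_def by (simp add: sum_nonneg order_less_le)
      define w' where "w' a = w a / sqrt N" for a
      have "(\<Sum>a\<in>expos r. (w' a)\<^sup>2) = 1"
        using N by (simp add: w'_def power_divide sum_divide_distrib[symmetric] N_def[symmetric])
      from u\<Phi>[OF gram_base_rank_one[OF finite_expos this]]
      have "0 \<le> (\<Sum>a\<in>expos r. \<Sum>b\<in>expos r.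
          (if a \<in> expos r \<and> b \<in> expos r then w' a * w' b else 0) * u (a + b))"
        unfolding riesz_\<Phi> by simp
      also have "\<dots> = (\<Sum>a\<in>expos r. \<Sum>b\<in>expos r. w' a * w' b * u (a + b))"
        by (intro sum.cong) auto
      finally have "0 \<le> (\<Sum>a\<in>expos r. \<Sum>b\<in>expos r. w' a * w' b * u (a + b))" .
      also have "\<dots> = (\<Sum>a\<in>expos r. \<Sum>b\<in>expos r. w a * moment_matrix u a b * w b) / N"
        unfolding sum_divide_distrib using N
        by (intro sum.cong) (auto simp: w'_def moment_matrix_def)
      finally show ?thesis using N by (simp add: zero_le_divide_iff)
    qed
  qed
  have th: "riesz u (theta r) \<le> b * u 0"
    using u\<Phi>[OF gram_base_slack] unfolding riesz_\<Phi> by simp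
  have neg: "riesz u f < v * u 0"
    using u(2) riesz_u[OF keys_t] by (simp add: t_def riesz_diff)
  have u0: "0 \<le> u 0" using moment_diag_nonneg[OF psd, of 0] by simp
  show False
  proof (cases "u 0 = 0")
    case True
    \<comment> \<open>A functional of mass zero cannot be normalised, but its moments are bounded by
      multiples of \<open>u 0\<close>; so it vanishes on \<open>f\<close> and is not negative
      there.\<close>
    have "\<bar>u \<gamma>\<bar> \<le> b * u 0 * fact r" if "\<gamma> \<in> E" for \<gamma>
      using that th by (intro moment_abs_le[OF psd]) (auto simp: E_def riesz_theta)
    then have "riesz u f = riesz (\<lambda>_. 0) f"
      using True deg by (intro riesz_cong) (auto simp: total_degree_le_iff E_def)
    then show False using neg True by (simp add: riesz_def)
  next
    case False
    then have pos: "0 < u 0" using u0 by simp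
    define y where "y \<alpha> = inverse (u 0) * u \<alpha>" for \<alpha>
    have "psd_on (expos r) (moment_matrix y)"
    proof -
      have "(\<Sum>a\<in>expos r. \<Sum>b\<in>expos r. w a * moment_matrix y a b * w b)
          = inverse (u 0) * (\<Sum>a\<in>expos r. \<Sum>b\<in>expos r. w a * moment_matrix u a b * w b)" for w
        by (simp add: y_def moment_matrix_def sum_distrib_left ac_simps)
      then show ?thesis using psd pos
        unfolding psd_on_def by (simp add: y_def moment_matrix_def)
    qed
    moreover have "riesz y (theta r) \<le> b"
      using th pos unfolding y_def riesz_scale by (simp add: field_simps)
    moreover have "y 0 = 1" using pos by (simp add: y_def)
    ultimately have "v \<le> riesz y f" by (rule v)
    then show False using neg pos unfolding y_def riesz_scale by (simp add: field_simps)
  qed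
qed

subsection \<open>Attainment and strong duality of the relaxations\<close>

lemma truncate_Q_feasible:
  fixes y :: "'n::finite expo \<Rightarrow> real"
  assumes "psd_on (expos r) (moment_matrix y)" "riesz y (theta r) \<le> bound TYPE('n) M" "y 0 = 1"
  shows "(\<lambda>\<alpha>. if \<alpha> \<in> expos (2 * r) then y \<alpha> else 0) \<in> Q_feasible M r"
proof -
  have "psd_on (expos r) (moment_matrix (\<lambda>\<alpha>. if \<alpha> \<in> expos (2 * r) then y \<alpha> else 0))"
    using assms(1) by (subst psd_on_cong[where B = "moment_matrix y"]) (auto simp: moment_matrix_def)
  then show ?thesis
    using assms(2,3) unfolding Q_feasible_def riesz_theta by simp
qed

lemma riesz_truncate:
  assumes "total_degree f \<le> 2 * r"
  shows "riesz (\<lambda>\<alpha>. if \<alpha> \<in> expos (2 * r) then y \<alpha> else 0) f = riesz y f"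
  using assms unfolding total_degree_le_iff by (intro riesz_cong) auto

lemma Q_value_le:
  fixes y :: "'n::finite expo \<Rightarrow> real"
  assumes "total_degree f \<le> 2 * r"
    and "psd_on (expos r) (moment_matrix y)" "riesz y (theta r) \<le> bound TYPE('n) M" "y 0 = 1"
  shows "Q_value f M r \<le> ereal (riesz y f)"
  unfolding Q_value_def riesz_truncate[OF assms(1), symmetric, of y]
  by (rule INF_lower) (rule truncate_Q_feasible[OF assms(2-4)])

lemma Q_feasible_psd: "y \<in> Q_feasible M r \<Longrightarrow> psd_on (expos r) (moment_matrix y)"
  by (simp add: Q_feasible_def)

lemma Q_feasible_bounded:
  fixes y :: "'n::finite expo \<Rightarrow> real"
  assumes "y \<in> Q_feasible M r"
  shows "\<bar>y \<alpha>\<bar> \<le> bound TYPE('n) M * fact r"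
proof (cases "\<alpha> \<in> expos (2 * r)")
  case True
  then show ?thesis using assms
    by (intro moment_abs_le) (auto simp: Q_feasible_def)
next
  case False
  then have "y \<alpha> = 0" using assms by (simp add: Q_feasible_def)
  then show ?thesis by (simp add: bound_def)
qed

lemma compact_Q_feasible: "compact (Q_feasible M r :: ('n::finite expo \<Rightarrow> real) set)"
proof -
  let ?K = "{y :: 'n expo \<Rightarrow> real. \<forall>\<alpha>. \<bar>y \<alpha>\<bar> \<le> bound TYPE('n) M * fact r}"
  have c: "continuous_on UNIV (\<lambda>y :: 'n expo \<Rightarrow> real. y i)" for i
    by (rule continuous_on_product_coordinates)
  have "closed {y :: 'n expo \<Rightarrow> real. psd_on (expos r) (moment_matrix y)}"
    unfolding psd_on_def moment_matrix_def
    by (auto simp: add.commute intro!: closed_Collect_all closed_Collect_le continuous_intros c)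
  moreover have "closed {y :: 'n expo \<Rightarrow> real. \<alpha> \<notin> expos (2 * r) \<longrightarrow> y \<alpha> = 0}" for \<alpha>
    by (cases "\<alpha> \<in> expos (2 * r)") (auto intro!: closed_Collect_eq continuous_intros c)
  ultimately have "closed (Q_feasible M r :: ('n expo \<Rightarrow> real) set)"
    unfolding Q_feasible_def
    by (intro closed_Collect_conj closed_Collect_all closed_Collect_le closed_Collect_eq
        continuous_intros c) auto
  moreover have "compact ?K" by (rule compact_box)
  ultimately have "compact (?K \<inter> Q_feasible M r)" by (intro compact_Int_closed)
  then show ?thesis using Q_feasible_bounded by (subst (asm) Int_absorb1) auto
qed

lemma Q_feasible_nonempty: "(Q_feasible M r :: ('n::finite expo \<Rightarrow> real) set) \<noteq> {}"
proof -
  \<comment> \<open>The moments of the Dirac measure at the origin; only the terms with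
    \<open>k = 0\<close> contribute, so the constraint reads
    \<open>CARD('n) \<le> bound TYPE('n) M\<close>.\<close>
  define y :: "'n expo \<Rightarrow> real" where "y \<alpha> = (if \<alpha> = 0 then 1 else 0)" for \<alpha>
  have y2: "y (a + b) = (if a = 0 then if b = 0 then 1 else 0 else 0)" for a b
    by (auto simp: y_def poly_mapping_eq_iff lookup_add fun_eq_iff)
  have "(\<Sum>a\<in>expos r. \<Sum>b\<in>expos r. v a * y (a + b) * v b) = (v 0)\<^sup>2" for v
  proof -
    have "(\<Sum>a\<in>expos r. \<Sum>b\<in>expos r. v a * y (a + b) * v b)
        = (\<Sum>a\<in>expos r. \<Sum>b\<in>expos r. if b = (0 :: 'n expo) then if a = (0 :: 'n expo) then (v 0)\<^sup>2 else 0 else 0)"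
      by (intro sum.cong) (auto simp: y2 power2_eq_square)
    then show ?thesis by simp
  qed
  then have psd: "psd_on (expos r) (moment_matrix y)"
    by (auto simp: psd_on_def moment_matrix_def add.commute)
  have "riesz y (theta r) = (\<Sum>k\<le>r. \<Sum>i\<in>(UNIV :: 'n set). (if k = 0 then 1 else 0) / fact k)"
    by (simp add: riesz_theta y_def)
  also have "\<dots> = (\<Sum>k\<le>r. if k = 0 then real CARD('n) else 0)"
    by (intro sum.cong) auto
  also have "\<dots> = real CARD('n)" by simp
  also have "\<dots> \<le> bound TYPE('n) M" by (simp add: bound_def)
  finally have "(\<lambda>\<alpha>. if \<alpha> \<in> expos (2 * r) then y \<alpha> else 0) \<in> Q_feasible M r"
    by (intro truncate_Q_feasible psd) (assumption, simp add: y_def)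
  then show ?thesis by blast
qed

lemma Q_optimal_exists: "\<exists>y. Q_optimal f M r y"
proof -
  have "continuous_on (Q_feasible M r) (\<lambda>y. riesz y f)"
    unfolding riesz_def
    by (intro continuous_intros continuous_on_subset[OF continuous_on_product_coordinates]) auto
  from continuous_attains_inf[OF compact_Q_feasible Q_feasible_nonempty this]
  obtain y where y: "y \<in> Q_feasible M r" "\<And>z. z \<in> Q_feasible M r \<Longrightarrow> riesz y f \<le> riesz z f"
    by blast
  have "ereal (riesz y f) = Q_value f M r"
    unfolding Q_value_def using y by (intro antisym INF_greatest INF_lower) auto
  then show ?thesis using y(1) unfolding Q_optimal_def by blast
qed

text \<open>The terms lost on passing from \<open>s\<close> to \<open>r\<close> are diagonal entries
  of the moment matrix over factorials, hence nonnegative. This gives monotone optimal values and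
  lets the constraints at a fixed level pass to limits.\<close>

lemma Q_feasible_restrict:
  fixes y :: "'n::finite expo \<Rightarrow> real"
  assumes y: "y \<in> Q_feasible M s" and "r \<le> s"
  shows "psd_on (expos r) (moment_matrix y)" "riesz y (theta r) \<le> bound TYPE('n) M" "y 0 = 1"
proof -
  have psd: "psd_on (expos s) (moment_matrix y)" by (rule Q_feasible_psd[OF y])
  have "expos r \<subseteq> (expos s :: 'n expo set)" using assms(2) by auto
  then show "psd_on (expos r) (moment_matrix y)" by (intro psd_on_subset[OF psd]) auto
  have "0 \<le> y (var_pow i (2 * k))" if "k \<le> s" for i k
    using moment_diag_nonneg[OF psd, of "var_pow i k"] that by (simp add: var_pow_add mult_2)
  then have "riesz y (theta r) \<le> riesz y (theta s)"
    unfolding riesz_theta using assms(2) by (intro sum_mono2) (auto intro!: sum_nonneg)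
  also have "\<dots> \<le> bound TYPE('n) M" using y by (simp add: Q_feasible_def riesz_theta)
  finally show "riesz y (theta r) \<le> bound TYPE('n) M" .
  show "y 0 = 1" using y by (simp add: Q_feasible_def)
qed

lemma Q_value_mono:
  fixes f :: "'n::finite mpoly"
  assumes "total_degree f \<le> 2 * r" "r \<le> s"
  shows "Q_value f M r \<le> Q_value f M s"
  unfolding Q_value_def[of f M s]
proof (rule INF_greatest)
  fix y :: "'n expo \<Rightarrow> real" assume "y \<in> Q_feasible M s"
  from Q_feasible_restrict[OF this assms(2)] show "Q_value f M r \<le> ereal (riesz y f)"
    by (rule Q_value_le[OF assms(1)])
qed

lemma strong_duality:
  fixes f :: "'n::finite mpoly"
  assumes deg: "total_degree f \<le> 2 * r" and M: "M > 0"
  shows "(\<exists>d. D_optimal f M r d) \<and> D_value f M r = Q_value f M r"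
proof -
  obtain y where y: "Q_optimal f M r y" using Q_optimal_exists by blast
  define v where "v = riesz y f"
  have v: "Q_value f M r = ereal v" using y by (simp add: Q_optimal_def v_def)
  define b where "b = bound TYPE('n) M"
  have "0 < (real_of_int M)\<^sup>2" using M by simp
  then have b: "real CARD('n) < b" by (simp add: b_def bound_def)
  have "v \<le> riesz z f" if "psd_on (expos r) (moment_matrix z)" "riesz z (theta r) \<le> b" "z 0 = 1"
    for z
    using Q_value_le[OF deg that[unfolded b_def]] v by simp
  from cone_membership[OF deg b this] obtain s z where s: "0 \<le> s" and z: "z \<in> gram_base (expos r)"
    and eq: "f - const_poly v = const_poly s *
      (gram_poly (expos r) (fst z) + const_poly (snd z) * (const_poly b - theta r))" by blast
  define q where "q = gram_poly (expos r) (\<lambda>x. s * fst z x)"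
  define l where "l = s * snd z"
  have l: "0 \<le> l" using s z by (simp add: l_def gram_base_def)
  have psd: "psd_on (expos r) (\<lambda>a b. fst z (a, b))" by (rule gram_base_psd[OF z])
  have "(\<Sum>a\<in>expos r. \<Sum>b\<in>expos r. w a * (s * fst z (a, b)) * w b)
      = s * (\<Sum>a\<in>expos r. \<Sum>b\<in>expos r. w a * fst z (a, b) * w b)" for w
    by (simp add: sum_distrib_left ac_simps)
  then have "psd_on (expos r) (\<lambda>a b. s * fst z (a, b))"
    using psd s unfolding psd_on_def by simp
  then have "sos q" unfolding q_def by (intro sos_gram_poly finite_expos)
  moreover have "total_degree q \<le> 2 * r"
    unfolding q_def total_degree_le_iff by (rule keys_gram_poly)
  \<comment> \<open>The slack term \<open>l * (b - theta r)\<close> is split: \<open>b * l\<close>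
    joins the constant \<open>v\<close>, and the dual objective subtracts it again.\<close>
  moreover have "f - const_poly (v + b * l) = q - const_poly l * theta r"
  proof (rule poly_mapping_eqI)
    fix \<gamma>
    have "coeff q \<gamma> = s * coeff (gram_poly (expos r) (fst z)) \<gamma>"
      by (simp add: q_def coeff_gram_poly sum_distrib_left if_distrib cong: if_cong)
    moreover have "coeff f \<gamma> - coeff (const_poly v) \<gamma> = s * (coeff (gram_poly (expos r) (fst z)) \<gamma>
        + snd z * (coeff (const_poly b) \<gamma> - coeff (theta r) \<gamma>))"
      using arg_cong[OF eq, of "\<lambda>p. coeff p \<gamma>"]
      by (simp only: lookup_minus lookup_add coeff_const_mult)
    moreover have "coeff (const_poly (v + b * l)) \<gamma> = coeff (const_poly v) \<gamma> + l * coeff (const_poly b) \<gamma>"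
      by (simp add: const_poly_def lookup_single when_def)
    ultimately show "coeff (f - const_poly (v + b * l)) \<gamma> = coeff (q - const_poly l * theta r) \<gamma>"
      unfolding lookup_minus coeff_const_mult l_def by (simp add: algebra_simps)
  qed
  ultimately have feas: "(l, v + b * l, q) \<in> D_feasible f r"
    using l by (simp add: D_feasible_def)
  have obj: "D_obj M (l, v + b * l, q) = v" by (simp add: D_obj_def b_def)
  have "D_value f M r = ereal v"
  proof (rule antisym)
    show "D_value f M r \<le> ereal v"
      unfolding D_value_def v_def
    proof (rule SUP_least)
      fix d assume "d \<in> D_feasible f r"
      moreover have "y \<in> Q_feasible M r" using y by (simp add: Q_optimal_def)
      ultimately show "ereal (D_obj M d) \<le> ereal (riesz y f)" using weak_duality by simp
    qed
    show "ereal v \<le> D_value f M r"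
      unfolding D_value_def using feas by (subst obj[symmetric]) (rule SUP_upper)
  qed
  then show ?thesis using feas obj v unfolding D_optimal_def by metis
qed

subsection \<open>A continuous surjection from the line onto Euclidean space\<close>

text \<open>Schoenberg's construction: the \<open>m\<close>-th ternary digit of \<open>t\<close> (0 or 2) is read off continuously
  as \<open>digit_fun (3 ^ m * t)\<close>, and the digits are distributed over the coordinates.\<close>

definition digit_fun :: "real \<Rightarrow> real" where
  "digit_fun t = max 0 (min 1 (1 / 2 - cos (pi * t)))"

lemma continuous_on_digit_fun [continuous_intros]:
  "continuous_on S f \<Longrightarrow> continuous_on S (\<lambda>x. digit_fun (f x))" for f :: "real \<Rightarrow> real"
  unfolding digit_fun_def by (intro continuous_intros)

lemma digit_fun_bounds: "0 \<le> digit_fun t" "digit_fun t \<le> 1"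
  by (auto simp: digit_fun_def)

lemma cos_pi_even_shift: "cos (pi * (2 * real_of_int k + t)) = cos (pi * t)"
proof -
  have "pi * (2 * real_of_int k + t) = pi * t + 2 * pi * of_int k" by (simp add: algebra_simps)
  then show ?thesis by (simp only: cos_add sin_int_2pin cos_int_2pin mult_1_right mult_zero_right diff_zero)
qed

lemma digit_fun_even_shift: "digit_fun (2 * real_of_int k + t) = digit_fun t"
  by (simp add: digit_fun_def cos_pi_even_shift)

lemma digit_fun_low: "0 \<le> t \<Longrightarrow> t \<le> 1 / 3 \<Longrightarrow> digit_fun t = 0"
proof -
  assume t: "0 \<le> t" "t \<le> 1 / 3"
  have "cos (pi / 3) \<le> cos (pi * t)" using t by (intro cos_monotone_0_pi_le) auto
  then show ?thesis by (simp add: digit_fun_def cos_60)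
qed

lemma digit_fun_high: "2 / 3 \<le> t \<Longrightarrow> t \<le> 1 \<Longrightarrow> digit_fun t = 1"
proof -
  assume t: "2 / 3 \<le> t" "t \<le> 1"
  have "cos (pi * t) \<le> cos (2 * pi / 3)" using t by (intro cos_monotone_0_pi_le) auto
  moreover have "cos (2 * pi / 3) = - 1 / 2" by (simp add: cos_120)
  ultimately show ?thesis by (simp add: digit_fun_def)
qed

text \<open>A point of the Cantor set. Avoiding the digit 1 leaves a gap between 1/3 and 2/3, in
  which \<open>digit_fun\<close> can pass continuously from 0 to 1.\<close>

definition ternary :: "(nat \<Rightarrow> bool) \<Rightarrow> real" where
  "ternary a = suminf (\<lambda>m. 2 * of_bool (a m) / 3 ^ Suc m)"

lemma ternary_summable: "summable (\<lambda>m. 2 * of_bool (a m) / 3 ^ Suc m :: real)"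
proof (rule summable_comparison_test'[where g = "\<lambda>m. 2 * (1 / 3) ^ m" and N = 0])
  show "summable (\<lambda>m. 2 * (1 / 3) ^ m :: real)"
    by (intro summable_mult summable_geometric) simp
qed (auto simp: power_divide field_simps)

lemma ternary_nonneg: "0 \<le> ternary a"
  unfolding ternary_def by (intro suminf_nonneg ternary_summable) simp

lemma ternary_le_1: "ternary a \<le> 1"
proof -
  have s: "(\<lambda>m. (2 / 3) * (1 / 3) ^ m :: real) sums ((2 / 3) * (1 / (1 - 1 / 3)))"
    by (intro sums_mult geometric_sums) simp
  have "ternary a \<le> suminf (\<lambda>m. (2 / 3) * (1 / 3) ^ m :: real)"
    unfolding ternary_def using s
    by (intro suminf_le ternary_summable) (auto simp: power_divide sums_iff)
  then show ?thesis using s by (simp add: sums_iff)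
qed

text \<open>All digits are 0 or 2, so those moved in front of the ternary point form an even
  integer, which the period 2 of \<open>digit_fun\<close> ignores.\<close>

lemma ternary_shift: "\<exists>k :: int. 3 ^ m * ternary a = 2 * of_int k + ternary (\<lambda>j. a (j + m))"
proof (induction m)
  case 0
  show ?case by (intro exI[of _ 0]) simp
next
  case (Suc m)
  then obtain k :: int where k: "3 ^ m * ternary a = 2 * of_int k + ternary (\<lambda>j. a (j + m))" by blast
  have "ternary (\<lambda>j. a (j + m)) = 2 * of_bool (a m) / 3
      + suminf (\<lambda>j. 2 * of_bool (a (Suc j + m)) / 3 ^ Suc (Suc j))"
    using suminf_split_head[OF ternary_summable[of "\<lambda>j. a (j + m)"]] by (simp add: ternary_def)
  also have "suminf (\<lambda>j. 2 * of_bool (a (Suc j + m)) / 3 ^ Suc (Suc j) :: real)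
      = (1 / 3) * ternary (\<lambda>j. a (j + Suc m))"
    unfolding ternary_def using suminf_mult[OF ternary_summable[of "\<lambda>j. a (j + Suc m)"], of "1/3"]
    by simp
  finally have "3 ^ Suc m * ternary a
      = 2 * of_int (3 * k + of_bool (a m)) + ternary (\<lambda>j. a (j + Suc m))"
    using k by (simp add: algebra_simps)
  then show ?case by blast
qed

text \<open>The shifted tail lies in \<open>[0, 1/3]\<close> or in \<open>[2/3, 1]\<close> according
  to its leading digit, and \<open>digit_fun\<close> is constant on both. The summand
  \<open>2 * of_int k\<close> stays an even integer under the shift; it leaves room for choosing the
  radius of the curve.\<close>

lemma digit_fun_ternary: "digit_fun (3 ^ m * (2 * of_int k + ternary a)) = of_bool (a m)"
proof -
  obtain j :: int where j: "3 ^ m * ternary a = 2 * of_int j + ternary (\<lambda>j. a (j + m))"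
    using ternary_shift by blast
  obtain l :: int where l: "3 ^ 1 * ternary (\<lambda>j. a (j + m))
      = 2 * of_int l + ternary (\<lambda>i. a (i + 1 + m))"
    using ternary_shift[of 1 "\<lambda>j. a (j + m)"] by auto
  have head: "ternary (\<lambda>j. a (j + m)) = 2 * of_bool (a m) / 3
      + (1 / 3) * ternary (\<lambda>j. a (j + Suc m))"
    unfolding ternary_def
    using suminf_split_head[OF ternary_summable[of "\<lambda>j. a (j + m)"]]
      suminf_mult[OF ternary_summable[of "\<lambda>j. a (j + Suc m)"], of "1/3"] by simp
  have "3 ^ m * (2 * of_int k + ternary a)
      = 2 * real_of_int (3 ^ m * k + j) + ternary (\<lambda>j. a (j + m))"
    using j by (simp add: algebra_simps)
  then have "digit_fun (3 ^ m * (2 * of_int k + ternary a)) = digit_fun (ternary (\<lambda>j. a (j + m)))"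
    by (simp only: digit_fun_even_shift)
  also have "\<dots> = of_bool (a m)"
    using head ternary_nonneg[of "\<lambda>j. a (j + Suc m)"] ternary_le_1[of "\<lambda>j. a (j + Suc m)"]
    by (cases "a m") (auto intro!: digit_fun_low digit_fun_high)
  finally show ?thesis .
qed

text \<open>Digit \<open>k\<close> is the parity of the integer part of
  \<open>2 ^ Suc k * x\<close>, so the partial sums are the truncations
  \<open>\<lfloor>2 ^ K * x\<rfloor> / 2 ^ K\<close>.\<close>

lemma binary_expansion:
  fixes x :: real
  assumes "0 \<le> x" "x < 1"
  shows "\<exists>a. (\<lambda>k. of_bool (a k) / 2 ^ Suc k) sums x"
proof -
  define a where "a k \<longleftrightarrow> odd \<lfloor>2 ^ Suc k * x\<rfloor>" for k
  have step: "\<lfloor>2 ^ Suc k * x\<rfloor> = 2 * \<lfloor>2 ^ k * x\<rfloor> + of_bool (a k)" for k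
  proof -
    have "2 * of_int \<lfloor>2 ^ k * x\<rfloor> \<le> 2 ^ Suc k * x" "2 ^ Suc k * x < 2 * of_int \<lfloor>2 ^ k * x\<rfloor> + 2"
      using floor_correct[of "2 ^ k * x"] by (auto simp: algebra_simps)
    then have "\<lfloor>2 ^ Suc k * x\<rfloor> = 2 * \<lfloor>2 ^ k * x\<rfloor> \<or> \<lfloor>2 ^ Suc k * x\<rfloor> = 2 * \<lfloor>2 ^ k * x\<rfloor> + 1"
      by linarith
    then show ?thesis by (auto simp: a_def)
  qed
  have partial: "(\<Sum>k<K. of_bool (a k) / 2 ^ Suc k) = (of_int \<lfloor>2 ^ K * x\<rfloor> / 2 ^ K :: real)" for K
  proof (induction K)
    case 0
    have "\<lfloor>x\<rfloor> = 0" using assms by (simp add: floor_eq_iff)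
    then show ?case by simp
  next
    case (Suc K)
    then show ?case using step[of K] by (simp add: field_simps)
  qed
  have "(\<lambda>K. of_int \<lfloor>2 ^ K * x\<rfloor> / 2 ^ K) \<longlonglongrightarrow> x"
  proof (rule tendsto_sandwich)
    have "x - (1 / 2) ^ K \<le> of_int \<lfloor>2 ^ K * x\<rfloor> / 2 ^ K" for K
    proof -
      have "(2 ^ K * x - 1) / 2 ^ K \<le> of_int \<lfloor>2 ^ K * x\<rfloor> / 2 ^ K"
        using floor_correct[of "2 ^ K * x"] by (intro divide_right_mono) auto
      then show ?thesis by (simp add: diff_divide_distrib power_one_over)
    qed
    then show "\<forall>\<^sub>F K in sequentially. x - (1 / 2) ^ K \<le> of_int \<lfloor>2 ^ K * x\<rfloor> / 2 ^ K"
      by (intro always_eventually allI)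
    show "\<forall>\<^sub>F K in sequentially. of_int \<lfloor>2 ^ K * x\<rfloor> / 2 ^ K \<le> x"
      by (intro always_eventually allI) (simp add: field_simps)
    have "(\<lambda>K. x - (1 / 2) ^ K) \<longlonglongrightarrow> x - 0"
      by (intro tendsto_intros LIMSEQ_power_zero) simp
    then show "(\<lambda>K. x - (1 / 2) ^ K) \<longlonglongrightarrow> x" by simp
  qed auto
  then show ?thesis unfolding sums_def partial[symmetric] by blast
qed

text \<open>The \<open>k\<close>-th binary digit of coordinate \<open>i\<close> is read at ternary
  position \<open>to_nat (i, k)\<close>; injectivity of \<open>to_nat\<close> allows the digits of
  all coordinates to be prescribed independently.\<close>

definition curve_coord :: "'n::finite \<Rightarrow> real \<Rightarrow> real" where
  "curve_coord i t = suminf (\<lambda>k. digit_fun (3 ^ to_nat (i, k) * t) / 2 ^ Suc k)"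

lemma continuous_on_curve_coord: "continuous_on UNIV (curve_coord i)"
proof -
  have s: "summable (\<lambda>k. (1 / 2) ^ Suc k :: real)"
    by (subst summable_Suc_iff) (intro summable_geometric, simp)
  have u: "uniform_limit UNIV (\<lambda>n t. \<Sum>k<n. digit_fun (3 ^ to_nat (i, k) * t) / 2 ^ Suc k)
      (\<lambda>t. suminf (\<lambda>k. digit_fun (3 ^ to_nat (i, k) * t) / 2 ^ Suc k)) sequentially"
  proof (rule Weierstrass_m_test[OF _ s])
    fix k and t :: real
    show "norm (digit_fun (3 ^ to_nat (i, k) * t) / 2 ^ Suc k) \<le> (1 / 2) ^ Suc k"
      using digit_fun_bounds[of "3 ^ to_nat (i, k) * t"]
      by (simp add: power_divide divide_right_mono)
  qed
  have "continuous_on UNIV (\<lambda>t. suminf (\<lambda>k. digit_fun (3 ^ to_nat (i, k) * t) / 2 ^ Suc k))"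
    by (rule uniform_limit_theorem[OF _ u])
      (auto intro!: always_eventually continuous_intros)
  then show ?thesis unfolding curve_coord_def[abs_def] .
qed

text \<open>The radius is constant on \<open>{2 * k..2 * k + 1}\<close>, where the curve sweeps out a full cube.\<close>

definition curve_radius :: "real \<Rightarrow> real" where
  "curve_radius t = 1 + t / 2 - arccos (cos (pi * t)) / (2 * pi)"

lemma continuous_on_curve_radius: "continuous_on UNIV curve_radius"
  unfolding curve_radius_def[abs_def] by (intro continuous_intros) auto

text \<open>\<open>arccos (cos (pi * t))\<close> is a triangle wave; on these intervals it rises
  with slope \<open>pi\<close> and cancels the growth of \<open>t / 2\<close>.\<close>

lemma curve_radius_eq:
  assumes "0 \<le> s" "s \<le> 1"
  shows "curve_radius (2 * of_int k + s) = of_int k + 1"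
proof -
  have "arccos (cos (pi * s)) = pi * s" using assms by (intro arccos_cos) auto
  then show ?thesis unfolding curve_radius_def cos_pi_even_shift by (simp add: field_simps)
qed

lemma continuous_encoding:
  "\<exists>(dec :: real \<Rightarrow> real^'n::finite) enc. continuous_on UNIV dec \<and>
     (\<forall>x. dec (enc x) = x \<and> \<bar>enc x\<bar> \<le> 2 * norm x + 1)"
proof -
  define dec :: "real \<Rightarrow> real^'n" where
    "dec t = (\<chi> i. curve_radius t * (2 * curve_coord i t - 1))" for t
  have "continuous_on UNIV dec"
    unfolding dec_def
    by (intro continuous_on_vec_lambda continuous_intros continuous_on_curve_coord
        continuous_on_curve_radius)
  moreover have "\<exists>t. dec t = x \<and> \<bar>t\<bar> \<le> 2 * norm x + 1" for x
  proof -
    \<comment> \<open>\<open>R\<close> exceeds the norm strictly, which puts the rescaled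
      coordinates into \<open>[0, 1)\<close> as the binary expansion requires; it is also the radius
      of the curve on the unit interval starting at
      \<open>2 * \<lfloor>norm x\<rfloor>\<close>.\<close>
    define R where "R = real_of_int \<lfloor>norm x\<rfloor> + 1"
    have R: "norm x < R" "R \<le> norm x + 1" "0 < R"
      using floor_correct[of "norm x"] norm_ge_zero[of x] unfolding R_def by linarith+
    define s where "s i = (x $ i / R + 1) / 2" for i
    have "\<exists>a. (\<lambda>k. of_bool (a k) / 2 ^ Suc k) sums s i" for i
    proof (rule binary_expansion)
      have "\<bar>x $ i\<bar> < R" using component_le_norm_cart[of x i] R(1) by linarith
      then have "- R < x $ i" "x $ i < R" by auto
      then show "0 \<le> s i" "s i < 1" unfolding s_def using R(3) by (auto simp: field_simps)
    qed
    then obtain a where a: "\<And>i. (\<lambda>k. of_bool (a i k) / 2 ^ Suc k) sums s i" by metis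
    define d where "d m = (case from_nat m of (i, k) \<Rightarrow> a (i::'n) (k::nat))" for m
    define t where "t = 2 * of_int \<lfloor>norm x\<rfloor> + ternary d"
    have "curve_coord i t = s i" for i
    proof -
      have "curve_coord i t = suminf (\<lambda>k. of_bool (a i k) / 2 ^ Suc k)"
        unfolding curve_coord_def t_def digit_fun_ternary by (simp add: d_def)
      then show ?thesis using a[of i] by (simp add: sums_iff)
    qed
    moreover have "curve_radius t = R"
      unfolding t_def R_def by (intro curve_radius_eq ternary_nonneg ternary_le_1)
    ultimately have "dec t = x"
      using R(3) by (simp add: dec_def vec_eq_iff s_def field_simps)
    moreover have "\<bar>t\<bar> \<le> 2 * norm x + 1"
      using ternary_nonneg[of d] ternary_le_1[of d] floor_correct[of "norm x"] norm_ge_zero[of x]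
      unfolding t_def by (simp add: abs_le_iff) linarith
    ultimately show ?thesis by blast
  qed
  then obtain enc where "\<And>x. dec (enc x) = x \<and> \<bar>enc x\<bar> \<le> 2 * norm x + 1" by metis
  ultimately show ?thesis by blast
qed

subsection \<open>Limits of moments of finitely supported measures\<close>

definition clip :: "real \<Rightarrow> real \<Rightarrow> real" where
  "clip R u = max (- R) (min R u)"

lemma continuous_on_clip [continuous_intros]:
  "continuous_on S f \<Longrightarrow> continuous_on S (\<lambda>x. clip R (f x))"
  unfolding clip_def by (intro continuous_intros)

lemma abs_clip_le: "0 \<le> R \<Longrightarrow> \<bar>clip R u\<bar> \<le> R"
  by (auto simp: clip_def)

text \<open>There is no error up to \<open>R\<close>; beyond \<open>R\<close>, one factor of
  \<open>u\<^sup>2\<close> absorbs the \<open>R\<close>. Bounded second moments thus control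
  truncation uniformly along a sequence of measures.\<close>

lemma abs_diff_clip_le: "0 < R \<Longrightarrow> \<bar>u - clip R u\<bar> \<le> u\<^sup>2 / R"
proof -
  assume R: "0 < R"
  have "R * \<bar>u - clip R u\<bar> \<le> u\<^sup>2"
  proof (cases "\<bar>u\<bar> \<le> R")
    case True
    then show ?thesis by (auto simp: clip_def)
  next
    case False
    have "\<bar>u - clip R u\<bar> \<le> \<bar>u\<bar>" using R by (auto simp: clip_def)
    then have "R * \<bar>u - clip R u\<bar> \<le> \<bar>u\<bar> * \<bar>u\<bar>" using False R by (intro mult_mono) auto
    then show ?thesis by (simp add: power2_eq_square)
  qed
  then show ?thesis using R by (simp add: field_simps)
qed

lemma monomial_fun_add: "monomial_fun (\<alpha> + \<beta>) x = monomial_fun \<alpha> x * monomial_fun \<beta> x"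
  by (simp add: monomial_fun_def lookup_add power_add prod.distrib)

lemma continuous_on_monomial_fun [continuous_intros]: "continuous_on S (monomial_fun \<alpha>)"
  unfolding monomial_fun_def[abs_def] by (intro continuous_intros)

lemma monomial_fun_measurable [measurable]: "monomial_fun \<alpha> \<in> borel_measurable borel"
  by (intro borel_measurable_continuous_onI continuous_on_monomial_fun)

lemma monomial_fun_var_pow: "monomial_fun (Poly_Mapping.single i k) x = (x $ i) ^ k"
proof -
  have "monomial_fun (Poly_Mapping.single i k) x = (\<Prod>j\<in>UNIV. if j = i then (x $ i) ^ k else 1)"
    unfolding monomial_fun_def by (rule prod.cong) (auto simp: lookup_single when_def)
  then show ?thesis by simp
qed

text \<open>Second moments of the coordinates give tightness by Markov's inequality. Second moments
  of each monomial give uniform integrability, so every moment survives the weak limit.\<close>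

lemma moment_limit_exists:
  fixes p :: "nat \<Rightarrow> (real^'n::finite) pmf"
  assumes fin: "\<And>m. finite (set_pmf (p m))"
    and lim: "\<And>\<alpha>. (\<lambda>m. measure_pmf.expectation (p m) (monomial_fun \<alpha>)) \<longlonglongrightarrow> y \<alpha>"
  shows "\<exists>\<mu>. prob_space \<mu> \<and> represents \<mu> y"
proof -
  obtain dec :: "real \<Rightarrow> real^'n" and enc where dec: "continuous_on UNIV dec"
    and enc: "\<And>x. dec (enc x) = x" "\<And>x. \<bar>enc x\<bar> \<le> 2 * norm x + 1"
    using continuous_encoding by metis
  have int: "integrable (measure_pmf (p m)) g" for m and g :: "real^'n \<Rightarrow> real"
    by (rule integrable_measure_pmf_finite[OF fin])
  have "\<exists>K. \<forall>m. measure_pmf.expectation (p m) (monomial_fun \<alpha>) \<le> K" for \<alpha>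
  proof -
    have "Bseq (\<lambda>m. measure_pmf.expectation (p m) (monomial_fun \<alpha>))"
      using lim[of \<alpha>] by (intro convergent_imp_Bseq) (auto simp: convergent_def)
    then obtain K where "\<And>m. norm (measure_pmf.expectation (p m) (monomial_fun \<alpha>)) \<le> K"
      unfolding Bseq_def by blast
    then show ?thesis by (intro exI[of _ K] allI) (metis abs_le_D1 real_norm_def)
  qed
  then obtain K where K: "\<And>m \<alpha>. measure_pmf.expectation (p m) (monomial_fun \<alpha>) \<le> K \<alpha>" by metis
  define \<xi> where "\<xi> m = distr (measure_pmf (p m)) borel enc" for m
  have rd: "real_distribution (\<xi> m)" for m
    unfolding \<xi>_def
    by (rule prob_space.real_distribution_distr[OF measure_pmf.prob_space_axioms]) simp
  define B where "B = (\<Sum>i\<in>UNIV. K (Poly_Mapping.single i 2)) + 1"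
  have norm2: "measure_pmf.expectation (p m) (\<lambda>x. (norm x)\<^sup>2) \<le> B" for m
  proof -
    have "(norm x)\<^sup>2 = (\<Sum>i\<in>UNIV. monomial_fun (Poly_Mapping.single i 2) x)" for x :: "real^'n"
      by (simp add: norm_vec_def L2_set_def monomial_fun_var_pow sum_nonneg)
    then have "measure_pmf.expectation (p m) (\<lambda>x. (norm x)\<^sup>2)
        = (\<Sum>i\<in>UNIV. measure_pmf.expectation (p m) (monomial_fun (Poly_Mapping.single i 2)))"
      by (simp add: int)
    also have "\<dots> \<le> (\<Sum>i\<in>UNIV. K (Poly_Mapping.single i 2))" by (intro sum_mono K)
    finally show ?thesis by (simp add: B_def)
  qed
  have B: "0 \<le> B"
    using norm2[of 0] by (rule order_trans[rotated]) simp
  have "tight \<xi>"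
    unfolding tight_def
  proof (intro conjI allI impI rd)
    fix \<epsilon> :: real assume \<epsilon>: "0 < \<epsilon>"
    define A where "A = sqrt (B / \<epsilon>) + 1"
    have A: "0 < A" unfolding A_def using B \<epsilon> by (simp add: add_nonneg_pos)
    have "B / \<epsilon> < A\<^sup>2"
    proof -
      have "(sqrt (B / \<epsilon>))\<^sup>2 < A\<^sup>2" unfolding A_def using B \<epsilon> by (intro power_strict_mono) auto
      then show ?thesis using B \<epsilon> by simp
    qed
    then have BA: "B / A\<^sup>2 < \<epsilon>" using A \<epsilon> by (simp add: field_simps)
    \<comment> \<open>If \<open>norm x < A\<close>, then
      \<open>\<bar>enc x\<bar> < 2 * A + 1\<close>, so \<open>enc x\<close> falls into the half-open
      interval of radius \<open>c\<close>.\<close>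
    define c where "c = 2 * A + 2"
    have "1 - \<epsilon> < measure (\<xi> m) {- c<..c}" for m
    proof -
      have "measure (measure_pmf (p m)) {x. A\<^sup>2 \<le> (norm x)\<^sup>2}
          \<le> measure_pmf.expectation (p m) (\<lambda>x. (norm x)\<^sup>2) / A\<^sup>2"
        using integral_Markov_inequality_measure[of "measure_pmf (p m)" "\<lambda>x. (norm x)\<^sup>2" UNIV "A\<^sup>2"] A int
        by simp
      also have "\<dots> \<le> B / A\<^sup>2" using norm2 by (intro divide_right_mono) auto
      finally have far: "measure (measure_pmf (p m)) {x. A\<^sup>2 \<le> (norm x)\<^sup>2} < \<epsilon>" using BA by simp
      have "- {x. A\<^sup>2 \<le> (norm x)\<^sup>2} \<subseteq> enc -` {- c<..c}"
      proof
        fix x :: "real^'n" assume "x \<in> - {x. A\<^sup>2 \<le> (norm x)\<^sup>2}"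
        then have "(norm x)\<^sup>2 < A\<^sup>2" by simp
        then have "norm x < A" using A by (intro power_less_imp_less_base[of "norm x" 2]) auto
        then show "x \<in> enc -` {- c<..c}" using enc(2)[of x] by (auto simp: c_def abs_le_iff)
      qed
      then have "measure (measure_pmf (p m)) (- {x. A\<^sup>2 \<le> (norm x)\<^sup>2})
          \<le> measure (measure_pmf (p m)) (enc -` {- c<..c})"
        by (intro measure_pmf.finite_measure_mono) auto
      moreover have "measure (measure_pmf (p m)) (- {x. A\<^sup>2 \<le> (norm x)\<^sup>2})
          = 1 - measure (measure_pmf (p m)) {x. A\<^sup>2 \<le> (norm x)\<^sup>2}"
        using measure_pmf.prob_compl[of "{x. A\<^sup>2 \<le> (norm x)\<^sup>2}" "p m"] by (simp add: Compl_eq_Diff_UNIV)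
      ultimately show ?thesis using far by (simp add: \<xi>_def measure_distr)
    qed
    moreover have "- c < c" using A by (simp add: c_def)
    ultimately show "\<exists>a b. a < b \<and> (\<forall>m. 1 - \<epsilon> < measure (\<xi> m) {a<..b})" by blast
  qed
  from tight_imp_convergent_subsubsequence[OF this strict_mono_id] obtain r M where
    r: "strict_mono (r :: nat \<Rightarrow> nat)" and M: "real_distribution M" and conv: "weak_conv_m (\<xi> \<circ> r) M"
    by auto
  interpret M: real_distribution M by fact
  have [measurable]: "dec \<in> borel_measurable borel" using dec by (intro borel_measurable_continuous_onI)
  define \<mu> where "\<mu> = distr M borel dec"
  have "prob_space \<mu>" unfolding \<mu>_def by (intro M.prob_space_distr) simp
  interpret \<mu>: prob_space \<mu> by fact
  have sets [measurable_cong]: "sets \<mu> = sets borel" by (simp add: \<mu>_def)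
  \<comment> \<open>A bounded continuous \<open>g\<close> pulls back along the continuous
    \<open>dec\<close> to a bounded continuous function on the line, and
    \<open>dec (enc x) = x\<close> restores the original expectations.\<close>
  have weak: "(\<lambda>m. measure_pmf.expectation (p (r m)) g) \<longlonglongrightarrow> (\<integral>x. g x \<partial>\<mu>)"
    if g: "continuous_on UNIV g" and bd: "\<And>x. \<bar>g x\<bar> \<le> C" for g :: "real^'n \<Rightarrow> real" and C
  proof -
    have [measurable]: "g \<in> borel_measurable borel" using g by (intro borel_measurable_continuous_onI)
    have cont: "continuous_on UNIV (\<lambda>t. g (dec t))" by (rule continuous_on_compose2[OF g dec]) simp
    have "(\<lambda>m. \<integral>t. g (dec t) \<partial>(\<xi> \<circ> r) m) \<longlonglongrightarrow> (\<integral>t. g (dec t) \<partial>M)"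
    proof (rule weak_conv_imp_integral_bdd_continuous_conv)
      show "isCont (\<lambda>t. g (dec t)) t" for t using cont by (simp add: continuous_on_eq_continuous_at)
      show "norm (g (dec t)) \<le> C" for t using bd by simp
    qed (use M conv rd in \<open>auto simp: o_def\<close>)
    moreover have "(\<integral>t. g (dec t) \<partial>(\<xi> \<circ> r) m) = measure_pmf.expectation (p (r m)) g" for m
      by (simp add: \<xi>_def integral_distr enc(1))
    moreover have "(\<integral>t. g (dec t) \<partial>M) = (\<integral>x. g x \<partial>\<mu>)"
      by (simp add: \<mu>_def integral_distr)
    ultimately show ?thesis by simp
  qed
  have sq: "monomial_fun (\<alpha> + \<alpha>) x = (monomial_fun \<alpha> x)\<^sup>2" for \<alpha> and x :: "real^'n"
    by (simp add: monomial_fun_add power2_eq_square)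
  have K0: "0 \<le> K (\<alpha> + \<alpha>)" for \<alpha>
    using K[of 0 "\<alpha> + \<alpha>"] unfolding sq by (rule order_trans[rotated]) simp
  have sq_int: "integrable \<mu> (\<lambda>x. (monomial_fun \<alpha> x)\<^sup>2) \<and> (\<integral>x. (monomial_fun \<alpha> x)\<^sup>2 \<partial>\<mu>) \<le> K (\<alpha> + \<alpha>)"
    for \<alpha>
  proof -
    \<comment> \<open>Cut off at height \<open>k\<close>, the square is a bounded test function;
      monotone convergence in \<open>k\<close> then transfers the bound to the limit
      measure.\<close>
    have trunc: "(\<integral>x. min (real k) ((monomial_fun \<alpha> x)\<^sup>2) \<partial>\<mu>) \<le> K (\<alpha> + \<alpha>)" for k
    proof (rule LIMSEQ_le_const2)
      show "(\<lambda>m. measure_pmf.expectation (p (r m)) (\<lambda>x. min (real k) ((monomial_fun \<alpha> x)\<^sup>2)))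
          \<longlonglongrightarrow> (\<integral>x. min (real k) ((monomial_fun \<alpha> x)\<^sup>2) \<partial>\<mu>)"
        by (rule weak[of _ "real k"]) (auto intro!: continuous_intros)
      have "measure_pmf.expectation (p (r m)) (\<lambda>x. min (real k) ((monomial_fun \<alpha> x)\<^sup>2)) \<le> K (\<alpha> + \<alpha>)"
        for m
        by (rule order_trans[OF integral_mono K[of "r m" "\<alpha> + \<alpha>"]]) (auto simp: int sq)
      then show "\<exists>N. \<forall>m\<ge>N. measure_pmf.expectation (p (r m))
          (\<lambda>x. min (real k) ((monomial_fun \<alpha> x)\<^sup>2)) \<le> K (\<alpha> + \<alpha>)" by blast
    qed
    have "(\<integral>\<^sup>+x. ennreal ((monomial_fun \<alpha> x)\<^sup>2) \<partial>\<mu>)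
        = (\<integral>\<^sup>+x. (SUP k. ennreal (min (real k) ((monomial_fun \<alpha> x)\<^sup>2))) \<partial>\<mu>)"
    proof (rule nn_integral_cong)
      fix x
      obtain k0 where k0: "(monomial_fun \<alpha> x)\<^sup>2 \<le> real k0" using real_arch_simple by blast
      show "ennreal ((monomial_fun \<alpha> x)\<^sup>2) = (SUP k. ennreal (min (real k) ((monomial_fun \<alpha> x)\<^sup>2)))"
      proof (rule antisym)
        show "ennreal ((monomial_fun \<alpha> x)\<^sup>2) \<le> (SUP k. ennreal (min (real k) ((monomial_fun \<alpha> x)\<^sup>2)))"
          using k0 by (intro SUP_upper2[of k0]) auto
      qed (auto intro!: SUP_least ennreal_leI)
    qed
    also have "\<dots> = (SUP k. \<integral>\<^sup>+x. ennreal (min (real k) ((monomial_fun \<alpha> x)\<^sup>2)) \<partial>\<mu>)"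
      by (intro nn_integral_monotone_convergence_SUP)
        (auto simp: incseq_def le_fun_def intro!: ennreal_leI)
    also have "\<dots> \<le> ennreal (K (\<alpha> + \<alpha>))"
    proof (rule SUP_least)
      fix k
      have "(\<integral>\<^sup>+x. ennreal (min (real k) ((monomial_fun \<alpha> x)\<^sup>2)) \<partial>\<mu>)
          = ennreal (\<integral>x. min (real k) ((monomial_fun \<alpha> x)\<^sup>2) \<partial>\<mu>)"
        by (intro nn_integral_eq_integral \<mu>.integrable_const_bound[where B = "real k"]) auto
      then show "(\<integral>\<^sup>+x. ennreal (min (real k) ((monomial_fun \<alpha> x)\<^sup>2)) \<partial>\<mu>) \<le> ennreal (K (\<alpha> + \<alpha>))"
        using trunc[of k] by (simp add: ennreal_leI)
    qed
    finally have le: "(\<integral>\<^sup>+x. ennreal ((monomial_fun \<alpha> x)\<^sup>2) \<partial>\<mu>) \<le> ennreal (K (\<alpha> + \<alpha>))" .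
    have i: "integrable \<mu> (\<lambda>x. (monomial_fun \<alpha> x)\<^sup>2)"
      using le by (intro integrableI_nonneg) (auto simp: less_top[symmetric] top_unique)
    moreover have "(\<integral>x. (monomial_fun \<alpha> x)\<^sup>2 \<partial>\<mu>) \<le> K (\<alpha> + \<alpha>)"
      using le K0[of \<alpha>] by (subst (asm) nn_integral_eq_integral[OF i]) auto
    ultimately show ?thesis by blast
  qed
  have "integrable \<mu> (monomial_fun \<alpha>) \<and> y \<alpha> = (\<integral>x. monomial_fun \<alpha> x \<partial>\<mu>)" for \<alpha>
  proof
    have ab: "\<bar>u\<bar> \<le> \<bar>1 + u\<^sup>2\<bar>" for u :: real
      using zero_le_power2[of "\<bar>u\<bar> - 1"] by (simp add: power2_eq_square algebra_simps)
    show i: "integrable \<mu> (monomial_fun \<alpha>)"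
    proof (rule Bochner_Integration.integrable_bound)
      show "integrable \<mu> (\<lambda>x. 1 + (monomial_fun \<alpha> x)\<^sup>2)" using sq_int[of \<alpha>] by simp
      show "AE x in \<mu>. norm (monomial_fun \<alpha> x) \<le> norm (1 + (monomial_fun \<alpha> x)\<^sup>2)"
        unfolding real_norm_def by (intro AE_I2 ab)
    qed simp
    have "\<bar>y \<alpha> - (\<integral>x. monomial_fun \<alpha> x \<partial>\<mu>)\<bar> \<le> 2 * K (\<alpha> + \<alpha>) / R" if R: "0 < R" for R
    proof (rule LIMSEQ_le_const2)
      let ?E = "\<lambda>m. measure_pmf.expectation (p (r m))"
      have "?E m (\<lambda>x. \<bar>monomial_fun \<alpha> x - clip R (monomial_fun \<alpha> x)\<bar>) \<le> K (\<alpha> + \<alpha>) / R" for m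
      proof -
        have "?E m (\<lambda>x. \<bar>monomial_fun \<alpha> x - clip R (monomial_fun \<alpha> x)\<bar>)
            \<le> ?E m (\<lambda>x. (monomial_fun \<alpha> x)\<^sup>2 / R)"
          using R by (intro integral_mono int abs_diff_clip_le)
        also have "\<dots> \<le> K (\<alpha> + \<alpha>) / R"
          using K[of "r m" "\<alpha> + \<alpha>", unfolded sq] R by (simp add: divide_right_mono)
        finally show ?thesis .
      qed
      then have 1: "\<bar>?E m (monomial_fun \<alpha>) - ?E m (\<lambda>x. clip R (monomial_fun \<alpha> x))\<bar> \<le> K (\<alpha> + \<alpha>) / R" for m
        by (subst Bochner_Integration.integral_diff[symmetric, OF int int])
          (rule order_trans[OF integral_abs_bound])
      have ic: "integrable \<mu> (\<lambda>x. clip R (monomial_fun \<alpha> x))"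
        using R by (intro \<mu>.integrable_const_bound[where B = R])
          (auto simp: abs_clip_le intro!: borel_measurable_continuous_onI continuous_intros
            cong: measurable_cong_sets[OF sets])
      have "(\<integral>x. \<bar>monomial_fun \<alpha> x - clip R (monomial_fun \<alpha> x)\<bar> \<partial>\<mu>)
          \<le> (\<integral>x. (monomial_fun \<alpha> x)\<^sup>2 / R \<partial>\<mu>)"
        using R i ic sq_int[of \<alpha>] by (intro integral_mono abs_diff_clip_le) auto
      also have "\<dots> \<le> K (\<alpha> + \<alpha>) / R"
        using sq_int[of \<alpha>] R by (simp add: divide_right_mono)
      finally have 2: "\<bar>(\<integral>x. monomial_fun \<alpha> x \<partial>\<mu>) - (\<integral>x. clip R (monomial_fun \<alpha> x) \<partial>\<mu>)\<bar> \<le> K (\<alpha> + \<alpha>) / R"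
        by (subst Bochner_Integration.integral_diff[symmetric, OF i ic])
          (rule order_trans[OF integral_abs_bound])
      \<comment> \<open>The subtracted term tends to 0 by weak convergence. For every
        \<open>m\<close> the triangle inequality bounds the difference by two truncation errors,
        each at most \<open>K (\<alpha> + \<alpha>) / R\<close>; at the end \<open>R\<close> goes to
        infinity.\<close>
      show "(\<lambda>m. \<bar>?E m (monomial_fun \<alpha>) - (\<integral>x. monomial_fun \<alpha> x \<partial>\<mu>)\<bar>
          - \<bar>?E m (\<lambda>x. clip R (monomial_fun \<alpha> x)) - (\<integral>x. clip R (monomial_fun \<alpha> x) \<partial>\<mu>)\<bar>)
          \<longlonglongrightarrow> \<bar>y \<alpha> - (\<integral>x. monomial_fun \<alpha> x \<partial>\<mu>)\<bar>"
      proof -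
        have a: "(\<lambda>m. ?E m (monomial_fun \<alpha>)) \<longlonglongrightarrow> y \<alpha>"
          using LIMSEQ_subseq_LIMSEQ[OF lim r] by (simp add: o_def)
        have b: "(\<lambda>m. ?E m (\<lambda>x. clip R (monomial_fun \<alpha> x))) \<longlonglongrightarrow> (\<integral>x. clip R (monomial_fun \<alpha> x) \<partial>\<mu>)"
          using R by (intro weak[of _ R] continuous_intros) (auto simp: abs_clip_le)
        show ?thesis
          by (rule tendsto_eq_intros a b refl | simp)+
      qed
      show "\<exists>N. \<forall>m\<ge>N. \<bar>?E m (monomial_fun \<alpha>) - (\<integral>x. monomial_fun \<alpha> x \<partial>\<mu>)\<bar>
          - \<bar>?E m (\<lambda>x. clip R (monomial_fun \<alpha> x)) - (\<integral>x. clip R (monomial_fun \<alpha> x) \<partial>\<mu>)\<bar>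
          \<le> 2 * K (\<alpha> + \<alpha>) / R"
      proof (intro exI allI impI)
        fix m
        show "\<bar>?E m (monomial_fun \<alpha>) - (\<integral>x. monomial_fun \<alpha> x \<partial>\<mu>)\<bar>
          - \<bar>?E m (\<lambda>x. clip R (monomial_fun \<alpha> x)) - (\<integral>x. clip R (monomial_fun \<alpha> x) \<partial>\<mu>)\<bar>
          \<le> 2 * K (\<alpha> + \<alpha>) / R"
          using 1[of m] 2 by (simp add: field_simps)
      qed
    qed
    then have bd: "\<bar>y \<alpha> - (\<integral>x. monomial_fun \<alpha> x \<partial>\<mu>)\<bar> \<le> 2 * K (\<alpha> + \<alpha>) / real (Suc k)" for k by simp
    have "\<bar>y \<alpha> - (\<integral>x. monomial_fun \<alpha> x \<partial>\<mu>)\<bar> \<le> 0"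
    proof (rule LIMSEQ_le_const)
      show "(\<lambda>k. 2 * K (\<alpha> + \<alpha>) / real (Suc k)) \<longlonglongrightarrow> 0"
        using LIMSEQ_Suc[OF lim_const_over_n[of "2 * K (\<alpha> + \<alpha>)"]] by simp
    qed (use bd in blast)
    then show "y \<alpha> = (\<integral>x. monomial_fun \<alpha> x \<partial>\<mu>)" by simp
  qed
  then show ?thesis using \<open>prob_space \<mu>\<close> sets unfolding represents_def by blast
qed

subsection \<open>Families of power series of exponential type\<close>

text \<open>One pair of constants serves the whole family. The index is a coordinate, a sequence
  number or both; uniformity provides the majorant for dominated convergence.\<close>

definition exp_bounded :: "('a \<Rightarrow> real fps) \<Rightarrow> bool" where
  "exp_bounded g \<longleftrightarrow>
     (\<exists>C R. 0 \<le> C \<and> 0 \<le> R \<and> (\<forall>m k. \<bar>fps_nth (g m) k\<bar> \<le> C * R ^ k / fact k))"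

lemma exp_boundedI:
  assumes "0 \<le> C" "0 \<le> R" "\<And>m k. \<bar>fps_nth (g m) k\<bar> \<le> C * R ^ k / fact k"
  shows "exp_bounded g"
  using assms unfolding exp_bounded_def by blast

lemma exp_bounded_comp: "exp_bounded g \<Longrightarrow> exp_bounded (\<lambda>x. g (h x))"
  unfolding exp_bounded_def by blast

text \<open>The Cauchy product of the two majorants is summed by the binomial theorem, so the
  exponential types add.\<close>

lemma exp_bounded_mult:
  assumes "exp_bounded f" "exp_bounded g"
  shows "exp_bounded (\<lambda>m. f m * g m)"
proof -
  obtain C R where f: "0 \<le> C" "0 \<le> R" "\<And>m k. \<bar>fps_nth (f m) k\<bar> \<le> C * R ^ k / fact k"
    using assms(1) unfolding exp_bounded_def by blast
  obtain D S where g: "0 \<le> D" "0 \<le> S" "\<And>m k. \<bar>fps_nth (g m) k\<bar> \<le> D * S ^ k / fact k"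
    using assms(2) unfolding exp_bounded_def by blast
  show ?thesis
  proof (rule exp_boundedI[of "C * D" "R + S"])
    fix m k
    have "\<bar>fps_nth (f m * g m) k\<bar> \<le> (\<Sum>i=0..k. \<bar>fps_nth (f m) i * fps_nth (g m) (k - i)\<bar>)"
      unfolding fps_mult_nth by (rule sum_abs)
    also have "\<dots> \<le> (\<Sum>i=0..k. (C * R ^ i / fact i) * (D * S ^ (k - i) / fact (k - i)))"
      unfolding abs_mult using f g by (intro sum_mono mult_mono) auto
    also have "\<dots> = (\<Sum>i=0..k. C * D / fact k * (real (k choose i) * R ^ i * S ^ (k - i)))"
    proof (rule sum.cong)
      fix i assume "i \<in> {0..k}"
      then have "real (k choose i) = fact k / (fact i * fact (k - i))"
        by (simp add: binomial_fact)
      then show "(C * R ^ i / fact i) * (D * S ^ (k - i) / fact (k - i))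
          = C * D / fact k * (real (k choose i) * R ^ i * S ^ (k - i))" by simp
    qed simp
    also have "\<dots> = C * D / fact k * (R + S) ^ k"
      unfolding sum_distrib_left[symmetric] binomial_ring by (simp add: atLeast0AtMost)
    finally show "\<bar>fps_nth (f m * g m) k\<bar> \<le> C * D * (R + S) ^ k / fact k" by simp
  qed (use f g in auto)
qed

lemma exp_bounded_add:
  assumes "exp_bounded f" "exp_bounded g"
  shows "exp_bounded (\<lambda>m. f m + g m)"
proof -
  obtain C R where f: "0 \<le> C" "0 \<le> R" "\<And>m k. \<bar>fps_nth (f m) k\<bar> \<le> C * R ^ k / fact k"
    using assms(1) unfolding exp_bounded_def by blast
  obtain D S where g: "0 \<le> D" "0 \<le> S" "\<And>m k. \<bar>fps_nth (g m) k\<bar> \<le> D * S ^ k / fact k"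
    using assms(2) unfolding exp_bounded_def by blast
  show ?thesis
  proof (rule exp_boundedI[of "C + D" "max R S"])
    fix m k
    have "\<bar>fps_nth (f m + g m) k\<bar> \<le> C * R ^ k / fact k + D * S ^ k / fact k"
      using f(3)[of m k] g(3)[of m k] by simp
    also have "\<dots> \<le> C * (max R S) ^ k / fact k + D * (max R S) ^ k / fact k"
      using f g by (intro add_mono divide_right_mono mult_left_mono power_mono) auto
    finally show "\<bar>fps_nth (f m + g m) k\<bar> \<le> (C + D) * (max R S) ^ k / fact k"
      by (simp add: distrib_right add_divide_distrib)
  qed (use f g in auto)
qed

lemma exp_bounded_const:
  assumes "\<And>m. \<bar>c m\<bar> \<le> K"
  shows "exp_bounded (\<lambda>m. fps_const (c m))"
proof (rule exp_boundedI[of K 0])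
  show "0 \<le> K" using assms[of undefined] by linarith
  show "\<bar>fps_nth (fps_const (c m)) k\<bar> \<le> K * 0 ^ k / fact k" for m k
    using assms[of m] by (simp add: power_0_left)
qed simp

lemma exp_bounded_const1: "exp_bounded (\<lambda>m. fps_const c)"
  by (rule exp_bounded_const[of "\<lambda>_. c" "\<bar>c\<bar>"]) simp

lemma exp_bounded_1: "exp_bounded (\<lambda>m. 1)"
  using exp_bounded_const1[of 1] by simp

lemma exp_bounded_power: "exp_bounded f \<Longrightarrow> exp_bounded (\<lambda>m. f m ^ j)"
  by (induction j) (auto intro: exp_bounded_1 exp_bounded_mult)

lemma exp_bounded_deriv:
  assumes "exp_bounded f"
  shows "exp_bounded (\<lambda>m. fps_deriv (f m))"
proof -
  obtain C R where f: "0 \<le> C" "0 \<le> R" "\<And>m k. \<bar>fps_nth (f m) k\<bar> \<le> C * R ^ k / fact k"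
    using assms unfolding exp_bounded_def by blast
  show ?thesis
  proof (rule exp_boundedI[of "C * R" R])
    fix m k
    have "\<bar>fps_nth (fps_deriv (f m)) k\<bar> = real (Suc k) * \<bar>fps_nth (f m) (Suc k)\<bar>"
      by (simp add: abs_mult)
    also have "\<dots> \<le> real (Suc k) * (C * R ^ Suc k / fact (Suc k))"
      by (rule mult_left_mono[OF f(3)]) simp
    also have "\<dots> = (real (Suc k) / real (Suc k)) * (C * R * R ^ k / fact k)"
      by (simp only: fact_Suc of_nat_mult power_Suc) (simp add: ac_simps)
    also have "\<dots> = C * R * R ^ k / fact k" by simp
    finally show "\<bar>fps_nth (fps_deriv (f m)) k\<bar> \<le> C * R * R ^ k / fact k" .
  qed (use f in auto)
qed

text \<open>Over finitely many coordinates, the sums of the individual constants serve for all of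
  them at once.\<close>

lemma exp_bounded_finite_index:
  fixes g :: "'a \<Rightarrow> 'n::finite \<Rightarrow> real fps"
  assumes "\<And>i. exp_bounded (\<lambda>m. g m i)"
  shows "exp_bounded (\<lambda>(m, i). g m i)"
proof -
  have "\<forall>i. \<exists>C R. 0 \<le> C \<and> 0 \<le> R \<and> (\<forall>m k. \<bar>fps_nth (g m i) k\<bar> \<le> C * R ^ k / fact k)"
    using assms unfolding exp_bounded_def by blast
  then obtain C R where CR: "\<And>i. 0 \<le> C i" "\<And>i. 0 \<le> R i"
    "\<And>i m k. \<bar>fps_nth (g m i) k\<bar> \<le> C i * R i ^ k / fact k" by metis
  have le: "C i \<le> sum C UNIV" "R i \<le> sum R UNIV" for i
    using CR by (auto intro: member_le_sum)
  have "\<bar>fps_nth (g m i) k\<bar> \<le> sum C UNIV * sum R UNIV ^ k / fact k" for m i k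
  proof -
    have "C i * R i ^ k / fact k \<le> sum C UNIV * sum R UNIV ^ k / fact k"
      using CR le by (intro divide_right_mono mult_mono power_mono) (auto intro: sum_nonneg)
    then show ?thesis using CR(3)[where i=i and m=m and k=k] by linarith
  qed
  then show ?thesis
    using CR by (intro exp_boundedI[of "sum C UNIV" "sum R UNIV"]) (auto intro: sum_nonneg)
qed

lemma exp_bounded_cutoff:
  assumes "exp_bounded f"
  shows "exp_bounded (\<lambda>m. fps_cutoff (N m) (f (h m)))"
proof -
  obtain C R where f: "0 \<le> C" "0 \<le> R" "\<And>m k. \<bar>fps_nth (f m) k\<bar> \<le> C * R ^ k / fact k"
    using assms unfolding exp_bounded_def by blast
  then show ?thesis by (intro exp_boundedI[of C R]) auto
qed

lemma tendsto_fps_mult_nth: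
  assumes "\<And>k. (\<lambda>m. fps_nth (f m) k) \<longlonglongrightarrow> fps_nth F k" "\<And>k. (\<lambda>m. fps_nth (g m) k) \<longlonglongrightarrow> fps_nth G k"
  shows "(\<lambda>m. fps_nth (f m * g m) k) \<longlonglongrightarrow> fps_nth (F * G :: real fps) k"
  unfolding fps_mult_nth by (intro tendsto_sum tendsto_mult assms)

lemma fps_cutoff_nth_tendsto: "(\<lambda>K. fps_nth (fps_cutoff K f) k) \<longlonglongrightarrow> fps_nth f k"
  by (rule tendsto_eventually) (use eventually_gt_at_top[of k] in eventually_elim, simp)

subsection \<open>The extension of a moment functional to products of power series\<close>

text \<open>The bound is on the square, as Cauchy-Schwarz against the constant monomial delivers it
  for every \<alpha>.\<close>

definition moment_growth :: "('n::finite expo \<Rightarrow> real) \<Rightarrow> bool" where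
  "moment_growth y \<longleftrightarrow> (\<exists>b. \<forall>\<alpha>. (y \<alpha>)\<^sup>2 \<le> b * fact (expo_deg \<alpha>))"

text \<open>The value on the function sending \<open>x\<close> to the product of the
  \<open>g i\<close> at \<open>x $ i\<close>, expanded into monomials. Written as an integral over
  counting measure, the series is subject to dominated convergence and linearity of the
  integral.\<close>

definition ext_functional :: "('n::finite expo \<Rightarrow> real) \<Rightarrow> ('n \<Rightarrow> real fps) \<Rightarrow> real" where
  "ext_functional y g =
     (\<integral>\<alpha>. y \<alpha> * (\<Prod>i\<in>UNIV. fps_nth (g i) (expt \<alpha> i)) \<partial>count_space UNIV)"

text \<open>The multinomial coefficient is at most \<open>card S ^ sum a S\<close>. In the induction
  it acquires one binomial factor, which is bounded by a single term in the expansion of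
  \<open>(card S + 1) ^ (a x + s)\<close>.\<close>

lemma fact_sum_le:
  assumes "finite S"
  shows "fact (sum a S) \<le> real (card S) ^ sum a S * (\<Prod>i\<in>S. fact (a i))"
  using assms
proof (induction S rule: finite_induct)
  case empty
  then show ?case by simp
next
  case (insert x S)
  define s where "s = sum a S"
  have "real ((a x + s) choose s) * real (card S) ^ s * 1 ^ (a x + s - s)
      \<le> (\<Sum>k\<le>a x + s. real ((a x + s) choose k) * real (card S) ^ k * 1 ^ (a x + s - k))"
    by (rule member_le_sum) auto
  also have "\<dots> = (real (card S) + 1) ^ (a x + s)" by (rule binomial_ring[symmetric])
  finally have bin: "real ((a x + s) choose s) * real (card S) ^ s \<le> (real (card S) + 1) ^ (a x + s)"
    by simp
  have "(fact (a x + s) :: real) = real ((a x + s) choose s) * fact s * fact (a x)"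
    by (simp add: binomial_fact)
  also have "\<dots> \<le> real ((a x + s) choose s) * (real (card S) ^ s * (\<Prod>i\<in>S. fact (a i))) * fact (a x)"
    using insert.IH unfolding s_def by (intro mult_left_mono mult_right_mono) auto
  also have "\<dots> = (real ((a x + s) choose s) * real (card S) ^ s) * (fact (a x) * (\<Prod>i\<in>S. fact (a i)))"
    by (simp add: ac_simps)
  also have "\<dots> \<le> (real (card S) + 1) ^ (a x + s) * (fact (a x) * (\<Prod>i\<in>S. fact (a i)))"
    by (intro mult_right_mono bin mult_nonneg_nonneg prod_nonneg) auto
  finally show ?case using insert.hyps by (simp add: s_def add.commute)
qed

text \<open>With \<open>x = (2 * R)\<^sup>2\<close>, each term \<open>x ^ k / fact k\<close> is
  below \<open>exp x\<close>, so \<open>(2 * R) ^ k / sqrt (fact k)\<close> is bounded and a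
  geometric factor \<open>(1 / 2) ^ k\<close> remains.\<close>

lemma summable_power_over_sqrt_fact:
  assumes "0 \<le> R"
  shows "summable (\<lambda>k. R ^ k / sqrt (fact k))"
proof (rule summable_comparison_test'[where N = 0])
  show "summable (\<lambda>k. exp ((2 * R)\<^sup>2) * (1 / 2) ^ k)"
    by (intro summable_mult summable_geometric) simp
  fix k :: nat
  define x where "x = (2 * R)\<^sup>2"
  have x: "0 \<le> x" by (simp add: x_def)
  have "sum (\<lambda>n. inverse (fact n) * x ^ n) {k} \<le> suminf (\<lambda>n. inverse (fact n) * x ^ n)"
    using x by (intro sum_le_suminf[OF summable_exp]) auto
  then have le: "x ^ k / fact k \<le> exp x" by (simp add: exp_def field_simps)
  have "(2 * R) ^ k / sqrt (fact k) = sqrt (x ^ k / fact k)"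
  proof -
    have "x ^ k = ((2 * R) ^ k)\<^sup>2"
      by (simp only: x_def power_mult[symmetric] mult.commute[of 2 k])
    then show ?thesis using assms by (simp add: real_sqrt_divide)
  qed
  also have "\<dots> \<le> sqrt (exp x * exp x)"
  proof (rule real_sqrt_le_mono)
    have "exp x * 1 \<le> exp x * exp x" using x by (intro mult_left_mono) auto
    then show "x ^ k / fact k \<le> exp x * exp x" using le by linarith
  qed
  also have "\<dots> = exp x" by simp
  finally have "(2 * R) ^ k / sqrt (fact k) \<le> exp ((2 * R)\<^sup>2)" by (simp add: x_def)
  then show "norm (R ^ k / sqrt (fact k)) \<le> exp ((2 * R)\<^sup>2) * (1 / 2) ^ k"
    using assms by (simp add: power_mult_distrib power_one_over field_simps)
qed

lemma bij_lookup: "bij_betw expt (UNIV :: 'n::finite expo set) UNIV"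
proof (rule bij_betwI[where g = Abs_poly_mapping])
  fix F :: "'n \<Rightarrow> nat"
  show "expt (Abs_poly_mapping F) = F" by (simp add: Abs_poly_mapping_inverse)
qed auto

lemma sqrt_prod: "sqrt (\<Prod>i\<in>A. f i) = (\<Prod>i\<in>A. sqrt (f i))"
  by (induction A rule: infinite_finite_induct) (auto simp: real_sqrt_mult)

text \<open>The growth bound and the multinomial estimate split over the coordinates, so the summand
  is dominated by a product of terms \<open>C * (R * sqrt n) ^ k / sqrt (fact k)\<close>. A finite
  product of summable families is summable over all exponents.\<close>

lemma moment_growth_summable:
  fixes y :: "'n::finite expo \<Rightarrow> real"
  assumes "moment_growth y" and CR: "0 \<le> C" "0 \<le> R"
  shows "integrable (count_space UNIV)
    (\<lambda>\<alpha>. \<bar>y \<alpha>\<bar> * (\<Prod>i\<in>UNIV. C * R ^ expt \<alpha> i / fact (expt \<alpha> i)))"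
proof -
  obtain b where b: "\<And>\<alpha>. (y \<alpha>)\<^sup>2 \<le> b * fact (expo_deg \<alpha>)"
    using assms(1) unfolding moment_growth_def by blast
  define n where "n = real CARD('n)"
  define h where "h k = C * ((R * sqrt n) ^ k / sqrt (fact k))" for k
  have "(y 0)\<^sup>2 \<le> b" using b[of 0] by simp
  then have b0: "0 \<le> b" by (rule order_trans[OF zero_le_power2])
  have "norm (h k) = C * ((R * sqrt n) ^ k / sqrt (fact k))" for k
    using CR by (simp add: h_def n_def)
  then have "integrable (count_space UNIV) h"
    unfolding integrable_count_space_nat_iff
    using CR by (simp only:) (intro summable_mult summable_power_over_sqrt_fact, simp add: n_def)
  then have "Infinite_Set_Sum.abs_summable_on (\<lambda>F. \<Prod>i\<in>UNIV. h (F i)) (PiE (UNIV :: 'n set) (\<lambda>_. UNIV))"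
    by (intro abs_summable_on_prod_PiE) (auto simp: Infinite_Set_Sum.abs_summable_on_def)
  then have "Infinite_Set_Sum.abs_summable_on (\<lambda>F :: 'n \<Rightarrow> nat. \<Prod>i\<in>UNIV. h (F i)) UNIV" by simp
  then have "Infinite_Set_Sum.abs_summable_on
      (\<lambda>\<alpha> :: 'n expo. \<Prod>i\<in>UNIV. h (expt \<alpha> i)) UNIV"
    by (subst Infinite_Set_Sum.abs_summable_on_reindex_bij_betw[OF bij_lookup])
  then have int: "integrable (count_space UNIV)
      (\<lambda>\<alpha> :: 'n expo. sqrt b * (\<Prod>i\<in>UNIV. h (expt \<alpha> i)))"
    unfolding Infinite_Set_Sum.abs_summable_on_def by (rule integrable_mult_right)
  show ?thesis
  proof (rule Bochner_Integration.integrable_bound[OF int]; (intro AE_I2)?)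
    fix \<alpha> :: "'n expo"
    let ?a = "expt \<alpha>"
    have "(fact (expo_deg \<alpha>) :: real) \<le> n ^ sum ?a UNIV * (\<Prod>i\<in>UNIV. fact (?a i))"
      unfolding expo_deg_def n_def using fact_sum_le[of UNIV ?a] by simp
    also have "n ^ sum ?a UNIV = (\<Prod>i\<in>UNIV. n ^ ?a i)" by (rule power_sum)
    finally have "b * fact (expo_deg \<alpha>) \<le> b * (\<Prod>i\<in>UNIV. n ^ ?a i * fact (?a i))"
      using b0 by (intro mult_left_mono) (auto simp: prod.distrib)
    with b[of \<alpha>] have "(y \<alpha>)\<^sup>2 \<le> b * (\<Prod>i\<in>UNIV. n ^ ?a i * fact (?a i))" by linarith
    then have "\<bar>y \<alpha>\<bar> \<le> sqrt (b * (\<Prod>i\<in>UNIV. n ^ ?a i * fact (?a i)))" by (rule real_le_rsqrt[of "\<bar>y \<alpha>\<bar>", simplified])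
    also have "\<dots> = sqrt b * (\<Prod>i\<in>UNIV. sqrt n ^ ?a i * sqrt (fact (?a i)))"
      by (simp add: real_sqrt_mult sqrt_prod real_sqrt_power)
    finally have yb: "\<bar>y \<alpha>\<bar> \<le> sqrt b * (\<Prod>i\<in>UNIV. sqrt n ^ ?a i * sqrt (fact (?a i)))" .
    have nn: "0 \<le> (\<Prod>i\<in>UNIV. C * R ^ ?a i / fact (?a i))"
      using CR by (intro prod_nonneg) auto
    have "\<bar>y \<alpha>\<bar> * (\<Prod>i\<in>UNIV. C * R ^ ?a i / fact (?a i))
        \<le> sqrt b * (\<Prod>i\<in>UNIV. sqrt n ^ ?a i * sqrt (fact (?a i))) * (\<Prod>i\<in>UNIV. C * R ^ ?a i / fact (?a i))"
      by (rule mult_right_mono[OF yb nn])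
    also have "\<dots> = sqrt b * (\<Prod>i\<in>UNIV. (sqrt n ^ ?a i * sqrt (fact (?a i))) * (C * R ^ ?a i / fact (?a i)))"
      by (simp only: prod.distrib mult.assoc)
    also have "(\<lambda>i. (sqrt n ^ ?a i * sqrt (fact (?a i))) * (C * R ^ ?a i / fact (?a i)))
        = (\<lambda>i. h (?a i))"
    proof
      fix i
      have "sqrt (fact (?a i)) * sqrt (fact (?a i)) = (fact (?a i) :: real)" by simp
      then have "sqrt (fact (?a i)) / fact (?a i) = (1 :: real) / sqrt (fact (?a i))"
        by (metis divide_divide_eq_left div_self fact_nonzero real_sqrt_eq_zero_cancel_iff)
      then show "(sqrt n ^ ?a i * sqrt (fact (?a i))) * (C * R ^ ?a i / fact (?a i)) = h (?a i)"
        by (simp add: h_def power_mult_distrib field_simps)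
    qed
    finally have "\<bar>y \<alpha>\<bar> * (\<Prod>i\<in>UNIV. C * R ^ ?a i / fact (?a i))
        \<le> \<bar>sqrt b * (\<Prod>i\<in>UNIV. h (?a i))\<bar>"
      by (rule order_trans[OF _ abs_ge_self])
    then show "norm (\<bar>y \<alpha>\<bar> * (\<Prod>i\<in>UNIV. C * R ^ ?a i / fact (?a i)))
        \<le> norm (sqrt b * (\<Prod>i\<in>UNIV. h (?a i)))"
      using nn by (simp only: real_norm_def abs_of_nonneg[OF mult_nonneg_nonneg[OF abs_ge_zero nn]])
  qed simp
qed

lemma prod_fps_nth_le:
  fixes g :: "'n::finite \<Rightarrow> real fps"
  assumes "\<And>i. \<bar>fps_nth (g i) (a i)\<bar> \<le> C * R ^ a i / fact (a i)"
  shows "\<bar>\<Prod>i\<in>UNIV. fps_nth (g i) (a i)\<bar> \<le> (\<Prod>i\<in>(UNIV :: 'n set). C * R ^ a i / fact (a i))"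
proof -
  have "\<bar>\<Prod>i\<in>UNIV. fps_nth (g i) (a i)\<bar> = (\<Prod>i\<in>UNIV. \<bar>fps_nth (g i) (a i)\<bar>)" by (rule abs_prod)
  also have "\<dots> \<le> (\<Prod>i\<in>UNIV. C * R ^ a i / fact (a i))" using assms by (intro prod_mono) auto
  finally show ?thesis .
qed

lemma ext_functional_integrable:
  fixes y :: "'n::finite expo \<Rightarrow> real"
  assumes "moment_growth y" "exp_bounded g"
  shows "integrable (count_space UNIV)
    (\<lambda>\<alpha>. y \<alpha> * (\<Prod>i\<in>UNIV. fps_nth (g i) (expt \<alpha> i)))"
proof -
  obtain C R where g: "0 \<le> C" "0 \<le> R" "\<And>m k. \<bar>fps_nth (g m) k\<bar> \<le> C * R ^ k / fact k"
    using assms(2) unfolding exp_bounded_def by blast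
  show ?thesis
  proof (rule Bochner_Integration.integrable_bound[OF moment_growth_summable[OF assms(1) g(1,2)]])
    have "norm (y \<alpha> * (\<Prod>i\<in>UNIV. fps_nth (g i) (expt \<alpha> i)))
        \<le> norm (\<bar>y \<alpha>\<bar> * (\<Prod>i\<in>UNIV. C * R ^ expt \<alpha> i / fact (expt \<alpha> i)))" for \<alpha>
      using prod_fps_nth_le[of g "expt \<alpha>" C R, OF g(3)]
      unfolding real_norm_def abs_mult by (intro mult_mono) auto
    then show "AE \<alpha> in count_space UNIV. norm (y \<alpha> * (\<Prod>i\<in>UNIV. fps_nth (g i) (expt \<alpha> i)))
        \<le> norm (\<bar>y \<alpha>\<bar> * (\<Prod>i\<in>UNIV. C * R ^ expt \<alpha> i / fact (expt \<alpha> i)))"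
      by (rule AE_I2)
  qed simp
qed

text \<open>Dominated convergence; the majorant comes from constants uniform in both
  \<open>m\<close> and the coordinate.\<close>

lemma ext_functional_tendsto:
  fixes y :: "'n::finite expo \<Rightarrow> real" and g :: "nat \<Rightarrow> 'n \<Rightarrow> real fps"
  assumes y: "moment_growth y" and g: "\<And>i. exp_bounded (\<lambda>m. g m i)"
    and lim: "\<And>i k. (\<lambda>m. fps_nth (g m i) k) \<longlonglongrightarrow> fps_nth (G i) k"
  shows "(\<lambda>m. ext_functional y (g m)) \<longlonglongrightarrow> ext_functional y G"
proof -
  obtain C R where CR: "0 \<le> C" "0 \<le> R"
    "\<And>z k. \<bar>fps_nth ((\<lambda>(m, i). g m i) z) k\<bar> \<le> C * R ^ k / fact k"
    using exp_bounded_finite_index[of g, OF g] unfolding exp_bounded_def by blast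
  have le: "\<bar>fps_nth (g m i) k\<bar> \<le> C * R ^ k / fact k" for m i k
    using CR(3)[of "(m, i)" k] by simp
  show ?thesis
    unfolding ext_functional_def
  proof (rule integral_dominated_convergence[OF _ _ moment_growth_summable[OF y CR(1,2)]])
    show "AE \<alpha> in count_space UNIV.
        (\<lambda>m. y \<alpha> * (\<Prod>i\<in>UNIV. fps_nth (g m i) (expt \<alpha> i)))
        \<longlonglongrightarrow> y \<alpha> * (\<Prod>i\<in>UNIV. fps_nth (G i) (expt \<alpha> i))"
      by (intro AE_I2 tendsto_intros tendsto_prod lim)
    have "norm (y \<alpha> * (\<Prod>i\<in>UNIV. fps_nth (g m i) (expt \<alpha> i)))
        \<le> \<bar>y \<alpha>\<bar> * (\<Prod>i\<in>UNIV. C * R ^ expt \<alpha> i / fact (expt \<alpha> i))" for m \<alpha>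
      using prod_fps_nth_le[of "g m" "expt \<alpha>" C R, OF le]
      unfolding real_norm_def abs_mult by (intro mult_mono) auto
    then show "AE \<alpha> in count_space UNIV. norm (y \<alpha> * (\<Prod>i\<in>UNIV. fps_nth (g m i) (expt \<alpha> i)))
        \<le> \<bar>y \<alpha>\<bar> * (\<Prod>i\<in>UNIV. C * R ^ expt \<alpha> i / fact (expt \<alpha> i))" for m
      by (rule AE_I2)
  qed simp_all
qed

lemma ext_functional_sum:
  fixes y :: "'n::finite expo \<Rightarrow> real"
  assumes y: "moment_growth y" and J: "finite J"
    and g: "\<And>F. F \<in> PiE UNIV (\<lambda>_. J) \<Longrightarrow> exp_bounded (\<lambda>i. g i (F i))"
  shows "ext_functional y (\<lambda>i. \<Sum>j\<in>J. g i j)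
    = (\<Sum>F\<in>PiE UNIV (\<lambda>_. J). ext_functional y (\<lambda>i. g i (F i)))"
proof -
  have "(\<Prod>i\<in>UNIV. fps_nth (\<Sum>j\<in>J. g i j) (expt \<alpha> i))
      = (\<Sum>F\<in>PiE UNIV (\<lambda>_. J). \<Prod>i\<in>UNIV. fps_nth (g i (F i)) (expt \<alpha> i))"
    for \<alpha> :: "'n expo"
    unfolding fps_sum_nth by (rule prod_sum_PiE) (use J in auto)
  then have "ext_functional y (\<lambda>i. \<Sum>j\<in>J. g i j)
    = (\<integral>\<alpha>. (\<Sum>F\<in>PiE UNIV (\<lambda>_. J). y \<alpha> * (\<Prod>i\<in>UNIV. fps_nth (g i (F i)) (expt \<alpha> i)))
        \<partial>count_space UNIV)"
    unfolding ext_functional_def by (simp add: sum_distrib_left)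
  also have "\<dots> = (\<Sum>F\<in>PiE UNIV (\<lambda>_. J). ext_functional y (\<lambda>i. g i (F i)))"
    unfolding ext_functional_def
    by (intro Bochner_Integration.integral_sum ext_functional_integrable[OF y] g)
  finally show ?thesis .
qed

lemma ext_functional_cmult:
  fixes y :: "'n::finite expo \<Rightarrow> real"
  shows "ext_functional y (\<lambda>i. fps_const (c i) * g i) = (\<Prod>i\<in>UNIV. c i) * ext_functional y g"
  unfolding ext_functional_def
  by (simp add: prod.distrib mult.left_commute[of "y _"])

lemma ext_functional_monomial:
  fixes y :: "'n::finite expo \<Rightarrow> real"
  shows "ext_functional y (\<lambda>i. fps_X ^ expt \<alpha> i) = y \<alpha>"
proof -
  have "(\<Prod>i\<in>UNIV. fps_nth (fps_X ^ expt \<alpha> i) (expt \<beta> i))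
      = (if \<beta> = \<alpha> then 1 else (0::real))" for \<beta>
  proof (cases "\<beta> = \<alpha>")
    case False
    then obtain i where "expt \<beta> i \<noteq> expt \<alpha> i"
      by (metis poly_mapping_eqI)
    then show ?thesis using False by (auto intro!: prod_zero)
  qed simp
  then have "ext_functional y (\<lambda>i. fps_X ^ expt \<alpha> i)
      = (\<integral>\<beta>. (if \<beta> = \<alpha> then y \<alpha> else 0) \<partial>count_space UNIV)"
    unfolding ext_functional_def by (intro Bochner_Integration.integral_cong) auto
  also have "\<dots> = y \<alpha>"
  proof -
    have "{\<beta>. \<beta> \<in> UNIV \<and> (if \<beta> = \<alpha> then y \<alpha> else 0) \<noteq> 0} \<subseteq> {\<alpha>}" by auto
    then have "(\<integral>\<beta>. (if \<beta> = \<alpha> then y \<alpha> else 0) \<partial>count_space UNIV)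
        = (\<Sum>\<beta>\<in>{\<alpha>}. if \<beta> = \<alpha> then y \<alpha> else 0)"
      by (intro lebesgue_integral_count_space_finite_support[THEN trans] sum.mono_neutral_left)
        (auto intro: finite_subset)
    then show ?thesis by simp
  qed
  finally show ?thesis .
qed

section \<open>Polynomial truncations and positivity on squares\<close>

lemma lookup_Abs_expo [simp]: "expt (Abs_poly_mapping F :: 'n::finite expo) = F"
  by (simp add: Abs_poly_mapping_inverse)

lemma Abs_expo_inj: "inj_on (Abs_poly_mapping :: ('n::finite \<Rightarrow> nat) \<Rightarrow> 'n expo) A"
  by (metis inj_onI lookup_Abs_expo)

lemma fps_cutoff_eq_sum: "fps_cutoff K f = (\<Sum>k<K. fps_const (fps_nth f k) * fps_X ^ k)"
  for f :: "real fps"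
  by (rule fps_ext) (simp add: fps_sum_nth if_distrib cong: if_cong)

lemma exp_bounded_monomials: "exp_bounded (\<lambda>i::'n::finite. fps_const (c i) * fps_X ^ F i)"
proof -
  have "exp_bounded (\<lambda>_::unit. fps_const (c i) * fps_X ^ F i)" for i
    by (intro exp_bounded_mult exp_bounded_const1 exp_bounded_power
      exp_boundedI[of 1 1 "\<lambda>_. fps_X"]) (auto simp: fps_X_nth)
  from exp_bounded_comp[OF exp_bounded_finite_index[OF this], where h = "\<lambda>i. ((), i)"]
  show ?thesis by simp
qed

lemma ext_functional_cutoff:
  fixes y :: "'n::finite expo \<Rightarrow> real"
  assumes y: "moment_growth y"
  shows "ext_functional y (\<lambda>i. fps_cutoff K (g i))
    = (\<Sum>F\<in>PiE UNIV (\<lambda>_. {..<K}). (\<Prod>i\<in>UNIV. fps_nth (g i) (F i)) * y (Abs_poly_mapping F))"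
proof -
  have "ext_functional y (\<lambda>i. fps_cutoff K (g i))
    = (\<Sum>F\<in>PiE UNIV (\<lambda>_. {..<K}). ext_functional y (\<lambda>i. fps_const (fps_nth (g i) (F i)) * fps_X ^ F i))"
    unfolding fps_cutoff_eq_sum by (intro ext_functional_sum y exp_bounded_monomials) simp
  also have "\<dots> = (\<Sum>F\<in>PiE UNIV (\<lambda>_. {..<K}).
      (\<Prod>i\<in>UNIV. fps_nth (g i) (F i)) * y (Abs_poly_mapping F))"
    using ext_functional_monomial[of y "Abs_poly_mapping _"] by (simp only: ext_functional_cmult) simp
  finally show ?thesis .
qed

text \<open>The product of the squares is the square of one polynomial, with exponents in the box
  below \<open>K\<close> and degree at most \<open>CARD('n) * K\<close>; so the value is a quadratic
  form in a finite moment matrix.\<close>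

lemma ext_functional_square_trunc_nonneg:
  fixes y :: "'n::finite expo \<Rightarrow> real"
  assumes y: "moment_growth y" and psd: "\<And>r. psd_on (expos r) (moment_matrix y)"
  shows "0 \<le> ext_functional y (\<lambda>i. (fps_cutoff K (h i))\<^sup>2)"
proof -
  define J where "J = {..<K} \<times> {..<K}"
  define B where "B = (PiE UNIV (\<lambda>_. {..<K}) :: ('n \<Rightarrow> nat) set)"
  have finB: "finite B" unfolding B_def by (simp add: finite_PiE)
  have sq: "(fps_cutoff K f)\<^sup>2
      = (\<Sum>z\<in>J. fps_const (fps_nth f (fst z) * fps_nth f (snd z)) * fps_X ^ (fst z + snd z))"
    for f :: "real fps"
    unfolding fps_cutoff_eq_sum power2_eq_square sum_product J_def sum.cartesian_product'
    by (intro sum.cong refl) (simp add: power_add fps_const_mult[symmetric] ac_simps del: fps_const_mult)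
  have "ext_functional y (\<lambda>i. (fps_cutoff K (h i))\<^sup>2)
    = (\<Sum>F\<in>PiE UNIV (\<lambda>_. J). ext_functional y
        (\<lambda>i. fps_const (fps_nth (h i) (fst (F i)) * fps_nth (h i) (snd (F i))) * fps_X ^ (fst (F i) + snd (F i))))"
    unfolding sq by (intro ext_functional_sum y exp_bounded_monomials) (simp add: J_def)
  also have "\<dots> = (\<Sum>F\<in>PiE UNIV (\<lambda>_. J).
      (\<Prod>i\<in>UNIV. fps_nth (h i) (fst (F i)) * fps_nth (h i) (snd (F i)))
      * y (Abs_poly_mapping (fst \<circ> F) + Abs_poly_mapping (snd \<circ> F)))"
  proof (rule sum.cong)
    fix F :: "'n \<Rightarrow> nat \<times> nat"
    have "ext_functional y (\<lambda>i. fps_X ^ (fst (F i) + snd (F i)))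
        = y (Abs_poly_mapping (fst \<circ> F) + Abs_poly_mapping (snd \<circ> F))"
      using ext_functional_monomial[of y "Abs_poly_mapping (fst \<circ> F) + Abs_poly_mapping (snd \<circ> F)"]
      by (simp add: lookup_add)
    then show "ext_functional y (\<lambda>i. fps_const (fps_nth (h i) (fst (F i)) * fps_nth (h i) (snd (F i)))
          * fps_X ^ (fst (F i) + snd (F i)))
      = (\<Prod>i\<in>UNIV. fps_nth (h i) (fst (F i)) * fps_nth (h i) (snd (F i)))
        * y (Abs_poly_mapping (fst \<circ> F) + Abs_poly_mapping (snd \<circ> F))"
      by (simp only: ext_functional_cmult)
  qed simp
  also have "\<dots> = (\<Sum>(A, A')\<in>B \<times> B. (\<Prod>i\<in>UNIV. fps_nth (h i) (A i) * fps_nth (h i) (A' i))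
      * y (Abs_poly_mapping A + Abs_poly_mapping A'))"
    by (rule sum.reindex_bij_witness[where i = "\<lambda>(A, A') i. (A i, A' i)" and j = "\<lambda>F. (fst \<circ> F, snd \<circ> F)"])
      (auto simp: B_def J_def PiE_def Pi_def fun_eq_iff mem_Times_iff)
  also have "\<dots> = (\<Sum>A\<in>B. \<Sum>A'\<in>B. (\<Prod>i\<in>UNIV. fps_nth (h i) (A i))
      * y (Abs_poly_mapping A + Abs_poly_mapping A') * (\<Prod>i\<in>UNIV. fps_nth (h i) (A' i)))"
    unfolding sum.cartesian_product[symmetric] by (intro sum.cong) (auto simp: prod.distrib)
  also have "\<dots> = (\<Sum>a\<in>Abs_poly_mapping ` B. \<Sum>b\<in>Abs_poly_mapping ` B.
      (\<Prod>i\<in>UNIV. fps_nth (h i) (expt a i)) * moment_matrix y a b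
      * (\<Prod>i\<in>UNIV. fps_nth (h i) (expt b i)))"
    by (simp add: sum.reindex[OF Abs_expo_inj] moment_matrix_def)
  also have "\<dots> \<ge> 0"
  proof -
    have "Abs_poly_mapping ` B \<subseteq> (expos (CARD('n) * K) :: 'n expo set)"
    proof (clarsimp simp: expo_deg_def)
      fix A assume "A \<in> B"
      then have "A i \<le> K" for i by (auto simp: B_def PiE_def Pi_def less_imp_le)
      then show "sum A UNIV \<le> CARD('n) * K" by (rule sum_bounded_above[of UNIV A K, simplified])
    qed
    then have "psd_on (Abs_poly_mapping ` B :: 'n expo set) (moment_matrix y)"
      by (intro psd_on_subset[OF psd]) auto
    then have "0 \<le> (\<Sum>a\<in>Abs_poly_mapping ` B. \<Sum>b\<in>Abs_poly_mapping ` B. v a * moment_matrix y a b * v b)"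
      for v unfolding psd_on_def by blast
    from this[of "\<lambda>a. \<Prod>i\<in>UNIV. fps_nth (h i) (expt a i)"]
    show ?thesis .
  qed
  finally show ?thesis .
qed

lemma ext_functional_square_nonneg:
  fixes y :: "'n::finite expo \<Rightarrow> real"
  assumes y: "moment_growth y" and psd: "\<And>r. psd_on (expos r) (moment_matrix y)"
    and h: "exp_bounded h"
  shows "0 \<le> ext_functional y (\<lambda>i. (h i)\<^sup>2)"
proof (rule LIMSEQ_le_const)
  show "(\<lambda>K. ext_functional y (\<lambda>i. (fps_cutoff K (h i))\<^sup>2)) \<longlonglongrightarrow> ext_functional y (\<lambda>i. (h i)\<^sup>2)"
  proof (rule ext_functional_tendsto[OF y])
    fix i
    have "exp_bounded (\<lambda>K. fps_cutoff K (h i))"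
      using exp_bounded_cutoff[OF h, of "\<lambda>K. K" "\<lambda>_. i"] by simp
    then show "exp_bounded (\<lambda>K. (fps_cutoff K (h i))\<^sup>2)" by (rule exp_bounded_power)
    show "(\<lambda>K. fps_nth ((fps_cutoff K (h i))\<^sup>2) k) \<longlonglongrightarrow> fps_nth ((h i)\<^sup>2) k" for k
      unfolding power2_eq_square by (intro tendsto_fps_mult_nth fps_cutoff_nth_tendsto)
  qed
  show "\<exists>N. \<forall>K\<ge>N. 0 \<le> ext_functional y (\<lambda>i. (fps_cutoff K (h i))\<^sup>2)"
    using ext_functional_square_trunc_nonneg[OF y psd] by blast
qed

subsection \<open>Bernstein weights in the variables \<open>sin (\<epsilon> x)\<close>\<close>

definition half_plus :: "real \<Rightarrow> real fps" where
  "half_plus \<epsilon> = fps_cos (\<epsilon> / 2) + fps_sin (\<epsilon> / 2)"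

definition half_minus :: "real \<Rightarrow> real fps" where
  "half_minus \<epsilon> = fps_cos (\<epsilon> / 2) - fps_sin (\<epsilon> / 2)"

text \<open>This is \<open>(N choose j) ((1 + u) / 2) ^ j ((1 - u) / 2) ^ (N - j)\<close> for \<open>u = sin (\<epsilon> x)\<close>, written
  so that it is visibly a square.\<close>

definition bern :: "nat \<Rightarrow> real \<Rightarrow> nat \<Rightarrow> real fps" where
  "bern N \<epsilon> j = fps_const (real (N choose j) / 2 ^ N) *
     ((half_plus \<epsilon>)\<^sup>2) ^ j * ((half_minus \<epsilon>)\<^sup>2) ^ (N - j)"

text \<open>Solves \<open>\<epsilon> * node N \<epsilon> j = 2 * (j / N) - 1\<close>: the Bernstein
  node \<open>j / N\<close> stands for \<open>(1 + sin (\<epsilon> * x)) / 2\<close>, and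
  \<open>sin (\<epsilon> * x) / \<epsilon>\<close> approximates \<open>x\<close>.\<close>

definition node :: "nat \<Rightarrow> real \<Rightarrow> nat \<Rightarrow> real" where
  "node N \<epsilon> j = (2 * real j - real N) / (real N * \<epsilon>)"

definition bern_moment :: "nat \<Rightarrow> real \<Rightarrow> nat \<Rightarrow> real fps" where
  "bern_moment N \<epsilon> a = (\<Sum>j\<le>N. fps_const (node N \<epsilon> j ^ a) * bern N \<epsilon> j)"

lemma bern_square:
  "bern N \<epsilon> j = (fps_const (sqrt (real (N choose j) / 2 ^ N)) * half_plus \<epsilon> ^ j * half_minus \<epsilon> ^ (N - j))\<^sup>2"
  by (simp add: bern_def power_mult_distrib power_mult[symmetric] mult.commute[of 2]
      fps_const_power del: fps_const_power[symmetric])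

lemma half_squares_sum: "(half_plus \<epsilon>)\<^sup>2 + (half_minus \<epsilon>)\<^sup>2 = 2"
proof -
  have "(half_plus \<epsilon>)\<^sup>2 + (half_minus \<epsilon>)\<^sup>2 = 2 * ((fps_cos (\<epsilon> / 2))\<^sup>2 + (fps_sin (\<epsilon> / 2))\<^sup>2)"
    by (simp add: half_plus_def half_minus_def power2_eq_square algebra_simps)
  then show ?thesis by (simp add: fps_sin_cos_sum_of_squares)
qed

lemma fps_sin_half: "fps_sin \<epsilon> = 2 * fps_sin (\<epsilon> / 2) * fps_cos (\<epsilon> / 2)"
  using fps_sin_add[of "\<epsilon> / 2" "\<epsilon> / 2"] by (simp add: algebra_simps)

lemma fps_cos_half: "fps_cos \<epsilon> = half_plus \<epsilon> * half_minus \<epsilon>"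
  using fps_cos_add[of "\<epsilon> / 2" "\<epsilon> / 2"] by (simp add: half_plus_def half_minus_def algebra_simps)

lemma half_plus_square: "(half_plus \<epsilon>)\<^sup>2 = 1 + fps_sin \<epsilon>"
proof -
  have "(half_plus \<epsilon>)\<^sup>2 = ((fps_cos (\<epsilon> / 2))\<^sup>2 + (fps_sin (\<epsilon> / 2))\<^sup>2) + fps_sin \<epsilon>"
    unfolding fps_sin_half[of \<epsilon>] by (simp add: half_plus_def power2_eq_square algebra_simps)
  then show ?thesis by (simp add: fps_sin_cos_sum_of_squares)
qed

lemma half_minus_square: "(half_minus \<epsilon>)\<^sup>2 = 1 - fps_sin \<epsilon>"
  using half_squares_sum[of \<epsilon>] unfolding half_plus_square by (simp add: algebra_simps)

lemma half_plus_deriv: "fps_deriv (half_plus \<epsilon>) = fps_const (\<epsilon> / 2) * half_minus \<epsilon>"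
  by (simp add: half_plus_def half_minus_def fps_sin_deriv fps_cos_deriv algebra_simps
      fps_const_neg[symmetric] del: fps_const_neg)

lemma half_minus_deriv: "fps_deriv (half_minus \<epsilon>) = - fps_const (\<epsilon> / 2) * half_plus \<epsilon>"
  by (simp add: half_plus_def half_minus_def fps_sin_deriv fps_cos_deriv algebra_simps
      fps_const_neg[symmetric] del: fps_const_neg)

lemma bern_sum: "(\<Sum>j\<le>N. bern N \<epsilon> j) = 1"
proof -
  have "(\<Sum>j\<le>N. bern N \<epsilon> j) = fps_const (1 / 2 ^ N) *
      (\<Sum>j\<le>N. of_nat (N choose j) * ((half_plus \<epsilon>)\<^sup>2) ^ j * ((half_minus \<epsilon>)\<^sup>2) ^ (N - j))"
    unfolding sum_distrib_left bern_def
    by (intro sum.cong) (simp_all add: fps_of_nat[symmetric] mult.assoc[symmetric])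
  also have "\<dots> = fps_const (1 / 2 ^ N) * 2 ^ N"
    unfolding binomial_ring[symmetric] half_squares_sum ..
  also have "\<dots> = 1"
    by (simp add: numeral_fps_const fps_const_power)
  finally show ?thesis .
qed

text \<open>The differential equation \<open>p * (1 - p) * B' = (j - N * p) * B\<close> of the
  Bernstein polynomials, under the substitution \<open>p = (1 + sin (\<epsilon> * x)) / 2\<close>.
  The factor \<open>fps_cos\<close> is the product of the two half-angle series, which avoids any
  division.\<close>

lemma bern_deriv:
  assumes "j \<le> N"
  shows "fps_cos \<epsilon> * fps_deriv (bern N \<epsilon> j)
    = fps_const \<epsilon> * (of_nat (2 * j) - of_nat N - of_nat N * fps_sin \<epsilon>) * bern N \<epsilon> j"
proof -
  define p q where "p = half_plus \<epsilon>" and "q = half_minus \<epsilon>"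
  define c where "c = fps_const (real (N choose j) / 2 ^ N)"
  have b: "bern N \<epsilon> j = c * p ^ (2 * j) * q ^ (2 * (N - j))"
    by (simp add: bern_def c_def p_def q_def power_mult)
  have pw: "f * fps_deriv (f ^ n) = of_nat n * fps_deriv f * f ^ n" for f :: "real fps" and n
    by (induction n) (simp_all add: algebra_simps del: fps_deriv_power)
  have dp: "fps_deriv p = fps_const (\<epsilon> / 2) * q" and dq: "fps_deriv q = - fps_const (\<epsilon> / 2) * p"
    by (simp_all add: p_def q_def half_plus_deriv half_minus_deriv)
  have dc: "fps_deriv c = 0" by (simp add: c_def)
  have "fps_cos \<epsilon> * fps_deriv (bern N \<epsilon> j)
      = c * ((p * fps_deriv (p ^ (2 * j))) * (q * q ^ (2 * (N - j)))
        + (p * p ^ (2 * j)) * (q * fps_deriv (q ^ (2 * (N - j)))))"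
    unfolding b fps_cos_half p_def[symmetric] q_def[symmetric]
    by (simp add: dc algebra_simps)
  also have "\<dots> = fps_const (\<epsilon> / 2) * (of_nat (2 * j) * q\<^sup>2 - of_nat (2 * (N - j)) * p\<^sup>2)
      * (c * p ^ (2 * j) * q ^ (2 * (N - j)))"
    unfolding pw dp dq
    by (simp add: power2_eq_square algebra_simps fps_const_neg[symmetric] del: fps_const_neg)
  also have "of_nat (2 * j) * q\<^sup>2 - of_nat (2 * (N - j)) * p\<^sup>2
      = fps_const 2 * (of_nat (2 * j) - of_nat N - of_nat N * fps_sin \<epsilon>)"
    using assms unfolding p_def q_def half_plus_square half_minus_square
    by (simp add: of_nat_diff algebra_simps numeral_fps_const[symmetric])
  finally show ?thesis unfolding b by (simp add: mult.assoc[symmetric])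
qed

lemma bern_moment_0: "bern_moment N \<epsilon> 0 = 1"
  by (simp add: bern_moment_def bern_sum)

text \<open>Solving \<open>bern_deriv\<close> for the node: weighting by it amounts to multiplying
  by \<open>sin (\<epsilon> * x) / \<epsilon>\<close>, up to a derivative term with factor
  \<open>1 / (N * \<epsilon>\<^sup>2)\<close>. The recursion replaces explicit formulas for
  Bernstein moments.\<close>

lemma bern_moment_Suc:
  assumes "0 < N" "0 < \<epsilon>"
  shows "bern_moment N \<epsilon> (Suc a) = fps_const (1 / \<epsilon>) * fps_sin \<epsilon> * bern_moment N \<epsilon> a
    + fps_const (1 / (real N * \<epsilon>\<^sup>2)) * fps_cos \<epsilon> * fps_deriv (bern_moment N \<epsilon> a)"
proof -
  have step: "fps_const (node N \<epsilon> j) * bern N \<epsilon> j = fps_const (1 / \<epsilon>) * fps_sin \<epsilon> * bern N \<epsilon> j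
      + fps_const (1 / (real N * \<epsilon>\<^sup>2)) * fps_cos \<epsilon> * fps_deriv (bern N \<epsilon> j)" if "j \<le> N" for j
  proof -
    define e where "e = 1 / (real N * \<epsilon>\<^sup>2) * \<epsilon>"
    have c: "of_nat m = fps_const (real m)" for m :: nat by (simp add: fps_of_nat)
    have "fps_const (1 / (real N * \<epsilon>\<^sup>2)) * (fps_cos \<epsilon> * fps_deriv (bern N \<epsilon> j))
        = fps_const e * ((of_nat (2 * j) - of_nat N - of_nat N * fps_sin \<epsilon>) * bern N \<epsilon> j)"
      unfolding bern_deriv[OF that] by (simp add: mult.assoc[symmetric] e_def)
    also have "\<dots> = fps_const (e * (2 * real j - real N)) * bern N \<epsilon> j
        - fps_const (e * real N) * fps_sin \<epsilon> * bern N \<epsilon> j"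
      unfolding c fps_const_sub by (simp add: left_diff_distrib right_diff_distrib mult.assoc[symmetric])
    also have "e * (2 * real j - real N) = node N \<epsilon> j"
      using assms by (simp add: e_def node_def power2_eq_square)
    also have "e * real N = 1 / \<epsilon>"
      using assms by (simp add: e_def power2_eq_square)
    finally show ?thesis by (simp add: mult.assoc)
  qed
  have "bern_moment N \<epsilon> (Suc a)
      = (\<Sum>j\<le>N. fps_const (node N \<epsilon> j ^ a) * (fps_const (node N \<epsilon> j) * bern N \<epsilon> j))"
    unfolding bern_moment_def
    by (intro sum.cong) (simp_all add: mult.assoc[symmetric] power_Suc2 del: power_Suc)
  also have "\<dots> = (\<Sum>j\<le>N. fps_const (1 / \<epsilon>) * fps_sin \<epsilon> * (fps_const (node N \<epsilon> j ^ a) * bern N \<epsilon> j)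
      + fps_const (1 / (real N * \<epsilon>\<^sup>2)) * fps_cos \<epsilon> * (fps_const (node N \<epsilon> j ^ a) * fps_deriv (bern N \<epsilon> j)))"
  proof (intro sum.cong refl)
    fix j assume "j \<in> {..N}"
    then show "fps_const (node N \<epsilon> j ^ a) * (fps_const (node N \<epsilon> j) * bern N \<epsilon> j)
        = fps_const (1 / \<epsilon>) * fps_sin \<epsilon> * (fps_const (node N \<epsilon> j ^ a) * bern N \<epsilon> j)
          + fps_const (1 / (real N * \<epsilon>\<^sup>2)) * fps_cos \<epsilon> * (fps_const (node N \<epsilon> j ^ a) * fps_deriv (bern N \<epsilon> j))"
      by (subst step) (simp_all only: atMost_iff distrib_left ac_simps)
  qed
  also have "\<dots> = fps_const (1 / \<epsilon>) * fps_sin \<epsilon> * bern_moment N \<epsilon> a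
    + fps_const (1 / (real N * \<epsilon>\<^sup>2)) * fps_cos \<epsilon> * fps_deriv (bern_moment N \<epsilon> a)"
    by (simp add: bern_moment_def sum.distrib sum_distrib_left fps_deriv_sum)
  finally show ?thesis .
qed

section \<open>Uniform coefficient bounds and the choice of nodes\<close>

lemma fps_nth_sin: "fps_nth (fps_sin c) n = (if even n then 0 else (- 1) ^ ((n - 1) div 2) * c ^ n / fact n)"
  for c :: real by (simp add: fps_sin_def)

lemma fps_nth_cos: "fps_nth (fps_cos c) n = (if even n then (- 1) ^ (n div 2) * c ^ n / fact n else 0)"
  for c :: real by (simp add: fps_cos_def)

lemma exp_bounded_trig:
  assumes "\<And>m. \<bar>c m\<bar> \<le> K"
  shows "exp_bounded (\<lambda>m. fps_sin (c m))" "exp_bounded (\<lambda>m. fps_cos (c m))"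
proof -
  have K: "0 \<le> K" using assms[of undefined] by linarith
  have le: "\<bar>c m\<bar> ^ k / fact k \<le> K ^ k / fact k" for m k
    using assms by (intro divide_right_mono power_mono) auto
  have "\<bar>fps_nth (fps_sin (c m)) k\<bar> \<le> 1 * K ^ k / fact k" for m k
    using le[of m k] K by (simp add: fps_nth_sin abs_mult power_abs)
  then show "exp_bounded (\<lambda>m. fps_sin (c m))" using K by (intro exp_boundedI[of 1 K]) auto
  have "\<bar>fps_nth (fps_cos (c m)) k\<bar> \<le> 1 * K ^ k / fact k" for m k
    using le[of m k] K by (simp add: fps_nth_cos abs_mult power_abs)
  then show "exp_bounded (\<lambda>m. fps_cos (c m))" using K by (intro exp_boundedI[of 1 K]) auto
qed

text \<open>Division removes one power of \<open>c m\<close>, and the remaining powers are at most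
  1, so the bound does not deteriorate as \<open>c m\<close> tends to 0.\<close>

lemma exp_bounded_scaled_sin:
  assumes "\<And>m. 0 < c m" "\<And>m. c m \<le> 1"
  shows "exp_bounded (\<lambda>m. fps_const (1 / c m) * fps_sin (c m))"
proof (rule exp_boundedI[of 1 1])
  fix m k
  show "\<bar>fps_nth (fps_const (1 / c m) * fps_sin (c m)) k\<bar> \<le> 1 * 1 ^ k / fact k"
  proof (cases k)
    case (Suc l)
    have "c m ^ l \<le> 1" using assms[of m] by (intro power_le_one) auto
    then show ?thesis using assms(1)[of m] unfolding Suc
      by (auto simp: fps_nth_sin abs_mult power_abs field_simps simp del: fact_Suc)
  qed simp
qed auto

lemma exp_bounded_bern: "exp_bounded (\<lambda>i. fps_const (c i) * half_plus \<epsilon> ^ j i * half_minus \<epsilon> ^ l i)"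
  for c :: "'n::finite \<Rightarrow> real"
proof -
  have t: "exp_bounded (\<lambda>_::unit. fps_sin (\<epsilon> / 2))" "exp_bounded (\<lambda>_::unit. fps_cos (\<epsilon> / 2))"
    using exp_bounded_trig[of "\<lambda>_. \<epsilon> / 2" "\<bar>\<epsilon> / 2\<bar>"] by auto
  have "exp_bounded (\<lambda>_::unit. half_minus \<epsilon>)"
    using exp_bounded_add[OF t(2) exp_bounded_mult[OF exp_bounded_const1[of "-1"] t(1)]]
    by (simp add: half_minus_def fps_const_neg[symmetric] del: fps_const_neg)
  moreover have "exp_bounded (\<lambda>_::unit. half_plus \<epsilon>)"
    unfolding half_plus_def by (intro exp_bounded_add t)
  ultimately have "exp_bounded (\<lambda>_::unit. fps_const (c i) * half_plus \<epsilon> ^ j i * half_minus \<epsilon> ^ l i)" for i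
    by (intro exp_bounded_mult exp_bounded_const1 exp_bounded_power)
  from exp_bounded_comp[OF exp_bounded_finite_index[OF this], where h = "\<lambda>i. ((), i)"]
  show ?thesis by simp
qed

text \<open>The number of nodes is the cube of the inverse step, so that
  \<open>1 / (N * \<epsilon>\<^sup>2) = \<epsilon>\<close>; hence the derivative term of the
  recursion and the variance of the nodes vanish in the limit.\<close>

definition step_width :: "nat \<Rightarrow> real" where "step_width m = 1 / real (Suc m)"
definition num_nodes :: "nat \<Rightarrow> nat" where "num_nodes m = Suc m ^ 3"

lemma step_width: "0 < step_width m" "step_width m \<le> 1" "step_width \<longlonglongrightarrow> 0"
  using LIMSEQ_inverse_real_of_nat by (auto simp: step_width_def[abs_def] inverse_eq_divide)

lemma num_nodes: "0 < num_nodes m" "1 / (real (num_nodes m) * (step_width m)\<^sup>2) = step_width m"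
proof -
  have x: "1 / (x ^ 3 * (1 / x)\<^sup>2) = 1 / x" if "0 < x" for x :: real
    using that by (simp add: power2_eq_square power3_eq_cube)
  show "1 / (real (num_nodes m) * (step_width m)\<^sup>2) = step_width m"
    unfolding num_nodes_def step_width_def of_nat_power by (rule x) simp
qed (simp add: num_nodes_def)

text \<open>Induction along the recursion, where \<open>sin (\<epsilon> * x) / \<epsilon>\<close>
  tends to \<open>fps_X\<close> and the factor of the derivative term tends to 0. The uniform bound
  is carried along, since coefficientwise convergence alone does not pass through the
  functional.\<close>

lemma bern_moment_limit:
  "exp_bounded (\<lambda>m. bern_moment (num_nodes m) (step_width m) a) \<and>
   (\<forall>k. (\<lambda>m. fps_nth (bern_moment (num_nodes m) (step_width m) a) k) \<longlonglongrightarrow> fps_nth (fps_X ^ a) k)"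
proof (induction a)
  case 0
  then show ?case by (simp add: bern_moment_0 exp_bounded_1)
next
  case (Suc a)
  have eq: "bern_moment (num_nodes m) (step_width m) (Suc a)
      = fps_const (1 / step_width m) * fps_sin (step_width m) * bern_moment (num_nodes m) (step_width m) a
      + fps_const (step_width m) * fps_cos (step_width m)
        * fps_deriv (bern_moment (num_nodes m) (step_width m) a)" for m
    using bern_moment_Suc[OF num_nodes(1)[of m] step_width(1)[of m], of a] unfolding num_nodes(2) .
  have sw: "\<bar>step_width m\<bar> \<le> 1" for m using step_width(1,2)[of m] by simp
  have eb: "exp_bounded (\<lambda>m. bern_moment (num_nodes m) (step_width m) (Suc a))"
    unfolding eq using Suc
    by (intro exp_bounded_add exp_bounded_mult exp_bounded_deriv exp_bounded_scaled_sin step_width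
        exp_bounded_trig(2) exp_bounded_const) (auto intro: sw)
  have sin: "(\<lambda>m. fps_nth (fps_const (1 / step_width m) * fps_sin (step_width m)) k) \<longlonglongrightarrow> fps_nth fps_X k"
    for k
  proof (cases "k = 0 \<or> even k")
    case True
    then show ?thesis by (auto simp: fps_nth_sin fps_X_nth)
  next
    case False
    then obtain l where k: "k = Suc l" "even l" by (cases k) auto
    have "(\<lambda>m. (- 1) ^ (l div 2) * step_width m ^ l / fact k) \<longlonglongrightarrow> (- 1) ^ (l div 2) * 0 ^ l / fact k"
      by (intro tendsto_intros step_width) simp
    moreover have "fps_nth (fps_const (1 / step_width m) * fps_sin (step_width m)) k
        = (- 1) ^ (l div 2) * step_width m ^ l / fact k" for m
      using step_width(1)[of m] k by (simp add: fps_nth_sin)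
    moreover have "(- 1) ^ (l div 2) * 0 ^ l / fact k = (fps_nth fps_X k :: real)"
      using k by (cases l) (auto simp: fps_X_nth)
    ultimately show ?thesis by simp
  qed
  have cos: "(\<lambda>m. fps_nth (fps_const (step_width m) * fps_cos (step_width m)) k) \<longlonglongrightarrow> fps_nth 0 k" for k
  proof -
    have "(\<lambda>m. step_width m * ((- 1) ^ (k div 2) * step_width m ^ k / fact k))
        \<longlonglongrightarrow> 0 * ((- 1) ^ (k div 2) * 0 ^ k / fact k)"
      by (intro tendsto_intros step_width) simp
    then have "(\<lambda>m. step_width m * (if even k then (- 1) ^ (k div 2) * step_width m ^ k / fact k else 0))
        \<longlonglongrightarrow> 0"
      by (cases "even k") simp_all
    then show ?thesis by (simp add: fps_nth_cos)
  qed
  have der: "(\<lambda>m. fps_nth (fps_deriv (bern_moment (num_nodes m) (step_width m) a)) k)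
      \<longlonglongrightarrow> fps_nth (fps_deriv (fps_X ^ a)) k" for k
    unfolding fps_deriv_nth using Suc by (intro tendsto_mult tendsto_const) blast
  have "(\<lambda>m. fps_nth (bern_moment (num_nodes m) (step_width m) (Suc a)) k)
      \<longlonglongrightarrow> fps_nth (fps_X * fps_X ^ a + 0 * fps_deriv (fps_X ^ a)) k" for k
    unfolding eq fps_add_nth using Suc
    by (intro tendsto_add tendsto_fps_mult_nth sin cos der) blast
  then show ?case using eb by simp
qed

subsection \<open>Existence of a representing measure\<close>

definition node_weight :: "('n::finite expo \<Rightarrow> real) \<Rightarrow> nat \<Rightarrow> ('n \<Rightarrow> nat) \<Rightarrow> real" where
  "node_weight y m F = ext_functional y (\<lambda>i. bern (num_nodes m) (step_width m) (F i))"

definition node_point :: "nat \<Rightarrow> ('n::finite \<Rightarrow> nat) \<Rightarrow> real^'n" where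
  "node_point m F = (\<chi> i. node (num_nodes m) (step_width m) (F i))"

definition node_index :: "nat \<Rightarrow> ('n::finite \<Rightarrow> nat) set" where
  "node_index m = PiE UNIV (\<lambda>_. {..num_nodes m})"

lemma finite_node_index [simp]: "finite (node_index m)"
  unfolding node_index_def by (simp add: finite_PiE)

lemma exp_bounded_bern_family: "exp_bounded (\<lambda>i::'n::finite. bern N \<epsilon> (F i))"
  unfolding bern_square by (intro exp_bounded_power exp_bounded_bern)

lemma node_weight_nonneg:
  assumes "moment_growth y" "\<And>r. psd_on (expos r) (moment_matrix y)"
  shows "0 \<le> node_weight y m F"
  unfolding node_weight_def bern_square
  by (intro ext_functional_square_nonneg assms exp_bounded_bern)

lemma node_weight_moments:
  fixes y :: "'n::finite expo \<Rightarrow> real"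
  assumes "moment_growth y"
  shows "(\<Sum>F\<in>node_index m. monomial_fun \<alpha> (node_point m F) * node_weight y m F)
    = ext_functional y (\<lambda>i. bern_moment (num_nodes m) (step_width m) (expt \<alpha> i))"
proof -
  \<comment> \<open>The constants may be negative here, so they are absorbed into the prefactor
    instead of being put under a square.\<close>
  have eb: "exp_bounded (\<lambda>i::'n. fps_const (c i) * bern N \<epsilon> (F i))" for c N \<epsilon> F
  proof -
    have "fps_const (c i) * bern N \<epsilon> (F i)
      = fps_const (c i * (real (N choose F i) / 2 ^ N)) * half_plus \<epsilon> ^ (2 * F i) * half_minus \<epsilon> ^ (2 * (N - F i))" for i
      by (simp add: bern_def power_mult mult.assoc[symmetric])
    then show ?thesis by (simp only: exp_bounded_bern)
  qed
  have "ext_functional y (\<lambda>i. bern_moment (num_nodes m) (step_width m) (expt \<alpha> i))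
    = (\<Sum>F\<in>node_index m. ext_functional y (\<lambda>i.
        fps_const (node (num_nodes m) (step_width m) (F i) ^ expt \<alpha> i)
        * bern (num_nodes m) (step_width m) (F i)))"
    unfolding bern_moment_def node_index_def by (intro ext_functional_sum assms eb) simp
  also have "\<dots> = (\<Sum>F\<in>node_index m. monomial_fun \<alpha> (node_point m F) * node_weight y m F)"
    by (simp only: ext_functional_cmult) (simp add: node_weight_def monomial_fun_def node_point_def)
  finally show ?thesis by simp
qed

lemma monomial_fun_0 [simp]: "monomial_fun 0 x = 1"
  by (simp add: monomial_fun_def)

lemma node_weight_sum:
  fixes y :: "'n::finite expo \<Rightarrow> real"
  assumes "moment_growth y"
  shows "(\<Sum>F\<in>node_index m. node_weight y m F) = y 0"
  using node_weight_moments[OF assms, of 0 m] ext_functional_monomial[of y 0]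
  by (simp add: bern_moment_0)

lemma node_weight_moments_tendsto:
  fixes y :: "'n::finite expo \<Rightarrow> real"
  assumes "moment_growth y"
  shows "(\<lambda>m. \<Sum>F\<in>node_index m. monomial_fun \<alpha> (node_point m F) * node_weight y m F) \<longlonglongrightarrow> y \<alpha>"
proof -
  have "(\<lambda>m. ext_functional y (\<lambda>i. bern_moment (num_nodes m) (step_width m) (expt \<alpha> i)))
      \<longlonglongrightarrow> ext_functional y (\<lambda>i. fps_X ^ expt \<alpha> i)"
    using bern_moment_limit by (intro ext_functional_tendsto assms) blast+
  then show ?thesis unfolding ext_functional_monomial node_weight_moments[OF assms] .
qed

text \<open>The Bernstein weights are a partition of unity, so the node weights sum to
  \<open>y 0 = 1\<close> and define probability mass functions; their moments are values of the
  functional on \<open>bern_moment\<close> and tend to those prescribed.\<close>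

lemma representing_measure_exists:
  fixes y :: "'n::finite expo \<Rightarrow> real"
  assumes y: "moment_growth y" and psd: "\<And>r. psd_on (expos r) (moment_matrix y)" and "y 0 = 1"
  shows "\<exists>\<mu>. prob_space \<mu> \<and> represents \<mu> y"
proof -
  define w where "w m F = (if F \<in> node_index m then node_weight y m F else 0)" for m F
  define p where "p m = embed_pmf (w m)" for m
  have w0: "0 \<le> w m F" for m F
    using node_weight_nonneg[OF y psd] by (simp add: w_def)
  have "(\<integral>\<^sup>+F. ennreal (w m F) \<partial>count_space UNIV) = 1" for m
  proof -
    have "(\<integral>\<^sup>+F. ennreal (w m F) \<partial>count_space UNIV) = (\<Sum>F\<in>node_index m. ennreal (w m F))"
      by (rule nn_integral_count_space') (auto simp: w_def split: if_splits)
    also have "\<dots> = ennreal (\<Sum>F\<in>node_index m. w m F)" by (rule sum_ennreal) (rule w0)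
    also have "(\<Sum>F\<in>node_index m. w m F) = 1"
      using node_weight_sum[OF y, of m] assms(3) by (simp add: w_def)
    finally show ?thesis by simp
  qed
  then have pmf_p: "pmf (p m) F = w m F" for m F
    unfolding p_def by (rule pmf_embed_pmf[OF w0])
  have set_p: "set_pmf (p m) \<subseteq> node_index m" for m
    by (auto simp: set_pmf_iff pmf_p w_def split: if_splits)
  show ?thesis
  proof (rule moment_limit_exists[of "\<lambda>m. map_pmf (node_point m) (p m)"])
    show "finite (set_pmf (map_pmf (node_point m) (p m)))" for m
      using finite_subset[OF set_p] by simp
    fix \<alpha> :: "'n expo"
    have "measure_pmf.expectation (map_pmf (node_point m) (p m)) (monomial_fun \<alpha>)
      = (\<Sum>F\<in>node_index m. monomial_fun \<alpha> (node_point m F) * node_weight y m F)" for m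
    proof -
      have "measure_pmf.expectation (p m) (\<lambda>F. monomial_fun \<alpha> (node_point m F))
        = (\<Sum>F\<in>node_index m. monomial_fun \<alpha> (node_point m F) * pmf (p m) F)"
        by (rule integral_measure_pmf_real) (use set_p in auto)
      then show ?thesis by (simp add: pmf_p w_def)
    qed
    then show "(\<lambda>m. measure_pmf.expectation (map_pmf (node_point m) (p m)) (monomial_fun \<alpha>)) \<longlonglongrightarrow> y \<alpha>"
      using node_weight_moments_tendsto[OF y] by simp
  qed
qed

subsection \<open>Moments of measures\<close>

lemma represents_psd:
  fixes y :: "'n::finite expo \<Rightarrow> real"
  assumes "represents \<mu> y"
  shows "psd_on (expos r) (moment_matrix y)"
  unfolding psd_on_def
proof (intro conjI allI)
  show "\<forall>a\<in>expos r. \<forall>b\<in>expos r. moment_matrix y a b = moment_matrix y b a"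
    by (simp add: moment_matrix_def add.commute)
  fix v :: "'n expo \<Rightarrow> real"
  have int: "integrable \<mu> (monomial_fun a)" and y: "y a = (\<integral>x. monomial_fun a x \<partial>\<mu>)" for a
    using assms by (auto simp: represents_def)
  have int2: "integrable \<mu> (\<lambda>x. v a * (monomial_fun a x * monomial_fun b x) * v b)" for a b
    using int[of "a + b"] unfolding monomial_fun_add[abs_def] by simp
  have "(\<Sum>a\<in>expos r. \<Sum>b\<in>expos r. v a * moment_matrix y a b * v b)
      = (\<Sum>a\<in>expos r. \<Sum>b\<in>expos r. \<integral>x. v a * (monomial_fun a x * monomial_fun b x) * v b \<partial>\<mu>)"
    by (simp add: moment_matrix_def y monomial_fun_add)
  also have "\<dots> = (\<integral>x. (\<Sum>a\<in>expos r. \<Sum>b\<in>expos r. v a * (monomial_fun a x * monomial_fun b x) * v b) \<partial>\<mu>)"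
    by (simp only: Bochner_Integration.integral_sum Bochner_Integration.integrable_sum int2)
  also have "\<dots> = (\<integral>x. (\<Sum>a\<in>expos r. v a * monomial_fun a x)\<^sup>2 \<partial>\<mu>)"
    unfolding power2_eq_square sum_product by (intro Bochner_Integration.integral_cong sum.cong) auto
  also have "0 \<le> \<dots>" by simp
  finally show "0 \<le> (\<Sum>a\<in>expos r. \<Sum>b\<in>expos r. v a * moment_matrix y a b * v b)" .
qed

lemma moment_growth_of_theta_bound:
  fixes y :: "'n::finite expo \<Rightarrow> real"
  assumes psd: "\<And>r. psd_on (expos r) (moment_matrix y)" and th: "\<And>r. riesz y (theta r) \<le> c"
  shows "moment_growth y"
  unfolding moment_growth_def
proof (intro exI allI)
  fix \<alpha> :: "'n expo"
  have "(y (\<alpha> + 0))\<^sup>2 \<le> y (\<alpha> + \<alpha>) * y (0 + 0)"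
    by (rule moment_cauchy[OF psd[of "expo_deg \<alpha>"]]) auto
  also have "\<dots> \<le> c * fact (expo_deg \<alpha>) * y (0 + 0)"
  proof (rule mult_right_mono)
    show "y (\<alpha> + \<alpha>) \<le> c * fact (expo_deg \<alpha>)"
      using th by (intro moment_diag_le[OF psd[of "expo_deg \<alpha>"]]) (auto simp: riesz_theta)
    show "0 \<le> y (0 + 0)" by (rule moment_diag_nonneg[OF psd[of 0]]) simp
  qed
  finally show "(y \<alpha>)\<^sup>2 \<le> (c * y 0) * fact (expo_deg \<alpha>)" by (simp add: ac_simps)
qed

text \<open>The exponential series has nonnegative terms, so monotone convergence applies even if
  the integral is infinite. It turns the single constraint of the measure problem into the
  constraints of all relaxations together.\<close>

lemma nn_integral_exp_square:
  fixes y :: "'n::finite expo \<Rightarrow> real"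
  assumes rep: "represents \<mu> y"
  shows "(\<integral>\<^sup>+x. ennreal (\<Sum>i\<in>UNIV. exp ((x $ i)\<^sup>2)) \<partial>\<mu>) = (SUP r. ennreal (riesz y (theta r)))"
proof -
  have [measurable_cong]: "sets \<mu> = sets borel" using rep by (simp add: represents_def)
  have int: "integrable \<mu> (monomial_fun a)" and y: "y a = (\<integral>x. monomial_fun a x \<partial>\<mu>)" for a
    using rep by (auto simp: represents_def)
  define t where "t k x = (\<Sum>i\<in>UNIV. (x $ i) ^ (2 * k) / fact k)" for k and x :: "real^'n"
  have t0: "0 \<le> t k x" for k x unfolding t_def by (intro sum_nonneg) auto
  have var: "(x $ i) ^ (2 * k) = monomial_fun (var_pow i (2 * k)) x" for i k and x :: "real^'n"
    by (simp add: var_pow_def monomial_fun_var_pow)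
  have tint: "integrable \<mu> (t k)" and tval: "(\<integral>x. t k x \<partial>\<mu>) = (\<Sum>i\<in>UNIV. y (var_pow i (2 * k)) / fact k)" for k
    unfolding t_def[abs_def] var using int by (auto simp: y)
  have "(\<lambda>k. (x $ i) ^ (2 * k) / fact k) sums exp ((x $ i)\<^sup>2)" for i and x :: "real^'n"
    using exp_converges[of "(x $ i)\<^sup>2"]
    unfolding power_mult[of _ 2] divide_inverse real_scaleR_def mult.commute[of "inverse _"] .
  then have sums: "(\<lambda>k. t k x) sums (\<Sum>i\<in>UNIV. exp ((x $ i)\<^sup>2))" for x
    unfolding t_def by (intro sums_sum)
  have "ennreal (\<Sum>i\<in>UNIV. exp ((x $ i)\<^sup>2)) = suminf (\<lambda>k. ennreal (t k x))" for x :: "real^'n"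
    using sums[of x] t0 by (intro suminf_ennreal_eq[symmetric])
  then have "(\<integral>\<^sup>+x. ennreal (\<Sum>i\<in>UNIV. exp ((x $ i)\<^sup>2)) \<partial>\<mu>) = suminf (\<lambda>k. \<integral>\<^sup>+x. ennreal (t k x) \<partial>\<mu>)"
    using tint by (simp add: nn_integral_suminf)
  also have "\<dots> = suminf (\<lambda>k. ennreal (\<integral>x. t k x \<partial>\<mu>))"
    using tint t0 by (simp add: nn_integral_eq_integral)
  also have "\<dots> = (SUP r. \<Sum>k<r. ennreal (\<integral>x. t k x \<partial>\<mu>))"
    by (rule suminf_eq_SUP)
  also have "\<dots> = (SUP r. ennreal (riesz y (theta r)))"
  proof (rule antisym)
    have eq: "(\<Sum>k<Suc r. ennreal (\<integral>x. t k x \<partial>\<mu>)) = ennreal (riesz y (theta r))" for r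
      using t0 by (simp add: riesz_theta tval[symmetric] lessThan_Suc_atMost sum_ennreal)
    show "(SUP r. \<Sum>k<r. ennreal (\<integral>x. t k x \<partial>\<mu>)) \<le> (SUP r. ennreal (riesz y (theta r)))"
    proof (rule SUP_least)
      fix r
      have "(\<Sum>k<r. ennreal (\<integral>x. t k x \<partial>\<mu>)) \<le> (\<Sum>k<Suc r. ennreal (\<integral>x. t k x \<partial>\<mu>))"
        by (intro sum_mono2) auto
      then show "(\<Sum>k<r. ennreal (\<integral>x. t k x \<partial>\<mu>)) \<le> (SUP r. ennreal (riesz y (theta r)))"
        unfolding eq by (rule order_trans) (rule SUP_upper, simp)
    qed
    show "(SUP r. ennreal (riesz y (theta r))) \<le> (SUP r. \<Sum>k<r. ennreal (\<integral>x. t k x \<partial>\<mu>))"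
      unfolding eq[symmetric] by (rule SUP_least) (rule SUP_upper, simp)
  qed
  finally show ?thesis .
qed

lemma exp_square_le_iff:
  fixes y :: "'n::finite expo \<Rightarrow> real"
  assumes "represents \<mu> y" "0 \<le> c"
  shows "(\<integral>\<^sup>+x. ennreal (\<Sum>i\<in>UNIV. exp ((x $ i)\<^sup>2)) \<partial>\<mu>) \<le> ennreal c \<longleftrightarrow> (\<forall>r. riesz y (theta r) \<le> c)"
  unfolding nn_integral_exp_square[OF assms(1)] SUP_le_iff using assms(2)
  by (auto simp: ennreal_le_iff)

text \<open>With \<open>m\<close> the largest absolute coordinate, the exponent is at most
  \<open>R * n * m \<le> (R * n)\<^sup>2 + m\<^sup>2\<close>, and \<open>exp (m\<^sup>2)\<close> is
  one summand on the right.\<close>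

lemma prod_exp_abs_le:
  fixes x :: "real^'n::finite"
  assumes R: "0 \<le> R"
  shows "(\<Prod>i\<in>UNIV. exp (R * \<bar>x $ i\<bar>)) \<le> exp ((R * real CARD('n))\<^sup>2) * (\<Sum>i\<in>UNIV. exp ((x $ i)\<^sup>2))"
proof -
  define m where "m = Max (range (\<lambda>i. \<bar>x $ i\<bar>))"
  have "m \<in> range (\<lambda>i. \<bar>x $ i\<bar>)" unfolding m_def by (intro Max_in) auto
  then obtain i0 where i0: "m = \<bar>x $ i0\<bar>" by blast
  have "\<bar>x $ i\<bar> \<le> m" for i unfolding m_def by (intro Max_ge) auto
  then have "(\<Sum>i\<in>UNIV. R * \<bar>x $ i\<bar>) \<le> (\<Sum>i\<in>(UNIV :: 'n set). R * m)"
    using R by (intro sum_mono mult_left_mono) auto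
  also have "\<dots> = (R * real CARD('n)) * m" by simp
  also have "\<dots> \<le> (R * real CARD('n))\<^sup>2 + m\<^sup>2"
    using sum_squares_bound[of "R * real CARD('n)" m] zero_le_power2[of m]
      zero_le_power2[of "R * real CARD('n)"] by linarith
  finally have "exp (\<Sum>i\<in>UNIV. R * \<bar>x $ i\<bar>) \<le> exp ((R * real CARD('n))\<^sup>2) * exp ((x $ i0)\<^sup>2)"
    by (simp add: exp_add[symmetric] i0)
  also have "\<dots> \<le> exp ((R * real CARD('n))\<^sup>2) * (\<Sum>i\<in>UNIV. exp ((x $ i)\<^sup>2))"
    by (intro mult_left_mono member_le_sum) auto
  finally show ?thesis by (simp add: exp_sum)
qed

lemma integrable_prod_exp_abs:
  fixes \<mu> :: "(real^'n::finite) measure"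
  assumes sets: "sets \<mu> = sets borel"
    and fin: "(\<integral>\<^sup>+x. ennreal (\<Sum>i\<in>UNIV. exp ((x $ i)\<^sup>2)) \<partial>\<mu>) < \<infinity>" and R: "0 \<le> R"
  shows "integrable \<mu> (\<lambda>x. \<Prod>i\<in>UNIV. exp (R * \<bar>x $ i\<bar>))"
proof -
  note [measurable_cong] = sets
  have "integrable \<mu> (\<lambda>x. \<Sum>i\<in>UNIV. exp ((x $ i)\<^sup>2))"
    using fin by (intro integrableI_nonneg) (auto intro!: AE_I2 sum_nonneg)
  then have "integrable \<mu> (\<lambda>x. exp ((R * real CARD('n))\<^sup>2) * (\<Sum>i\<in>UNIV. exp ((x $ i)\<^sup>2)))" by simp
  then show ?thesis
  proof (rule Bochner_Integration.integrable_bound)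
    show "AE x in \<mu>. norm (\<Prod>i\<in>UNIV. exp (R * \<bar>x $ i\<bar>))
        \<le> norm (exp ((R * real CARD('n))\<^sup>2) * (\<Sum>i\<in>UNIV. exp ((x $ i)\<^sup>2)))"
    proof (rule AE_I2)
      fix x :: "real^'n"
      have "0 \<le> (\<Prod>i\<in>UNIV. exp (R * \<bar>x $ i\<bar>))" by (intro prod_nonneg) auto
      then show "norm (\<Prod>i\<in>UNIV. exp (R * \<bar>x $ i\<bar>))
        \<le> norm (exp ((R * real CARD('n))\<^sup>2) * (\<Sum>i\<in>UNIV. exp ((x $ i)\<^sup>2)))"
        using prod_exp_abs_le[OF R, of x] by (simp only: real_norm_def)
    qed
  qed measurable
qed

lemma abs_monomial_le: "\<bar>monomial_fun \<alpha> x\<bar> \<le> (\<Prod>i\<in>UNIV. exp (real (expo_deg \<alpha>) * \<bar>x $ i\<bar>))"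
proof -
  have "\<bar>x $ i\<bar> ^ expt \<alpha> i \<le> exp (real (expo_deg \<alpha>) * \<bar>x $ i\<bar>)" for i
  proof -
    have "\<bar>x $ i\<bar> \<le> exp \<bar>x $ i\<bar>" using exp_ge_add_one_self[of "\<bar>x $ i\<bar>"] by linarith
    then have "\<bar>x $ i\<bar> ^ expt \<alpha> i \<le> exp \<bar>x $ i\<bar> ^ expt \<alpha> i"
      by (intro power_mono) auto
    also have "\<dots> = exp (real (expt \<alpha> i) * \<bar>x $ i\<bar>)" by (simp add: exp_of_nat_mult)
    also have "\<dots> \<le> exp (real (expo_deg \<alpha>) * \<bar>x $ i\<bar>)"
    proof -
      have "expt \<alpha> i \<le> expo_deg \<alpha>"
        unfolding expo_deg_def by (intro member_le_sum) auto
      then show ?thesis by (simp add: mult_right_mono)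
    qed
    finally show ?thesis .
  qed
  then show ?thesis
    unfolding monomial_fun_def abs_prod power_abs by (intro prod_mono) auto
qed

lemma represents_of_feasible:
  fixes \<mu> :: "(real^'n::finite) measure"
  assumes "\<mu> \<in> P_feasible M"
  shows "represents \<mu> (\<lambda>\<alpha>. \<integral>x. monomial_fun \<alpha> x \<partial>\<mu>)"
proof -
  have sets: "sets \<mu> = sets borel" using assms by (simp add: P_feasible_def)
  note [measurable_cong] = sets
  have fin: "(\<integral>\<^sup>+x. ennreal (\<Sum>i\<in>UNIV. exp ((x $ i)\<^sup>2)) \<partial>\<mu>) < \<infinity>"
    using assms unfolding P_feasible_def by (auto intro: le_less_trans)
  have "integrable \<mu> (monomial_fun \<alpha>)" for \<alpha>
  proof (rule Bochner_Integration.integrable_bound[OF integrable_prod_exp_abs[OF sets fin]])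
    show "0 \<le> real (expo_deg \<alpha>)" by simp
    show "AE x in \<mu>. norm (monomial_fun \<alpha> x) \<le> norm (\<Prod>i\<in>UNIV. exp (real (expo_deg \<alpha>) * \<bar>x $ i\<bar>))"
      unfolding real_norm_def by (intro AE_I2 order_trans[OF abs_monomial_le abs_ge_self])
  qed measurable
  then show ?thesis using sets by (simp add: represents_def)
qed

lemma riesz_represents:
  assumes "represents \<mu> y"
  shows "(\<integral>x. poly_fun f x \<partial>\<mu>) = riesz y f"
  using assms unfolding poly_fun_def riesz_def represents_def by simp

subsection \<open>Determinacy\<close>

lemma exp_bounded_partial_sum_le:
  fixes f :: "real fps"
  assumes "0 \<le> C" "0 \<le> R" "\<And>k. \<bar>fps_nth f k\<bar> \<le> C * R ^ k / fact k"
  shows "summable (\<lambda>k. fps_nth f k * t ^ k)"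
    and "\<bar>\<Sum>k<K. fps_nth f k * t ^ k\<bar> \<le> C * exp (R * \<bar>t\<bar>)"
proof -
  have term_le: "\<bar>fps_nth f k * t ^ k\<bar> \<le> C * (inverse (fact k) * (R * \<bar>t\<bar>) ^ k)" for k
  proof -
    have "\<bar>fps_nth f k * t ^ k\<bar> \<le> C * R ^ k / fact k * \<bar>t\<bar> ^ k"
      unfolding abs_mult power_abs using assms(3) by (intro mult_right_mono) auto
    then show ?thesis by (simp add: power_mult_distrib divide_inverse ac_simps)
  qed
  have exp_sum: "summable (\<lambda>k. C * (inverse (fact k) * (R * \<bar>t\<bar>) ^ k))"
    by (intro summable_mult summable_exp)
  show "summable (\<lambda>k. fps_nth f k * t ^ k)"
    by (rule summable_comparison_test'[OF exp_sum, of 0]) (simp only: real_norm_def term_le)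
  have "\<bar>\<Sum>k<K. fps_nth f k * t ^ k\<bar> \<le> (\<Sum>k<K. C * (inverse (fact k) * (R * \<bar>t\<bar>) ^ k))"
    by (rule order_trans[OF sum_abs]) (intro sum_mono term_le)
  also have "\<dots> \<le> suminf (\<lambda>k. C * (inverse (fact k) * (R * \<bar>t\<bar>) ^ k))"
    using assms(1,2) by (intro sum_le_suminf exp_sum) auto
  also have "\<dots> = C * exp (R * \<bar>t\<bar>)"
    by (subst suminf_mult[OF summable_exp]) (simp add: exp_def divide_inverse mult.commute)
  finally show "\<bar>\<Sum>k<K. fps_nth f k * t ^ k\<bar> \<le> C * exp (R * \<bar>t\<bar>)" .
qed

text \<open>Both sides agree on polynomial truncations. The left side converges by domination with
  products of \<open>exp (R * \<bar>x $ i\<bar>)\<close>, the right side by continuity of the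
  functional. So these integrals are determined by \<open>y\<close>.\<close>

lemma integral_prod_eval_fps:
  fixes y :: "'n::finite expo \<Rightarrow> real" and g :: "'n \<Rightarrow> real fps"
  assumes rep: "represents \<mu> y" and th: "\<And>r. riesz y (theta r) \<le> c" and c: "0 \<le> c"
    and g: "exp_bounded g"
  shows "(\<integral>x. (\<Prod>i\<in>UNIV. eval_fps (g i) (x $ i)) \<partial>\<mu>) = ext_functional y g"
proof -
  have sets: "sets \<mu> = sets borel" using rep by (simp add: represents_def)
  note [measurable_cong] = sets
  have int: "integrable \<mu> (monomial_fun a)" and y: "y a = (\<integral>x. monomial_fun a x \<partial>\<mu>)" for a
    using rep by (auto simp: represents_def)
  have gr: "moment_growth y"
    by (rule moment_growth_of_theta_bound[OF represents_psd[OF rep] th])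
  obtain C R where CR: "0 \<le> C" "0 \<le> R" "\<And>i k. \<bar>fps_nth (g i) k\<bar> \<le> C * R ^ k / fact k"
    using g unfolding exp_bounded_def by blast
  have "(\<integral>\<^sup>+x. ennreal (\<Sum>i\<in>UNIV. exp ((x $ i)\<^sup>2)) \<partial>\<mu>) \<le> ennreal c"
    using th by (simp add: exp_square_le_iff[OF rep c])
  then have fin: "(\<integral>\<^sup>+x. ennreal (\<Sum>i\<in>UNIV. exp ((x $ i)\<^sup>2)) \<partial>\<mu>) < \<infinity>"
    by (rule le_less_trans) simp
  define P where "P K x = (\<Prod>i\<in>UNIV. \<Sum>k<K. fps_nth (g i) k * (x $ i) ^ k)" for K and x :: "real^'n"
  have "(\<integral>x. P K x \<partial>\<mu>) = ext_functional y (\<lambda>i. fps_cutoff K (g i))" for K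
  proof -
    have P: "P K x = (\<Sum>F\<in>PiE UNIV (\<lambda>_. {..<K}). (\<Prod>i\<in>UNIV. fps_nth (g i) (F i)) * monomial_fun (Abs_poly_mapping F) x)" for x
      unfolding P_def by (subst prod_sum_PiE) (auto simp: monomial_fun_def prod.distrib)
    have "(\<integral>x. P K x \<partial>\<mu>) = (\<Sum>F\<in>PiE UNIV (\<lambda>_. {..<K}). (\<Prod>i\<in>UNIV. fps_nth (g i) (F i)) * y (Abs_poly_mapping F))"
      unfolding P y by (simp add: int)
    then show ?thesis unfolding ext_functional_cutoff[OF gr] .
  qed
  moreover have "(\<lambda>K. ext_functional y (\<lambda>i. fps_cutoff K (g i))) \<longlonglongrightarrow> ext_functional y g"
    using exp_bounded_cutoff[OF g, of "\<lambda>K. K" "\<lambda>_. _"]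
    by (intro ext_functional_tendsto gr fps_cutoff_nth_tendsto) simp
  moreover have "(\<lambda>K. \<integral>x. P K x \<partial>\<mu>) \<longlonglongrightarrow> (\<integral>x. (\<Prod>i\<in>UNIV. eval_fps (g i) (x $ i)) \<partial>\<mu>)"
  proof (rule integral_dominated_convergence)
    have lim: "(\<lambda>K. \<Sum>k<K. fps_nth (g i) k * t ^ k) \<longlonglongrightarrow> eval_fps (g i) t" for i t
      unfolding eval_fps_def by (rule summable_LIMSEQ[OF exp_bounded_partial_sum_le(1)[OF CR]])
    then show pt: "AE x in \<mu>. (\<lambda>K. P K x) \<longlonglongrightarrow> (\<Prod>i\<in>UNIV. eval_fps (g i) (x $ i))"
      unfolding P_def by (intro AE_I2 tendsto_prod)
    show Pm: "P K \<in> borel_measurable \<mu>" for K unfolding P_def by measurable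
    show "(\<lambda>x. \<Prod>i\<in>UNIV. eval_fps (g i) (x $ i)) \<in> borel_measurable \<mu>"
      by (rule borel_measurable_LIMSEQ_real[of _ P]) (use lim Pm in \<open>auto simp: P_def intro!: tendsto_prod\<close>)
    show "integrable \<mu> (\<lambda>x. C ^ CARD('n) * (\<Prod>i\<in>UNIV. exp (R * \<bar>x $ i\<bar>)))"
      by (intro integrable_mult_right integrable_prod_exp_abs sets fin CR)
    have "\<bar>P K x\<bar> \<le> (\<Prod>i\<in>UNIV. C * exp (R * \<bar>x $ i\<bar>))" for K x
      unfolding P_def abs_prod using exp_bounded_partial_sum_le(2)[OF CR]
      by (intro prod_mono) auto
    then show "AE x in \<mu>. norm (P K x) \<le> C ^ CARD('n) * (\<Prod>i\<in>UNIV. exp (R * \<bar>x $ i\<bar>))" for K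
      by (intro AE_I2) (simp add: prod.distrib)
  qed
  ultimately show ?thesis by (simp add: LIMSEQ_unique)
qed

section \<open>Bernstein approximation in the variables \<open>sin (\<epsilon> x)\<close>\<close>

lemma eval_fps_bern:
  assumes "j \<le> N"
  shows "eval_fps (bern N \<epsilon> j) t = Bernstein N j ((1 + sin (\<epsilon> * t)) / 2)"
proof -
  have r1: "fps_conv_radius (1 + fps_sin \<epsilon>) = \<infinity>" "fps_conv_radius (1 - fps_sin \<epsilon>) = \<infinity>"
    using fps_conv_radius_add[of 1 "fps_sin \<epsilon>"] fps_conv_radius_diff[of 1 "fps_sin \<epsilon>"] by auto
  have rp: "fps_conv_radius ((1 + fps_sin \<epsilon>) ^ j) = \<infinity>" "fps_conv_radius ((1 - fps_sin \<epsilon>) ^ (N - j)) = \<infinity>"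
    using fps_conv_radius_power[of "1 + fps_sin \<epsilon>" j] fps_conv_radius_power[of "1 - fps_sin \<epsilon>" "N - j"] r1
    by auto
  have rc: "fps_conv_radius (fps_const (real (N choose j) / 2 ^ N) * (1 + fps_sin \<epsilon>) ^ j) = \<infinity>"
    using fps_conv_radius_mult[of "fps_const (real (N choose j) / 2 ^ N)" "(1 + fps_sin \<epsilon>) ^ j"] rp by auto
  have "eval_fps (bern N \<epsilon> j) t
      = real (N choose j) / 2 ^ N * (1 + sin (\<epsilon> * t)) ^ j * (1 - sin (\<epsilon> * t)) ^ (N - j)"
    unfolding bern_def half_plus_square half_minus_square
    by (simp add: eval_fps_mult eval_fps_power eval_fps_add eval_fps_diff r1 rp rc)
  also have "\<dots> = Bernstein N j ((1 + sin (\<epsilon> * t)) / 2)"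
  proof -
    have two: "(2::real) ^ N = 2 ^ j * 2 ^ (N - j)" using assms by (simp add: power_add[symmetric])
    have half: "1 - (1 + sin (\<epsilon> * t)) / 2 = (1 - sin (\<epsilon> * t)) / 2" by (simp add: field_simps)
    show ?thesis unfolding Bernstein_def half power_divide two by simp
  qed
  finally show ?thesis .
qed

lemma half_one_plus_sin_bounds: "0 \<le> (1 + sin u) / 2" "(1 + sin u) / 2 \<le> 1" for u :: real
proof -
  have "- 1 \<le> sin u" by simp
  then have "0 \<le> 1 + sin u" by linarith
  then show "0 \<le> (1 + sin u) / 2" by simp
qed simp

lemma Bernstein_variance:
  "(\<Sum>j\<le>N. (real j - real N * p)\<^sup>2 * Bernstein N j p) = real N * p * (1 - p)"
proof -
  have "(\<Sum>j\<le>N. (real j - real N * p)\<^sup>2 * Bernstein N j p)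
    = (\<Sum>j\<le>N. real j * (real j - 1) * Bernstein N j p)
      + (1 - 2 * (real N * p)) * (\<Sum>j\<le>N. real j * Bernstein N j p)
      + (real N * p)\<^sup>2 * (\<Sum>j\<le>N. Bernstein N j p)"
    unfolding sum_distrib_left sum.distrib[symmetric]
    by (rule sum.cong) (auto simp: power2_eq_square algebra_simps)
  also have "\<dots> = real N * p * (1 - p)"
    unfolding sum_kk_Bernstein sum_k_Bernstein sum_Bernstein
    by (simp add: power2_eq_square algebra_simps)
  finally show ?thesis .
qed

lemma sin_step_width_tendsto: "(\<lambda>m. sin (step_width m * t) / step_width m) \<longlonglongrightarrow> t"
proof -
  have "((\<lambda>h. sin (h * t)) has_field_derivative t) (at 0)"
    by (auto intro!: derivative_eq_intros)
  then have "((\<lambda>h. sin (h * t) / h) \<longlongrightarrow> t) (at 0)" by (simp add: has_field_derivative_iff)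
  moreover have "filterlim step_width (at 0) sequentially"
    using step_width(1) by (intro filterlim_atI step_width(3) always_eventually allI) (metis less_irrefl)
  ultimately show ?thesis by (rule filterlim_compose)
qed

text \<open>Bernstein's probabilistic argument: the nodes have mean
  \<open>sin (\<epsilon> * t) / \<epsilon>\<close> and variance at most \<epsilon>, so a Lipschitz
  function changes little on average, and the mean tends to \<open>t\<close>.\<close>

lemma bern_approximation:
  fixes h :: "real \<Rightarrow> real"
  assumes L: "\<And>s t. \<bar>h s - h t\<bar> \<le> L * \<bar>s - t\<bar>" "0 \<le> L"
  shows "(\<lambda>m. \<Sum>j\<le>num_nodes m. h (node (num_nodes m) (step_width m) j)
      * eval_fps (bern (num_nodes m) (step_width m) j) t) \<longlonglongrightarrow> h t"
proof -
  define p where "p m = (1 + sin (step_width m * t)) / 2" for m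
  define s where "s m = sin (step_width m * t) / step_width m" for m
  define N where "N = num_nodes"
  define z where "z m j = node (N m) (step_width m) j" for m j
  define B where "B m j = Bernstein (N m) j (p m)" for m j
  have p: "0 \<le> p m" "p m \<le> 1" for m
    unfolding p_def by (rule half_one_plus_sin_bounds)+
  have B0: "0 \<le> B m j" for m j unfolding B_def using p by (rule Bernstein_nonneg)
  have B1: "(\<Sum>j\<le>N m. B m j) = 1" for m unfolding B_def by simp
  have var: "(\<Sum>j\<le>N m. (z m j - s m)\<^sup>2 * B m j) \<le> step_width m" for m
  proof -
    have N0: "0 < real (N m)" using num_nodes(1) by (simp add: N_def)
    have dz: "z m j - s m = 2 / (real (N m) * step_width m) * (real j - real (N m) * p m)" for j
      using N0 step_width(1)[of m] by (simp add: z_def node_def s_def p_def field_simps)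
    have "(\<Sum>j\<le>N m. (z m j - s m)\<^sup>2 * B m j)
      = (2 / (real (N m) * step_width m))\<^sup>2 * (\<Sum>j\<le>N m. (real j - real (N m) * p m)\<^sup>2 * B m j)"
      unfolding dz power_mult_distrib sum_distrib_left mult.assoc by (rule refl)
    also have "\<dots> = 1 / (real (N m) * (step_width m)\<^sup>2) * (4 * (p m * (1 - p m)))"
      unfolding B_def Bernstein_variance using N0 by (simp add: power2_eq_square)
    also have "\<dots> \<le> step_width m * 1"
    proof -
      have "0 \<le> (2 * p m - 1)\<^sup>2" by simp
      then have "4 * (p m * (1 - p m)) \<le> 1" by (simp add: power2_eq_square algebra_simps)
      then show ?thesis unfolding N_def num_nodes(2) using step_width(1)[of m]
        by (intro mult_left_mono) auto
    qed
    finally show ?thesis by simp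
  qed
  have dev: "(\<Sum>j\<le>N m. \<bar>z m j - s m\<bar> * B m j) \<le> 2 * sqrt (step_width m)" for m
  proof -
    define \<eta> where "\<eta> = sqrt (step_width m)"
    have \<eta>: "0 < \<eta>" "step_width m = \<eta>\<^sup>2" using step_width(1)[of m] by (auto simp: \<eta>_def)
    \<comment> \<open>This passes from the variance to the mean deviation; with
      \<open>\<eta> = sqrt \<epsilon>\<close> both terms contribute the same amount.\<close>
    have "\<bar>d\<bar> \<le> \<eta> + d\<^sup>2 / \<eta>" for d
    proof -
      have "0 \<le> (\<bar>d\<bar> - \<eta>)\<^sup>2 + \<bar>d\<bar> * \<eta>" using \<eta> by simp
      then have "\<bar>d\<bar> * \<eta> \<le> \<eta> * \<eta> + d\<^sup>2" by (simp add: power2_eq_square algebra_simps)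
      then show ?thesis using \<eta> by (simp add: field_simps)
    qed
    then have "(\<Sum>j\<le>N m. \<bar>z m j - s m\<bar> * B m j) \<le> (\<Sum>j\<le>N m. (\<eta> + (z m j - s m)\<^sup>2 / \<eta>) * B m j)"
      using B0 by (intro sum_mono mult_right_mono) auto
    also have "\<dots> = \<eta> * (\<Sum>j\<le>N m. B m j) + (\<Sum>j\<le>N m. (z m j - s m)\<^sup>2 * B m j) / \<eta>"
      by (simp add: distrib_right sum.distrib sum_distrib_left sum_divide_distrib)
    also have "\<dots> \<le> \<eta> * 1 + \<eta>\<^sup>2 / \<eta>"
      unfolding B1 using var[of m] \<eta> by (intro add_left_mono divide_right_mono) auto
    also have "\<dots> = 2 * \<eta>" using \<eta> by (simp add: power2_eq_square)
    finally show ?thesis unfolding \<eta>_def .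
  qed
  have bound: "\<bar>(\<Sum>j\<le>N m. h (z m j) * B m j) - h t\<bar> \<le> L * (2 * sqrt (step_width m)) + L * \<bar>s m - t\<bar>" for m
  proof -
    have "(\<Sum>j\<le>N m. h (z m j) * B m j) - h (s m) = (\<Sum>j\<le>N m. (h (z m j) - h (s m)) * B m j)"
      using B1[of m] by (simp add: left_diff_distrib sum_subtractf sum_distrib_left[symmetric])
    also have "\<bar>\<dots>\<bar> \<le> (\<Sum>j\<le>N m. L * \<bar>z m j - s m\<bar> * B m j)"
      by (rule order_trans[OF sum_abs]) (auto simp: abs_mult B0 intro!: sum_mono mult_right_mono L(1))
    also have "\<dots> = L * (\<Sum>j\<le>N m. \<bar>z m j - s m\<bar> * B m j)" by (simp add: sum_distrib_left mult.assoc)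
    also have "\<dots> \<le> L * (2 * sqrt (step_width m))" by (rule mult_left_mono[OF dev L(2)])
    finally show ?thesis using L(1)[of "s m" t] by linarith
  qed
  have "(\<lambda>m. L * (2 * sqrt (step_width m)) + L * \<bar>s m - t\<bar>) \<longlonglongrightarrow> L * (2 * sqrt 0) + L * \<bar>t - t\<bar>"
    unfolding s_def by (intro tendsto_intros step_width sin_step_width_tendsto)
  then have "(\<lambda>m. L * (2 * sqrt (step_width m)) + L * \<bar>s m - t\<bar>) \<longlonglongrightarrow> 0" by simp
  then have "(\<lambda>m. (\<Sum>j\<le>N m. h (z m j) * B m j) - h t) \<longlonglongrightarrow> 0"
    by (rule Lim_null_comparison[rotated]) (auto simp: bound intro!: always_eventually)
  then have "(\<lambda>m. \<Sum>j\<le>N m. h (z m j) * B m j) \<longlonglongrightarrow> h t" by (simp add: LIM_zero_iff)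
  moreover have "(\<Sum>j\<le>N m. h (z m j) * B m j)
      = (\<Sum>j\<le>num_nodes m. h (node (num_nodes m) (step_width m) j) * eval_fps (bern (num_nodes m) (step_width m) j) t)" for m
    by (intro sum.cong) (auto simp: N_def z_def B_def p_def eval_fps_bern)
  ultimately show ?thesis by simp
qed

text \<open>The sums on the left involve \<open>y\<close> only, while \<mu> may be any representing
  measure. They are integrals of the products \<open>H m\<close> of Bernstein sums, which are
  bounded by 1 and converge pointwise.\<close>

lemma node_sums_tendsto_integral:
  fixes y :: "'n::finite expo \<Rightarrow> real" and h :: "'n \<Rightarrow> real \<Rightarrow> real"
  assumes rep: "represents \<mu> y" and th: "\<And>r. riesz y (theta r) \<le> c" and c: "0 \<le> c"
    and L: "\<And>i s t. \<bar>h i s - h i t\<bar> \<le> L * \<bar>s - t\<bar>" "0 \<le> L" and bd: "\<And>i t. \<bar>h i t\<bar> \<le> 1"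
  shows "(\<lambda>m. \<Sum>F\<in>node_index m. (\<Prod>i\<in>UNIV. h i (node_point m F $ i)) * node_weight y m F)
    \<longlonglongrightarrow> (\<integral>x. (\<Prod>i\<in>UNIV. h i (x $ i)) \<partial>\<mu>)"
proof -
  have sets: "sets \<mu> = sets borel" using rep by (simp add: represents_def)
  note [measurable_cong] = sets
  have "integrable \<mu> (monomial_fun 0)" using rep by (simp add: represents_def)
  then have one: "integrable \<mu> (\<lambda>_. 1 :: real)" by (simp add: monomial_fun_def[abs_def])
  define b where "b m j t = eval_fps (bern (num_nodes m) (step_width m) j) t" for m j t
  define z where "z m j = node (num_nodes m) (step_width m) j" for m j
  define H where "H m x = (\<Prod>i\<in>UNIV. \<Sum>j\<le>num_nodes m. h i (z m j) * b m j (x $ i))" for m and x :: "real^'n"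
  have b_eq: "b m j t = Bernstein (num_nodes m) j ((1 + sin (step_width m * t)) / 2)" if "j \<le> num_nodes m" for m j t
    unfolding b_def by (rule eval_fps_bern[OF that])
  have b0: "0 \<le> b m j t" if "j \<le> num_nodes m" for m j t
    unfolding b_eq[OF that] by (intro Bernstein_nonneg half_one_plus_sin_bounds)
  have b1: "(\<Sum>j\<le>num_nodes m. b m j t) = 1" for m t by (simp add: b_eq)
  have b_le: "b m j t \<le> 1" if "j \<le> num_nodes m" for m j t
    using member_le_sum[of j "{..num_nodes m}" "\<lambda>j. b m j t"] that b0 b1 by auto
  have b_meas [measurable]: "(\<lambda>x :: real^'n. b m j (x $ i)) \<in> borel_measurable borel" if "j \<le> num_nodes m" for m j i
    unfolding b_eq[OF that] Bernstein_def by measurable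
  have "(\<lambda>m. \<integral>x. H m x \<partial>\<mu>) \<longlonglongrightarrow> (\<integral>x. (\<Prod>i\<in>UNIV. h i (x $ i)) \<partial>\<mu>)"
  proof (rule integral_dominated_convergence[where w = "\<lambda>_. 1"])
    have "continuous_on UNIV (h i)" for i
      using L by (intro lipschitz_on_continuous_on[of L] lipschitz_onI) (auto simp: dist_real_def)
    then have [measurable]: "h i \<in> borel_measurable borel" for i
      by (rule borel_measurable_continuous_onI)
    show "(\<lambda>x. \<Prod>i\<in>UNIV. h i (x $ i)) \<in> borel_measurable \<mu>" by measurable
    show "H m \<in> borel_measurable \<mu>" for m
      unfolding H_def using b_meas by (intro borel_measurable_prod borel_measurable_sum borel_measurable_times)
        (auto simp: measurable_cong_sets[OF sets refl])
    show "integrable \<mu> (\<lambda>_. 1 :: real)" by (rule one)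
    show "AE x in \<mu>. (\<lambda>m. H m x) \<longlonglongrightarrow> (\<Prod>i\<in>UNIV. h i (x $ i))"
      unfolding H_def b_def z_def using L by (intro AE_I2 tendsto_prod bern_approximation)
    show "AE x in \<mu>. norm (H m x) \<le> 1" for m
    proof (rule AE_I2)
      fix x :: "real^'n"
      have "\<bar>\<Sum>j\<le>num_nodes m. h i (z m j) * b m j (x $ i)\<bar> \<le> 1" for i
      proof -
        have "\<bar>\<Sum>j\<le>num_nodes m. h i (z m j) * b m j (x $ i)\<bar> \<le> (\<Sum>j\<le>num_nodes m. 1 * b m j (x $ i))"
          using b0 bd by (intro order_trans[OF sum_abs] sum_mono) (auto simp: abs_mult intro!: mult_left_le_one_le)
        then show ?thesis using b1 by simp
      qed
      then have "(\<Prod>i\<in>UNIV. \<bar>\<Sum>j\<le>num_nodes m. h i (z m j) * b m j (x $ i)\<bar>) \<le> (\<Prod>i\<in>(UNIV :: 'n set). 1)"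
        by (intro prod_mono) auto
      then show "norm (H m x) \<le> 1" by (simp add: H_def abs_prod)
    qed
  qed
  moreover have "(\<integral>x. H m x \<partial>\<mu>)
      = (\<Sum>F\<in>node_index m. (\<Prod>i\<in>UNIV. h i (node_point m F $ i)) * node_weight y m F)" for m
  proof -
    have H: "H m x = (\<Sum>F\<in>node_index m. (\<Prod>i\<in>UNIV. h i (z m (F i))) * (\<Prod>i\<in>UNIV. b m (F i) (x $ i)))" for x
      unfolding H_def node_index_def by (subst prod_sum_PiE) (auto simp: prod.distrib)
    have int: "integrable \<mu> (\<lambda>x. \<Prod>i\<in>UNIV. b m (F i) (x $ i))" if "F \<in> node_index m" for F
    proof (rule Bochner_Integration.integrable_bound[OF one])
      have F: "F i \<le> num_nodes m" for i using that by (auto simp: node_index_def)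
      show "(\<lambda>x. \<Prod>i\<in>UNIV. b m (F i) (x $ i)) \<in> borel_measurable \<mu>"
        using b_meas[OF F] by (intro borel_measurable_prod) (auto simp: measurable_cong_sets[OF sets refl])
      have "(\<Prod>i\<in>UNIV. \<bar>b m (F i) (x $ i)\<bar>) \<le> (\<Prod>i\<in>(UNIV :: 'n set). 1)" for x :: "real^'n"
        using b0[OF F] b_le[OF F] by (intro prod_mono) (auto simp: abs_of_nonneg)
      then show "AE x in \<mu>. norm (\<Prod>i\<in>UNIV. b m (F i) (x $ i)) \<le> norm (1 :: real)"
        by (intro AE_I2) (simp add: abs_prod)
    qed
    have "(\<integral>x. H m x \<partial>\<mu>) = (\<Sum>F\<in>node_index m. (\<Prod>i\<in>UNIV. h i (z m (F i)))
        * (\<integral>x. (\<Prod>i\<in>UNIV. b m (F i) (x $ i)) \<partial>\<mu>))"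
      unfolding H using int by (subst Bochner_Integration.integral_sum) auto
    also have "\<dots> = (\<Sum>F\<in>node_index m. (\<Prod>i\<in>UNIV. h i (node_point m F $ i)) * node_weight y m F)"
      unfolding b_def node_weight_def
      by (subst integral_prod_eval_fps[OF rep th c exp_bounded_bern_family])
        (simp add: z_def node_point_def)
    finally show ?thesis .
  qed
  ultimately show ?thesis by simp
qed

section \<open>Recovering a finite measure from Lipschitz test functions\<close>

definition ramp :: "real \<Rightarrow> nat \<Rightarrow> real \<Rightarrow> real" where
  "ramp a k t = max 0 (min 1 (1 - real k * (t - a)))"

lemma ramp_lipschitz: "\<bar>ramp a k s - ramp a k t\<bar> \<le> real k * \<bar>s - t\<bar>"
proof -
  have "\<bar>ramp a k s - ramp a k t\<bar> \<le> \<bar>real k * (t - s)\<bar>"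
    unfolding ramp_def by (simp add: algebra_simps max_def min_def abs_if)
  then show ?thesis by (simp add: abs_mult abs_minus_commute)
qed

lemma ramp_tendsto: "(\<lambda>k. ramp a k t) \<longlonglongrightarrow> (if t \<le> a then 1 else 0)"
proof (cases "t \<le> a")
  case True
  then have "ramp a k t = 1" for k
    using mult_nonneg_nonpos[of "real k" "t - a"] by (simp add: ramp_def)
  then show ?thesis using True by simp
next
  case False
  obtain K where K: "1 / (t - a) \<le> real K" using real_arch_simple by blast
  have "ramp a k t = 0" if "K \<le> k" for k
  proof -
    have "1 / (t - a) \<le> real k" using K that by linarith
    then have "1 \<le> real k * (t - a)" using False by (simp add: field_simps)
    then show ?thesis by (simp add: ramp_def)
  qed
  then have "\<forall>\<^sub>F k in sequentially. ramp a k t = 0" by (auto simp: eventually_sequentially)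
  then show ?thesis using False by (simp add: tendsto_eventually)
qed

lemma measure_atMost_limit:
  fixes \<mu> :: "(real^'n::finite) measure"
  assumes sets: "sets \<mu> = sets borel" and one: "integrable \<mu> (\<lambda>_. 1 :: real)"
  shows "(\<lambda>k. \<integral>x. (\<Prod>i\<in>UNIV. ramp (a $ i) k (x $ i)) \<partial>\<mu>) \<longlonglongrightarrow> measure \<mu> {..a}"
proof -
  note [measurable_cong] = sets
  have "(\<lambda>k. \<integral>x. (\<Prod>i\<in>UNIV. ramp (a $ i) k (x $ i)) \<partial>\<mu>) \<longlonglongrightarrow> (\<integral>x. indicator {..a} x \<partial>\<mu>)"
  proof (rule integral_dominated_convergence[OF _ _ one])
    show "indicator {..a} \<in> borel_measurable \<mu>" by simp
    show "(\<lambda>x. \<Prod>i\<in>UNIV. ramp (a $ i) k (x $ i)) \<in> borel_measurable \<mu>" for k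
      unfolding ramp_def by measurable
    have ind: "(\<Prod>i\<in>UNIV. if x $ i \<le> a $ i then 1 else 0) = (indicator {..a} x :: real)" for x :: "real^'n"
    proof (cases "x \<le> a")
      case True
      then show ?thesis by (simp add: less_eq_vec_def)
    next
      case False
      then obtain i where "\<not> x $ i \<le> a $ i" by (auto simp: less_eq_vec_def)
      then have "(\<Prod>i\<in>UNIV. if x $ i \<le> a $ i then 1 else (0::real)) = 0"
        by (intro prod_zero) auto
      then show ?thesis using False by simp
    qed
    show "AE x in \<mu>. (\<lambda>k. \<Prod>i\<in>UNIV. ramp (a $ i) k (x $ i)) \<longlonglongrightarrow> indicator {..a} x"
      unfolding ind[symmetric] by (intro AE_I2 tendsto_prod ramp_tendsto)
    have "0 \<le> ramp u k t" "ramp u k t \<le> 1" for u k t by (auto simp: ramp_def)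
    then have "(\<Prod>i\<in>UNIV. \<bar>ramp (a $ i) k (x $ i)\<bar>) \<le> (\<Prod>i\<in>(UNIV :: 'n set). 1)" for x k
      by (intro prod_mono) auto
    then show "AE x in \<mu>. norm (\<Prod>i\<in>UNIV. ramp (a $ i) k (x $ i)) \<le> 1" for k
      by (intro AE_I2) (simp add: abs_prod)
  qed
  then show ?thesis using sets_eq_imp_space_eq[OF sets] by simp
qed

lemma measure_eqI_atMost:
  fixes \<mu> \<nu> :: "(real^'n::finite) measure"
  assumes \<mu>: "finite_measure \<mu>" "sets \<mu> = sets borel" and \<nu>: "finite_measure \<nu>" "sets \<nu> = sets borel"
    and eq: "\<And>a. measure \<mu> {..a} = measure \<nu> {..a}"
  shows "\<mu> = \<nu>"
proof (rule measure_eqI_generator_eq[where \<Omega> = UNIV and E = "range atMost"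
      and A = "\<lambda>k. {..\<chi> i. real k}"])
  interpret \<mu>: finite_measure \<mu> by fact
  interpret \<nu>: finite_measure \<nu> by fact
  show "Int_stable (range atMost :: (real^'n) set set)"
  proof (rule Int_stableI)
    fix A B :: "(real^'n) set" assume "A \<in> range atMost" "B \<in> range atMost"
    then obtain a b where "A = {..a}" "B = {..b}" by auto
    then have "A \<inter> B = {..\<chi> i. min (a $ i) (b $ i)}" by (auto simp: less_eq_vec_def)
    then show "A \<inter> B \<in> range atMost" by blast
  qed
  show "sets \<mu> = sigma_sets UNIV (range atMost)" "sets \<nu> = sigma_sets UNIV (range atMost)"
    unfolding \<mu>(2) \<nu>(2) by (subst borel_eq_atMost, simp)+
  show "emeasure \<mu> X = emeasure \<nu> X" if "X \<in> range atMost" for X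
    using that eq by (auto simp: \<mu>.emeasure_eq_measure \<nu>.emeasure_eq_measure)
  show "(\<Union>k. {..\<chi> i. real k}) = (UNIV :: (real^'n) set)"
  proof -
    have "\<exists>k. x \<le> (\<chi> i. real k)" for x :: "real^'n"
    proof -
      obtain k where "norm x \<le> real k" using real_arch_simple by blast
      then have "x $ i \<le> real k" for i using component_le_norm_cart[of x i] by linarith
      then show ?thesis by (auto simp: less_eq_vec_def)
    qed
    then show ?thesis by auto
  qed
  show "emeasure \<mu> {..\<chi> i. real k} \<noteq> \<infinity>" for k by (simp add: \<mu>.emeasure_eq_measure)
qed auto

lemma represents_finite_measure:
  assumes "represents \<mu> y"
  shows "finite_measure \<mu>"
proof -
  have "integrable \<mu> (monomial_fun 0)" using assms by (simp add: represents_def)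
  then have "integrable \<mu> (\<lambda>_. 1 :: real)" by (simp add: monomial_fun_def[abs_def])
  then show ?thesis by (auto simp: integrable_iff_bounded intro!: finite_measureI)
qed

text \<open>Integrals of products of ramps are limits of the same node sums for both measures.
  Letting the slopes grow gives equal values on all sets \<open>{..a}\<close>, a generator stable
  under intersections.\<close>

lemma represents_unique:
  fixes y :: "'n::finite expo \<Rightarrow> real"
  assumes \<mu>: "represents \<mu> y" and \<nu>: "represents \<nu> y" and th: "\<And>r. riesz y (theta r) \<le> c" and c: "0 \<le> c"
  shows "\<mu> = \<nu>"
proof (rule measure_eqI_atMost)
  interpret \<mu>: finite_measure \<mu> by (rule represents_finite_measure[OF \<mu>])
  interpret \<nu>: finite_measure \<nu> by (rule represents_finite_measure[OF \<nu>])
  show sets: "sets \<mu> = sets borel" "sets \<nu> = sets borel" using \<mu> \<nu> by (auto simp: represents_def)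
  fix a :: "real^'n"
  have "(\<integral>x. (\<Prod>i\<in>UNIV. ramp (a $ i) k (x $ i)) \<partial>\<mu>) = (\<integral>x. (\<Prod>i\<in>UNIV. ramp (a $ i) k (x $ i)) \<partial>\<nu>)" for k
  proof (rule LIMSEQ_unique)
    have bd: "\<bar>ramp u k t\<bar> \<le> 1" for u t by (auto simp: ramp_def)
    show "(\<lambda>m. \<Sum>F\<in>node_index m. (\<Prod>i\<in>UNIV. ramp (a $ i) k (node_point m F $ i)) * node_weight y m F)
        \<longlonglongrightarrow> (\<integral>x. (\<Prod>i\<in>UNIV. ramp (a $ i) k (x $ i)) \<partial>\<mu>)"
      by (rule node_sums_tendsto_integral[OF \<mu> th c ramp_lipschitz _ bd]) simp
    show "(\<lambda>m. \<Sum>F\<in>node_index m. (\<Prod>i\<in>UNIV. ramp (a $ i) k (node_point m F $ i)) * node_weight y m F)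
        \<longlonglongrightarrow> (\<integral>x. (\<Prod>i\<in>UNIV. ramp (a $ i) k (x $ i)) \<partial>\<nu>)"
      by (rule node_sums_tendsto_integral[OF \<nu> th c ramp_lipschitz _ bd]) simp
  qed
  then show "measure \<mu> {..a} = measure \<nu> {..a}"
    using measure_atMost_limit[OF sets(1), of a] measure_atMost_limit[OF sets(2), of a]
    by (simp add: LIMSEQ_unique)
qed (intro represents_finite_measure[OF \<mu>] represents_finite_measure[OF \<nu>])+

subsection \<open>Convergence of the relaxations\<close>

text \<open>A bound free of \<open>r\<close> is needed for pointwise limits over all levels. Degrees
  up to \<open>r\<close> are controlled by Cauchy-Schwarz against the constant monomial; for higher
  ones \<open>fact r\<close> is below \<open>fact (expo_deg \<alpha>)\<close>. The summand 1 comes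
  from \<open>\<bar>u\<bar> \<le> u\<^sup>2 + 1\<close>.\<close>

lemma Q_feasible_uniform_bound:
  fixes y :: "'n::finite expo \<Rightarrow> real"
  assumes y: "y \<in> Q_feasible M r"
  shows "\<bar>y \<alpha>\<bar> \<le> bound TYPE('n) M * fact (expo_deg \<alpha>) + 1"
proof (cases "expo_deg \<alpha> \<le> r")
  case True
  note res = Q_feasible_restrict[OF y True]
  have "(y (\<alpha> + 0))\<^sup>2 \<le> y (\<alpha> + \<alpha>) * y (0 + 0)"
    by (rule moment_cauchy[OF res(1)]) auto
  also have "\<dots> \<le> bound TYPE('n) M * fact (expo_deg \<alpha>)"
    using moment_diag_le[OF res(1), of "bound TYPE('n) M" \<alpha>] res(2,3) by (simp add: riesz_theta)
  finally have "(y \<alpha>)\<^sup>2 \<le> bound TYPE('n) M * fact (expo_deg \<alpha>)" by simp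
  moreover have "\<bar>u\<bar> \<le> u\<^sup>2 + 1" for u :: real
    using zero_le_power2[of "\<bar>u\<bar> - 1"] by (simp add: power2_eq_square algebra_simps)
  ultimately show ?thesis using order_trans by (metis add_right_mono)
next
  case False
  have "\<bar>y \<alpha>\<bar> \<le> bound TYPE('n) M * fact r" by (rule Q_feasible_bounded[OF y])
  also have "\<dots> \<le> bound TYPE('n) M * fact (expo_deg \<alpha>)"
    using False by (intro mult_left_mono fact_mono) (auto simp: bound_def)
  finally show ?thesis by simp
qed

lemma accumulation_point_exists:
  fixes Y :: "nat \<Rightarrow> 'n::finite expo \<Rightarrow> real"
  assumes "\<And>r \<alpha>. \<bar>Y r \<alpha>\<bar> \<le> R \<alpha>"
  shows "\<exists>y. accumulation_point Y y"
proof -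
  \<comment> \<open>Exponents are replaced by functions \<open>'n \<Rightarrow> nat\<close>, a
    countable type, so that the product space is first countable and compactness yields convergent
    subsequences.\<close>
  define X where "X r F = Y r (Abs_poly_mapping F)" for r and F :: "'n \<Rightarrow> nat"
  have "seq_compact {x :: ('n \<Rightarrow> nat) \<Rightarrow> real. \<forall>F. \<bar>x F\<bar> \<le> R (Abs_poly_mapping F)}"
    by (intro compact_imp_seq_compact compact_box)
  moreover have "\<forall>r. X r \<in> {x. \<forall>F. \<bar>x F\<bar> \<le> R (Abs_poly_mapping F)}"
    using assms by (simp add: X_def)
  ultimately obtain x s where s: "strict_mono (s :: nat \<Rightarrow> nat)" "(X \<circ> s) \<longlonglongrightarrow> x"
    by (rule seq_compactE)
  have "(\<lambda>k. X (s k) F) \<longlonglongrightarrow> x F" for F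
    using continuous_on_tendsto_compose[OF continuous_on_product_coordinates s(2), of F] by simp
  from this[of "expt _"]
  have "(\<lambda>k. Y (s k) \<alpha>) \<longlonglongrightarrow> x (expt \<alpha>)" for \<alpha>
    unfolding X_def lookup_inverse .
  then show ?thesis
    unfolding accumulation_point_def using s(1)
    by (intro exI[of _ "\<lambda>\<alpha>. x (expt \<alpha>)"] exI[of _ s]) blast
qed

lemma Q_value_le_P_value:
  fixes f :: "'n::finite mpoly"
  assumes "total_degree f \<le> 2 * r"
  shows "Q_value f M r \<le> P_value f M"
  unfolding P_value_def
proof (rule INF_greatest)
  fix \<mu> :: "(real^'n) measure" assume \<mu>: "\<mu> \<in> P_feasible M"
  define y where "y \<alpha> = (\<integral>x. monomial_fun \<alpha> x \<partial>\<mu>)" for \<alpha>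
  have rep: "represents \<mu> y" unfolding y_def by (rule represents_of_feasible[OF \<mu>])
  interpret prob_space \<mu> using \<mu> by (simp add: P_feasible_def)
  have "0 \<le> bound TYPE('n) M" by (simp add: bound_def)
  then have "riesz y (theta r) \<le> bound TYPE('n) M"
    using exp_square_le_iff[OF rep, of "bound TYPE('n) M"] \<mu> by (simp add: P_feasible_def)
  moreover have "y 0 = 1" by (simp add: y_def prob_space)
  ultimately have "Q_value f M r \<le> ereal (riesz y f)"
    by (intro Q_value_le assms represents_psd[OF rep])
  then show "Q_value f M r \<le> ereal (P_obj f \<mu>)" by (simp add: P_obj_def riesz_represents[OF rep])
qed

lemma riesz_tendsto:
  assumes "\<And>\<alpha>. (\<lambda>k. Y k \<alpha>) \<longlonglongrightarrow> y \<alpha>"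
  shows "(\<lambda>k. riesz (Y k) p) \<longlonglongrightarrow> riesz y p"
  unfolding riesz_def by (intro tendsto_intros assms)

lemma accumulation_point_moments:
  fixes Y :: "nat \<Rightarrow> 'n::finite expo \<Rightarrow> real"
  assumes s: "strict_mono s" "\<And>\<alpha>. (\<lambda>k. Y (s k) \<alpha>) \<longlonglongrightarrow> y \<alpha>"
    and Y: "\<And>r. r0 \<le> r \<Longrightarrow> Y r \<in> Q_feasible M r"
  shows "psd_on (expos r) (moment_matrix y)" "riesz y (theta r) \<le> bound TYPE('n) M" "y 0 = 1"
proof -
  \<comment> \<open>For a fixed level \<open>r\<close>, all later members of the subsequence
    restrict to feasible points of that level, whose conditions are closed.\<close>
  have ev: "\<forall>k\<ge>max r r0. max r r0 \<le> s k" using seq_suble[OF s(1)] by (meson order_trans)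
  have res: "psd_on (expos r) (moment_matrix (Y (s k)))"
      "riesz (Y (s k)) (theta r) \<le> bound TYPE('n) M" "Y (s k) 0 = 1" if "max r r0 \<le> k" for k
    using Q_feasible_restrict[OF Y, of "s k" r] ev that by (meson max.boundedE)+
  show "psd_on (expos r) (moment_matrix y)"
    unfolding psd_on_def
  proof (intro conjI allI)
    show "\<forall>a\<in>expos r. \<forall>b\<in>expos r. moment_matrix y a b = moment_matrix y b a"
      by (simp add: moment_matrix_def add.commute)
    fix v :: "'n expo \<Rightarrow> real"
    show "0 \<le> (\<Sum>a\<in>expos r. \<Sum>b\<in>expos r. v a * moment_matrix y a b * v b)"
    proof (rule LIMSEQ_le_const)
      show "(\<lambda>k. \<Sum>a\<in>expos r. \<Sum>b\<in>expos r. v a * moment_matrix (Y (s k)) a b * v b)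
          \<longlonglongrightarrow> (\<Sum>a\<in>expos r. \<Sum>b\<in>expos r. v a * moment_matrix y a b * v b)"
        unfolding moment_matrix_def by (intro tendsto_intros s(2))
      show "\<exists>N. \<forall>k\<ge>N. 0 \<le> (\<Sum>a\<in>expos r. \<Sum>b\<in>expos r. v a * moment_matrix (Y (s k)) a b * v b)"
        using res(1) unfolding psd_on_def by blast
    qed
  qed
  show "riesz y (theta r) \<le> bound TYPE('n) M"
    using riesz_tendsto[of "\<lambda>k. Y (s k)" y "theta r", OF s(2)] res(2) by (intro LIMSEQ_le_const2) blast+
  have "(\<lambda>k. Y (s k) 0) \<longlonglongrightarrow> 1"
  proof (rule tendsto_eventually)
    show "\<forall>\<^sub>F k in sequentially. Y (s k) 0 = 1"
      using res(3) unfolding eventually_sequentially by blast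
  qed
  then show "y 0 = 1" using s(2) LIMSEQ_unique by blast
qed

text \<open>A sandwich: \<open>riesz y f\<close> is a limit of relaxation values, hence at most the
  value of the measure problem, yet it is also the objective at a feasible measure. This gives
  optimality and convergence of the values at once.\<close>

lemma accumulation_point_optimal:
  fixes f :: "'n::finite mpoly" and Y :: "nat \<Rightarrow> 'n expo \<Rightarrow> real"
  assumes deg: "total_degree f \<le> 2 * r0" and Y: "\<And>r. r0 \<le> r \<Longrightarrow> Q_optimal f M r (Y r)"
    and s: "strict_mono s" "\<And>\<alpha>. (\<lambda>k. Y (s k) \<alpha>) \<longlonglongrightarrow> y \<alpha>"
  shows "\<exists>\<mu>. prob_space \<mu> \<and> represents \<mu> y"
    and "\<And>\<mu> \<nu>. represents \<mu> y \<Longrightarrow> represents \<nu> y \<Longrightarrow> \<mu> = \<nu>"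
    and "\<And>\<mu>. prob_space \<mu> \<Longrightarrow> represents \<mu> y \<Longrightarrow> P_optimal f M \<mu>"
    and "(\<lambda>k. Q_value f M (s k)) \<longlonglongrightarrow> P_value f M"
proof -
  have feas: "Y r \<in> Q_feasible M r" if "r0 \<le> r" for r using Y[OF that] by (simp add: Q_optimal_def)
  have lim: "psd_on (expos r) (moment_matrix y)" "riesz y (theta r) \<le> bound TYPE('n) M" "y 0 = 1" for r
    using accumulation_point_moments[where ?r0.0 = r0, OF s feas] by blast+
  have b: "0 \<le> bound TYPE('n) M" by (simp add: bound_def)
  have growth: "moment_growth y" by (rule moment_growth_of_theta_bound[OF lim(1,2)])
  show ex: "\<exists>\<mu>. prob_space \<mu> \<and> represents \<mu> y"
    by (rule representing_measure_exists[OF growth lim(1,3)])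
  show "\<And>\<mu> \<nu>. represents \<mu> y \<Longrightarrow> represents \<nu> y \<Longrightarrow> \<mu> = \<nu>"
    by (rule represents_unique[OF _ _ lim(2) b])
  have ev: "r0 \<le> s k" if "r0 \<le> k" for k using seq_suble[OF s(1), of k] that by linarith
  have conv: "(\<lambda>k. Q_value f M (s k)) \<longlonglongrightarrow> ereal (riesz y f)"
  proof (rule Lim_transform_eventually)
    show "(\<lambda>k. ereal (riesz (Y (s k)) f)) \<longlonglongrightarrow> ereal (riesz y f)"
      by (intro tendsto_intros riesz_tendsto s(2))
    show "\<forall>\<^sub>F k in sequentially. ereal (riesz (Y (s k)) f) = Q_value f M (s k)"
      using Y ev unfolding eventually_sequentially Q_optimal_def by blast
  qed
  have "Q_value f M (s k) \<le> P_value f M" if "r0 \<le> k" for k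
    using ev[OF that] deg by (intro Q_value_le_P_value) simp
  then have le: "ereal (riesz y f) \<le> P_value f M" using conv by (intro LIMSEQ_le_const2) blast+
  have opt: "P_optimal f M \<mu> \<and> P_value f M = ereal (riesz y f)" if \<mu>: "prob_space \<mu>" "represents \<mu> y" for \<mu>
  proof -
    have "\<mu> \<in> P_feasible M"
      using \<mu> lim(2) exp_square_le_iff[OF \<mu>(2) b] by (simp add: P_feasible_def represents_def)
    moreover from this have "P_value f M \<le> ereal (P_obj f \<mu>)"
      unfolding P_value_def by (rule INF_lower)
    moreover have "P_obj f \<mu> = riesz y f" unfolding P_obj_def by (rule riesz_represents[OF \<mu>(2)])
    ultimately show ?thesis using le by (simp add: P_optimal_def antisym)
  qed
  then show "\<And>\<mu>. prob_space \<mu> \<Longrightarrow> represents \<mu> y \<Longrightarrow> P_optimal f M \<mu>" by blast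
  show "(\<lambda>k. Q_value f M (s k)) \<longlonglongrightarrow> P_value f M" using conv ex opt by metis
qed

lemma Q_value_tendsto_P_value:
  fixes f :: "'n::finite mpoly"
  assumes deg: "total_degree f \<le> 2 * r0"
  shows "(\<lambda>r. Q_value f M r) \<longlonglongrightarrow> P_value f M"
proof -
  define Y where "Y r = (SOME y. Q_optimal f M r y)" for r
  have Y: "Q_optimal f M r (Y r)" for r unfolding Y_def by (rule someI_ex[OF Q_optimal_exists])
  have "\<bar>Y r \<alpha>\<bar> \<le> bound TYPE('n) M * fact (expo_deg \<alpha>) + 1" for r \<alpha>
    using Y[of r] by (intro Q_feasible_uniform_bound[where r = r]) (simp add: Q_optimal_def)
  then have "\<exists>y. accumulation_point Y y" by (rule accumulation_point_exists)
  then obtain y s where s: "strict_mono s" "\<And>\<alpha>. (\<lambda>k. Y (s k) \<alpha>) \<longlonglongrightarrow> y \<alpha>"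
    unfolding accumulation_point_def by blast
  have sub: "(\<lambda>k. Q_value f M (s k)) \<longlonglongrightarrow> P_value f M"
    by (rule accumulation_point_optimal(4)[OF deg Y s])
  \<comment> \<open>Monotonicity, valid from level \<open>r0\<close> on, provides a limit for the
    full sequence; the convergent subsequence identifies it.\<close>
  have "incseq (\<lambda>k. Q_value f M (k + r0))"
    using deg by (intro incseq_SucI Q_value_mono) auto
  then have "(\<lambda>k. Q_value f M (k + r0)) \<longlonglongrightarrow> (SUP k. Q_value f M (k + r0))" by (rule LIMSEQ_SUP)
  then have full: "(\<lambda>r. Q_value f M r) \<longlonglongrightarrow> (SUP k. Q_value f M (k + r0))" by (rule LIMSEQ_offset)
  then have "(\<lambda>k. Q_value f M (s k)) \<longlonglongrightarrow> (SUP k. Q_value f M (k + r0))"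
    using LIMSEQ_subseq_LIMSEQ[OF full s(1)] by (simp add: o_def)
  then show ?thesis using full sub LIMSEQ_unique by metis
qed

theorem theorem3p3:
  fixes f :: "'n::finite mpoly" and r_f :: nat and M :: int
  assumes "total_degree f = 2 * r_f"
    and "(INF x. ereal (poly_fun f x)) > -\<infinity>"
    and "M > 0"
  shows
    "((\<forall>r\<ge>r_f. \<exists>y. Q_optimal f M r y) \<and>
      (\<forall>r\<ge>r_f. \<forall>s\<ge>r. Q_value f M r \<le> Q_value f M s) \<and>
      (\<lambda>r. Q_value f M r) \<longlonglongrightarrow> P_value f M) \<and>
     (\<forall>Y :: nat \<Rightarrow> 'n expo \<Rightarrow> real. (\<forall>r\<ge>r_f. Q_optimal f M r (Y r)) \<longrightarrow>
       (\<forall>r\<ge>r_f. bounded (range (Y r))) \<and>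
       (\<forall>y. accumulation_point Y y \<longrightarrow>
          moment_seq y \<and> determinate y \<and>
          (\<exists>!\<mu>. prob_space \<mu> \<and> represents \<mu> y) \<and>
          (\<forall>\<mu>. prob_space \<mu> \<and> represents \<mu> y \<longrightarrow> P_optimal f M \<mu>))) \<and>
     (\<forall>r\<ge>r_f. (\<exists>d. D_optimal f M r d) \<and> D_value f M r = Q_value f M r)"
proof (intro conjI allI impI)
  have deg: "total_degree f \<le> 2 * r_f" using assms(1) by simp
  have deg': "total_degree f \<le> 2 * r" if "r_f \<le> r" for r using deg that by linarith
  show "\<exists>y. Q_optimal f M r y" for r by (rule Q_optimal_exists)
  show "Q_value f M r \<le> Q_value f M s" if "r_f \<le> r" "r \<le> s" for r s
    by (rule Q_value_mono[OF deg'[OF that(1)] that(2)])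
  show "(\<lambda>r. Q_value f M r) \<longlonglongrightarrow> P_value f M" by (rule Q_value_tendsto_P_value[OF deg])
  show "\<exists>d. D_optimal f M r d" "D_value f M r = Q_value f M r" if "r_f \<le> r" for r
    using strong_duality[OF deg'[OF that] assms(3)] by blast+
next
  fix Y :: "nat \<Rightarrow> 'n expo \<Rightarrow> real" and r
  assume Y: "\<forall>r\<ge>r_f. Q_optimal f M r (Y r)" and r: "r_f \<le> r"
  then have "Y r \<in> Q_feasible M r" by (simp add: Q_optimal_def)
  then show "bounded (range (Y r))"
    using Q_feasible_bounded[of "Y r" M r] by (intro boundedI[where B = "bound TYPE('n) M * fact r"]) auto
next
  fix Y :: "nat \<Rightarrow> 'n expo \<Rightarrow> real" and y
  assume Y: "\<forall>r\<ge>r_f. Q_optimal f M r (Y r)" and y: "accumulation_point Y y"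
  obtain s where s: "strict_mono s" "\<And>\<alpha>. (\<lambda>k. Y (s k) \<alpha>) \<longlonglongrightarrow> y \<alpha>"
    using y unfolding accumulation_point_def by blast
  have deg: "total_degree f \<le> 2 * r_f" using assms(1) by simp
  note acc = accumulation_point_optimal[OF deg Y[rule_format] s]
  show "moment_seq y" using acc(1) unfolding moment_seq_def by blast
  show "determinate y" using acc(1,2) unfolding determinate_def by blast
  show "\<exists>!\<mu>. prob_space \<mu> \<and> represents \<mu> y" using acc(1,2) by blast
  show "P_optimal f M \<mu>" if "prob_space \<mu> \<and> represents \<mu> y" for \<mu> using acc(3) that by blast
qed

end
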